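(* Let $\Phi:\Sigma\to\mathbb{S}^2\times\mathbb{S}^2$ be a minimal Lagrangian immersion of a simply-connected surface $\Sigma$ with $C^2<1/4$ everywhere. Then $\Phi$ is congruent to the Gauss map of a minimal immersion $\Psi:\Sigma\to\mathbb{S}^3\subset\mathbb{R}^4$ into the $3$-dimensional unit sphere of $\mathbb{R}^4$.
   Context: $\mathbb{S}^2\subset\mathbb{R}^3$ is the unit sphere with its standard metric $\langle\,,\rangle$, complex structure $J_xv=x\times v$ and area form $\omega_0(v,w)=\langle J_xv,w\rangle$. $\mathbb{S}^2\times\mathbb{S}^2$ carries the product metric, product complex structure $J$ and Kähler form $\omega=\pi_1^*\omega_0+\pi_2^*\omega_0$. An immersion $\Phi=(\phi,\psi):\Sigma\to\mathbb{S}^2\times\mathbb{S}^2$ of a surface is Lagrangian if $\Phi^*\omega=0$; $\Sigma$ is given the induced metric, and minimal means vanishing mean curvature vector. The function $C^2$ on $\Sigma$ is $C^2(p)=\langle Jd\phi_p(e_1),d\phi_p(e_2)\rangle^2$ for any orthonormal basis $\{e_1,e_2\}$ of $T_p\Sigma$. Gauss map: $\Lambda^2\mathbb{R}^4\cong\mathbb{R}^6$ has the inner product $\langle\langle v\wedge w,v'\wedge w'\rangle\rangle=\langle v,v'\rangle\langle w,w'\rangle-\langle v,w'\rangle\langle w,v'\rangle$. For an oriented orthonormal basis $\{e_1,\dots,e_4\}$ of $\mathbb{R}^4$, $\Lambda^2_\pm\mathbb{R}^4$ is the $3$-dimensional subspace with orthonormal basis $\frac1{\sqrt2}(e_1\wedge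 e_2\pm e_3\wedge e_4)$, $\frac1{\sqrt2}(e_1\wedge e_3\pm e_4\wedge e_2)$, $\frac1{\sqrt2}(e_1\wedge e_4\pm e_2\wedge e_3)$, and $\mathbb{S}^2_\pm$ is its unit sphere. The Grassmannian $G^+(2,4)$ of oriented $2$-planes in $\mathbb{R}^4$ is identified with $\mathbb{S}^2_+\times\mathbb{S}^2_-\cong\mathbb{S}^2\times\mathbb{S}^2$ by sending the plane with oriented orthonormal basis $\{v_1,v_2\}$ to $\left(\frac{1}{\sqrt2}(v_1\wedge v_2+v_3\wedge v_4),\frac{1}{\sqrt2}(v_1\wedge v_2-v_3\wedge v_4)\right)$, where $\{v_1,v_2,v_3,v_4\}$ is an oriented orthonormal basis of $\mathbb{R}^4$. The Gauss map of an immersion $\Psi$ of an oriented surface $\Sigma$ into $\mathbb{R}^4$ is $p\mapsto d\Psi_p(T_p\Sigma)\in G^+(2,4)\cong\mathbb{S}^2_+\times\mathbb{S}^2_-$. "Congruent" means equal up to composition with an isometry of $\mathbb{S}^2\times\mathbb{S}^2$. *)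

theory Defs
  imports "HOL-Analysis.Analysis"
begin

subsection \<open>Smooth maps between normed spaces\<close>

text \<open>The predicates below are meant for open \<open>U\<close>.  All directional derivatives of \<open>f\<close> are
  required to be \<open>C\<^sup>k\<close> for \<open>f\<close> to be \<open>C\<^sup>k\<^sup>+\<^sup>1\<close>.\<close>

primrec Ck_on :: "nat \<Rightarrow> ('a::real_normed_vector \<Rightarrow> 'b::real_normed_vector) \<Rightarrow> 'a set \<Rightarrow> bool" where
  "Ck_on 0 f U \<longleftrightarrow> continuous_on U f"
| "Ck_on (Suc k) f U \<longleftrightarrow>
     (\<forall>u\<in>U. f differentiable (at u)) \<and> (\<forall>v. Ck_on k (\<lambda>u. frechet_derivative f (at u) v) U)"

definition smooth_on :: "'a::real_normed_vector set \<Rightarrow> ('a \<Rightarrow> 'b::real_normed_vector) \<Rightarrow> bool" where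
  "smooth_on U f \<longleftrightarrow> (\<forall>k. Ck_on k f U)"

subsection \<open>Surfaces\<close>

text \<open>A surface is a set \<open>S\<close> in a second countable Hausdorff space, with the subspace topology, and an
  atlas of local parametrizations: \<open>(V, x)\<close> in the atlas stands for a homeomorphism \<open>x\<close> of the open
  set \<open>V\<close> in the plane onto a (relatively) open subset of \<open>S\<close>, so \<open>x\<close> is the inverse of a chart.
  The atlas need not be maximal.\<close>

type_synonym 'a atlas = "((real^2) set \<times> (real^2 \<Rightarrow> 'a)) set"

definition smooth_surface :: "'a::{t2_space,second_countable_topology} set \<Rightarrow> 'a atlas \<Rightarrow> bool" where
  "smooth_surface S A \<longleftrightarrow>
     (\<forall>(V, x)\<in>A. open V \<and> openin (top_of_set S) (x ` V) \<and>
                 homeomorphism V (x ` V) x (inv_into V x)) \<and>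
     (\<Union>(V, x)\<in>A. x ` V) = S \<and>
     (\<forall>(V, x)\<in>A. \<forall>(W, y)\<in>A. smooth_on (V \<inter> x -` (y ` W)) (inv_into W y \<circ> x))"

text \<open>An orientation of the surface \<open>(S, A)\<close>, given by an atlas \<open>B\<close> of the same smooth structure whose
  coordinate changes preserve the orientation of the plane.\<close>

definition oriented_atlas ::
    "'a::{t2_space,second_countable_topology} set \<Rightarrow> 'a atlas \<Rightarrow> 'a atlas \<Rightarrow> bool" where
  "oriented_atlas S A B \<longleftrightarrow>
     smooth_surface S B \<and> smooth_surface S (A \<union> B) \<and>
     (\<forall>(V, x)\<in>B. \<forall>(W, y)\<in>B. \<forall>u \<in> V \<inter> x -` (y ` W).
        det (jacobian (inv_into W y \<circ> x) (at u)) > 0)"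

subsection \<open>Immersions and mean curvature\<close>

definition immersion :: "'a atlas \<Rightarrow> ('a \<Rightarrow> 'e::euclidean_space) \<Rightarrow> bool" where
  "immersion A f \<longleftrightarrow>
     (\<forall>(V, x)\<in>A. smooth_on V (f \<circ> x) \<and> (\<forall>u\<in>V. inj (frechet_derivative (f \<circ> x) (at u))))"

text \<open>The image of the tangent space at \<open>p\<close> under the differential of \<open>f\<close>.  If \<open>f\<close> is an immersion,
  the tangent space with the induced metric is isometric to this plane.\<close>

definition tangent_image :: "'a atlas \<Rightarrow> ('a \<Rightarrow> 'e::euclidean_space) \<Rightarrow> 'a \<Rightarrow> 'e set" where
  "tangent_image A f p =
     {frechet_derivative (f \<circ> x) (at u) v | V x u v. (V, x) \<in> A \<and> u \<in> V \<and> x u = p}"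

text \<open>In the following three definitions \<open>X\<close> is a map from the plane to a Euclidean space (an immersion in
  local coordinates) and \<open>TN q\<close> is the tangent space at \<open>q\<close> of a submanifold \<open>N\<close> of that Euclidean
  space containing the image of \<open>X\<close>.  By the Gauss formula, the second fundamental form of \<open>X\<close>
  in \<open>N\<close> is the component of the Euclidean second derivative that is tangent to \<open>N\<close> and normal to \<open>X\<close>.\<close>

definition induced_metric :: "(real^2 \<Rightarrow> 'e::euclidean_space) \<Rightarrow> real^2 \<Rightarrow> real^2^2" where
  "induced_metric X u =
     (\<chi> i j. frechet_derivative X (at u) (axis i 1) \<bullet> frechet_derivative X (at u) (axis j 1))"

definition second_fundamental_form ::
    "('e \<Rightarrow> 'e set) \<Rightarrow> (real^2 \<Rightarrow> 'e::euclidean_space) \<Rightarrow> real^2 \<Rightarrow> real^2 \<Rightarrow> real^2 \<Rightarrow> 'e" where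
  "second_fundamental_form TN X u v w =
     closest_point {n \<in> TN (X u). \<forall>z. n \<bullet> frechet_derivative X (at u) z = 0}
       (frechet_derivative (\<lambda>y. frechet_derivative X (at y) w) (at u) v)"

definition mean_curvature_vector ::
    "('e \<Rightarrow> 'e set) \<Rightarrow> (real^2 \<Rightarrow> 'e::euclidean_space) \<Rightarrow> real^2 \<Rightarrow> 'e" where
  "mean_curvature_vector TN X u =
     (1/2) *\<^sub>R (\<Sum>i\<in>UNIV. \<Sum>j\<in>UNIV. (matrix_inv (induced_metric X u) $ i $ j) *\<^sub>R
               second_fundamental_form TN X u (axis i 1) (axis j 1))"

definition minimal_immersion ::
    "'a set \<Rightarrow> 'a atlas \<Rightarrow> 'e set \<Rightarrow> ('e \<Rightarrow> 'e set) \<Rightarrow> ('a \<Rightarrow> 'e::euclidean_space) \<Rightarrow> bool" where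
  "minimal_immersion S A N TN f \<longleftrightarrow>
     f ` S \<subseteq> N \<and> immersion A f \<and>
     (\<forall>(V, x)\<in>A. \<forall>u\<in>V. mean_curvature_vector TN (f \<circ> x) u = 0)"

subsection \<open>The ambient spaces\<close>

definition S3 :: "(real^4) set" where
  "S3 = sphere 0 1"

definition tangent_S3 :: "real^4 \<Rightarrow> (real^4) set" where
  "tangent_S3 q = {v. q \<bullet> v = 0}"

definition S2xS2 :: "((real^3) \<times> (real^3)) set" where
  "S2xS2 = sphere 0 1 \<times> sphere 0 1"

definition tangent_S2xS2 :: "(real^3) \<times> (real^3) \<Rightarrow> ((real^3) \<times> (real^3)) set" where
  "tangent_S2xS2 q = {v. fst q \<bullet> fst v = 0 \<and> snd q \<bullet> snd v = 0}"

definition J_S2xS2 :: "(real^3) \<times> (real^3) \<Rightarrow> (real^3) \<times> (real^3) \<Rightarrow> (real^3) \<times> (real^3)" where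
  "J_S2xS2 q v = (cross3 (fst q) (fst v), cross3 (snd q) (snd v))"

definition omega_S2xS2 :: "(real^3) \<times> (real^3) \<Rightarrow> (real^3) \<times> (real^3) \<Rightarrow> (real^3) \<times> (real^3) \<Rightarrow> real" where
  "omega_S2xS2 q v w = J_S2xS2 q v \<bullet> w"

text \<open>Riemannian isometries.  Smoothness of a map on the submanifold means that it extends to a smooth map on
  a neighbourhood; the extension has the differential of the map on tangent vectors.\<close>

definition isometry_S2xS2 :: "((real^3) \<times> (real^3) \<Rightarrow> (real^3) \<times> (real^3)) \<Rightarrow> bool" where
  "isometry_S2xS2 F \<longleftrightarrow>
     bij_betw F S2xS2 S2xS2 \<and>
     (\<exists>W G. open W \<and> S2xS2 \<subseteq> W \<and> smooth_on W G \<and> (\<forall>q\<in>S2xS2. G q = F q) \<and>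
        (\<forall>q\<in>S2xS2. \<forall>v\<in>tangent_S2xS2 q. \<forall>w\<in>tangent_S2xS2 q.
           frechet_derivative G (at q) v \<bullet> frechet_derivative G (at q) w = v \<bullet> w))"

subsection \<open>Lagrangian immersions into the product of spheres\<close>

definition lagrangian :: "'a atlas \<Rightarrow> ('a \<Rightarrow> (real^3) \<times> (real^3)) \<Rightarrow> bool" where
  "lagrangian A \<Phi> \<longleftrightarrow>
     (\<forall>(V, x)\<in>A. \<forall>u\<in>V. \<forall>v w.
        omega_S2xS2 (\<Phi> (x u)) (frechet_derivative (\<Phi> \<circ> x) (at u) v)
                               (frechet_derivative (\<Phi> \<circ> x) (at u) w) = 0)"

text \<open>An orthonormal basis \<open>e\<^sub>1, e\<^sub>2\<close> of the tangent space is represented by its image under the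
  differential of \<open>\<Phi> = (\<phi>, \<psi>)\<close>, so \<open>fst E\<^sub>i\<close> is the value of the differential of \<open>\<phi>\<close> at \<open>e\<^sub>i\<close>.  The value does
  not depend on the basis.\<close>

definition C_squared :: "'a atlas \<Rightarrow> ('a \<Rightarrow> (real^3) \<times> (real^3)) \<Rightarrow> 'a \<Rightarrow> real" where
  "C_squared A \<Phi> p =
     (THE c. \<forall>E\<^sub>1 \<in> tangent_image A \<Phi> p. \<forall>E\<^sub>2 \<in> tangent_image A \<Phi> p.
        norm E\<^sub>1 = 1 \<and> norm E\<^sub>2 = 1 \<and> E\<^sub>1 \<bullet> E\<^sub>2 = 0 \<longrightarrow>
        (cross3 (fst (\<Phi> p)) (fst E\<^sub>1) \<bullet> fst E\<^sub>2)\<^sup>2 = c)"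

subsection \<open>Bivectors and the Gauss map\<close>

text \<open>Bivectors of the Euclidean 4-space are represented by skew-symmetric matrices.\<close>

definition wedge :: "real^4 \<Rightarrow> real^4 \<Rightarrow> real^4^4" where
  "wedge v w = (\<chi> i j. v $ i * w $ j - w $ i * v $ j)"

definition bivector_inner :: "real^4^4 \<Rightarrow> real^4^4 \<Rightarrow> real" where
  "bivector_inner \<alpha> \<beta> = (\<alpha> \<bullet> \<beta>) / 2"

lemma bivector_inner_wedge:
  "bivector_inner (wedge v w) (wedge v' w') = (v \<bullet> v') * (w \<bullet> w') - (v \<bullet> w') * (w \<bullet> v')"
  unfolding bivector_inner_def wedge_def inner_vec_def
  by (simp add: sum_4 field_simps)

text \<open>The orthonormal bases of the spaces of self-dual (\<open>s = 1\<close>) and anti-self-dual (\<open>s = -1\<close>) bivectors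
  belonging to the standard basis of the 4-space, and the resulting coordinates.\<close>

definition dual_basis :: "real \<Rightarrow> real^4^4^3" where
  "dual_basis s =
     vector [(1 / sqrt 2) *\<^sub>R (wedge (axis 1 1) (axis 2 1) + s *\<^sub>R wedge (axis 3 1) (axis 4 1)),
             (1 / sqrt 2) *\<^sub>R (wedge (axis 1 1) (axis 3 1) + s *\<^sub>R wedge (axis 4 1) (axis 2 1)),
             (1 / sqrt 2) *\<^sub>R (wedge (axis 1 1) (axis 4 1) + s *\<^sub>R wedge (axis 2 1) (axis 3 1))]"

definition dual_coords :: "real \<Rightarrow> real^4^4 \<Rightarrow> real^3" where
  "dual_coords s \<alpha> = (\<chi> k. bivector_inner \<alpha> (dual_basis s $ k))"

definition plane_to_spheres :: "real^4 \<Rightarrow> real^4 \<Rightarrow> real^4 \<Rightarrow> real^4 \<Rightarrow> (real^3) \<times> (real^3)" where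
  "plane_to_spheres v\<^sub>1 v\<^sub>2 v\<^sub>3 v\<^sub>4 =
     (dual_coords 1 ((1 / sqrt 2) *\<^sub>R (wedge v\<^sub>1 v\<^sub>2 + wedge v\<^sub>3 v\<^sub>4)),
      dual_coords (-1) ((1 / sqrt 2) *\<^sub>R (wedge v\<^sub>1 v\<^sub>2 - wedge v\<^sub>3 v\<^sub>4)))"

text \<open>\<open>(v\<^sub>1, v\<^sub>2)\<close> is the image under the differential of \<open>\<Psi>\<close> of a positively oriented frame of the tangent
  space at \<open>p\<close>, with respect to the orientation defined by the oriented atlas \<open>B\<close>.\<close>

definition positive_frame :: "'a atlas \<Rightarrow> ('a \<Rightarrow> real^4) \<Rightarrow> 'a \<Rightarrow> real^4 \<Rightarrow> real^4 \<Rightarrow> bool" where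
  "positive_frame B \<Psi> p v\<^sub>1 v\<^sub>2 \<longleftrightarrow>
     (\<exists>(V, x)\<in>B. \<exists>u\<in>V. x u = p \<and>
        (\<exists>a b. det (vector [a, b] :: real^2^2) > 0 \<and>
           v\<^sub>1 = frechet_derivative (\<Psi> \<circ> x) (at u) a \<and>
           v\<^sub>2 = frechet_derivative (\<Psi> \<circ> x) (at u) b))"

text \<open>The value does not depend on the oriented orthonormal basis chosen.\<close>

definition gauss_map :: "'a atlas \<Rightarrow> ('a \<Rightarrow> real^4) \<Rightarrow> 'a \<Rightarrow> (real^3) \<times> (real^3)" where
  "gauss_map B \<Psi> p =
     (THE q. \<forall>v\<^sub>1 v\<^sub>2 v\<^sub>3 v\<^sub>4.
        positive_frame B \<Psi> p v\<^sub>1 v\<^sub>2 \<and> rotation_matrix (vector [v\<^sub>1, v\<^sub>2, v\<^sub>3, v\<^sub>4] :: real^4^4) \<longrightarrow>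
        plane_to_spheres v\<^sub>1 v\<^sub>2 v\<^sub>3 v\<^sub>4 = q)"

end

theory Submission
  imports Defs
begin

text \<open>Identify \<open>\<real>\<^sup>4\<close> with the quaternions and write \<open>\<Phi> = (\<phi>, \<psi>)\<close> with imaginary unit quaternions.  The oriented plane
  with Gauss image \<open>(\<phi>, \<psi>)\<close> is \<open>{x. \<phi> x = x \<psi>}\<close>, so a hypersurface \<open>q\<close> of the 3-sphere has Gauss map
  \<open>\<Phi>\<close> iff \<open>q\<close> is a unit section of the complementary bundle \<open>{x. \<phi> x = - x \<psi>}\<close> that is parallel in the normal
  connection; \<open>\<phi> q\<close> is then its unit normal.  The Lagrangian condition says that this connection is flat, but no
  differential equation has to be solved: minimality of \<open>q\<close> amounts to one further algebraic condition, which at every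
  point leaves exactly the four values \<open>q, - q, \<phi> q, - \<phi> q\<close>.  Over the simply connected surface a continuous choice
  exists, and minimality of \<open>\<Phi>\<close> (constancy of the Lagrangian angle) makes every continuous choice parallel.  Finally
  \<open>C\<^sup>2 < 1/4\<close> excludes the points where \<open>q\<close> or its normal fails to be an immersion.  Hence no isometry other than
  the identity is needed.\<close>

subsection \<open>Smooth maps\<close>

text \<open>With left multiplication by \<phi> as \<open>i\<close>, the tangent plane is a complex
  line, and d\<phi> q and q d\<psi> become one-forms \<alpha> and \<beta> on the surface. Turning q
  by \<theta> in the normal plane multiplies the 2-form cnj \<alpha> \<and> \<beta>, which has no
  zero on a Lagrangian immersion, by exp(2 i \<theta>); the extra condition is that its real part
  vanishes, which fixes \<theta> modulo a quarter turn. It is the right condition because q and its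
  normal have derivatives i(\<alpha> + \<beta>)/2 and (\<alpha> - \<beta>)/2: with the Lagrangian
  equation it gives \<alpha> - \<beta> = \<mu> cnj(\<alpha> + \<beta>) wherever \<alpha> + \<beta>
  is not zero, and the resulting second fundamental form is trace-free. The metric of \<Phi> is then
  (1 + |\<mu>|^2)/2 times |\<alpha> + \<beta>|^2, and C = +-(1 - |\<mu>|^2)/(2(1 + |\<mu>|^2)). So
  C^2 = 1/4 exactly where one of \<alpha> - \<beta>, \<alpha> + \<beta> vanishes, which is where the
  bound comes from.\<close>

lemma Ck_on_cong:
  fixes f :: "'a::real_normed_vector \<Rightarrow> 'b::real_normed_vector"
  assumes "open U" "\<And>u. u \<in> U \<Longrightarrow> f u = g u" "Ck_on k f U"
  shows "Ck_on k g U"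
  using assms
proof (induction k arbitrary: f g)
  case 0
  then show ?case by (simp cong: continuous_on_cong)
next
  case (Suc k)
  have fd: "f differentiable (at u)" if "u \<in> U" for u using Suc.prems that by simp
  have gd: "(g has_derivative frechet_derivative f (at u)) (at u)" if "u \<in> U" for u
    using has_derivative_transform_within_open[of f _ u UNIV U g] fd[OF that] Suc.prems(1,2) that
    by (auto simp: frechet_derivative_works)
  have eq: "frechet_derivative f (at u) v = frechet_derivative g (at u) v" if "u \<in> U" for u v
    using frechet_derivative_at[OF gd[OF that]] by simp
  show ?case
    using Suc.IH[OF Suc.prems(1) eq] Suc.prems(3) gd
    by (auto simp: differentiable_def)
qed

text \<open>Any family \<open>D\<close> of derivatives may be supplied, so the closure proofs need
  no explicit \<open>frechet_derivative\<close> of a compound map.\<close>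

lemma Ck_on_SucI:
  fixes f :: "'a::real_normed_vector \<Rightarrow> 'b::real_normed_vector"
  assumes "open U" "\<And>u. u \<in> U \<Longrightarrow> (f has_derivative D u) (at u)" "\<And>v. Ck_on k (\<lambda>u. D u v) U"
  shows "Ck_on (Suc k) f U"
proof -
  have "Ck_on k (\<lambda>u. frechet_derivative f (at u) v) U" for v
    by (rule Ck_on_cong[OF assms(1) _ assms(3)[of v]]) (use frechet_derivative_at[OF assms(2)] in metis)
  then show ?thesis using assms(2) by (auto simp: differentiable_def)
qed

lemma Ck_on_Suc_imp_has_derivative:
  "Ck_on (Suc k) f U \<Longrightarrow> u \<in> U \<Longrightarrow> (f has_derivative frechet_derivative f (at u)) (at u)"
  by (simp add: frechet_derivative_works[symmetric])

lemma Ck_on_SucD: "Ck_on (Suc k) f U \<Longrightarrow> Ck_on k f U"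
proof (induction k arbitrary: f)
  case 0
  then show ?case
    by (auto intro!: continuous_at_imp_continuous_on differentiable_imp_continuous_within)
qed auto

lemma Ck_on_subset: "Ck_on k f U \<Longrightarrow> W \<subseteq> U \<Longrightarrow> Ck_on k f W"
  by (induction k arbitrary: f) (auto intro: continuous_on_subset)

lemma Ck_on_const: "open U \<Longrightarrow> Ck_on k (\<lambda>_. c) U"
  by (induction k arbitrary: c) auto

lemma Ck_on_ident: "Ck_on k (\<lambda>x. x) UNIV"
  by (cases k) (auto simp: Ck_on_const)

lemma Ck_on_bounded_linear:
  assumes "bounded_linear L" "open U" "Ck_on k f U"
  shows "Ck_on k (\<lambda>u. L (f u)) U"
  using assms(3)
proof (induction k arbitrary: f)
  case 0
  then show ?case using assms(1) by (simp add: bounded_linear.continuous_on)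
next
  case (Suc k)
  show ?case
    by (rule Ck_on_SucI[OF assms(2), of _ "\<lambda>u v. L (frechet_derivative f (at u) v)"])
      (use Suc in \<open>auto intro!: bounded_linear.has_derivative[OF assms(1)] simp: frechet_derivative_works[symmetric]\<close>)
qed

lemma Ck_on_add:
  assumes "open U" "Ck_on k f U" "Ck_on k g U"
  shows "Ck_on k (\<lambda>u. f u + g u) U"
  using assms(2,3)
proof (induction k arbitrary: f g)
  case 0
  then show ?case by (auto intro: continuous_intros)
next
  case (Suc k)
  show ?case
    by (rule Ck_on_SucI[OF assms(1), of _ "\<lambda>u v. frechet_derivative f (at u) v + frechet_derivative g (at u) v"])
      (use Suc in \<open>auto intro!: has_derivative_add simp: frechet_derivative_works[symmetric]\<close>)
qed

lemma Ck_on_bilinear: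
  assumes "bounded_bilinear B" "open U" "Ck_on k f U" "Ck_on k g U"
  shows "Ck_on k (\<lambda>u. B (f u) (g u)) U"
  using assms(3,4)
proof (induction k arbitrary: f g)
  case 0
  then show ?case using assms(1) by (simp add: bounded_bilinear.continuous_on)
next
  case (Suc k)
  show ?case
  proof (rule Ck_on_SucI[OF assms(2)])
    show "((\<lambda>u. B (f u) (g u)) has_derivative
       (\<lambda>h. B (f u) (frechet_derivative g (at u) h) + B (frechet_derivative f (at u) h) (g u))) (at u)"
      if "u \<in> U" for u
      using Suc.prems that
      by (intro bounded_bilinear.FDERIV[OF assms(1)]) (auto simp: frechet_derivative_works[symmetric])
    show "Ck_on k (\<lambda>u. B (f u) (frechet_derivative g (at u) v) + B (frechet_derivative f (at u) v) (g u)) U" for v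
      using Suc.prems Ck_on_SucD[OF Suc.prems(1)] Ck_on_SucD[OF Suc.prems(2)]
      by (intro Ck_on_add assms(2) Suc.IH) auto
  qed
qed

lemma Ck_on_compose_linear:
  assumes "bounded_linear L" "open U" "Ck_on k f U"
  shows "Ck_on k (\<lambda>u. f (L u)) (L -` U)"
  using assms(3)
proof (induction k arbitrary: f)
  case 0
  have "continuous_on (L -` U) L" using assms(1) by (simp add: linear_continuous_on)
  with 0 show ?case by (auto intro!: continuous_on_compose2[of U f "L -` U" L])
next
  case (Suc k)
  have op: "open (L -` U)"
    using assms(1,2) by (intro open_vimage linear_continuous_on)
  show ?case
  proof (rule Ck_on_SucI[OF op])
    show "((\<lambda>u. f (L u)) has_derivative (\<lambda>v. frechet_derivative f (at (L u)) (L v))) (at u)"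
      if "u \<in> L -` U" for u
      using Suc.prems that
      by (intro has_derivative_compose[OF bounded_linear_imp_has_derivative[OF assms(1)]])
        (auto simp: frechet_derivative_works[symmetric])
    show "Ck_on k (\<lambda>u. frechet_derivative f (at (L u)) (L v)) (L -` U)" for v
      using Suc.IH[of "\<lambda>u. frechet_derivative f (at u) (L v)"] Suc.prems by simp
  qed
qed

lemma smooth_on_has_derivative:
  "smooth_on U f \<Longrightarrow> u \<in> U \<Longrightarrow> (f has_derivative frechet_derivative f (at u)) (at u)"
  unfolding smooth_on_def by (rule Ck_on_Suc_imp_has_derivative[of 0]) auto

lemma smooth_on_frechet_derivative:
  "smooth_on U f \<Longrightarrow> smooth_on U (\<lambda>u. frechet_derivative f (at u) v)"
  unfolding smooth_on_def by (metis Ck_on.simps(2))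

lemma smooth_on_cong:
  assumes "open U" "\<And>u. u \<in> U \<Longrightarrow> f u = g u" "smooth_on U f"
  shows "smooth_on U g"
  using assms Ck_on_cong[of U f g] unfolding smooth_on_def by blast

lemma smooth_on_subset: "smooth_on U f \<Longrightarrow> W \<subseteq> U \<Longrightarrow> smooth_on W f"
  unfolding smooth_on_def by (blast intro: Ck_on_subset)

lemma smooth_on_bounded_linear:
  "bounded_linear L \<Longrightarrow> open U \<Longrightarrow> smooth_on U f \<Longrightarrow> smooth_on U (\<lambda>u. L (f u))"
  unfolding smooth_on_def by (blast intro: Ck_on_bounded_linear)

lemma smooth_on_compose_linear:
  "bounded_linear L \<Longrightarrow> open U \<Longrightarrow> smooth_on U f \<Longrightarrow> smooth_on (L -` U) (\<lambda>u. f (L u))"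
  unfolding smooth_on_def by (blast intro: Ck_on_compose_linear)

lemma smooth_on_imp_continuous_on: "smooth_on U f \<Longrightarrow> continuous_on U f"
  unfolding smooth_on_def by (metis Ck_on.simps(1))

text \<open>Both mixed derivatives are limits of the second difference of \<open>f\<close> over small parallelograms, by the
  mean value theorem applied twice.\<close>

lemma second_difference_mean_value:
  fixes f :: "'a::real_normed_vector \<Rightarrow> real"
  assumes U: "open U" "ball u d \<subseteq> U" and f: "Ck_on 2 f U"
    and h: "0 < h" "h * (norm v + norm w) < d"
  shows "\<exists>z. dist z u \<le> h * (norm v + norm w) \<and>
    f (u + h *\<^sub>R v + h *\<^sub>R w) - f (u + h *\<^sub>R v) - f (u + h *\<^sub>R w) + f u =
    h^2 * frechet_derivative (\<lambda>y. frechet_derivative f (at y) v) (at z) w"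
proof -
  let ?f1 = "\<lambda>y. frechet_derivative f (at y) v"
  have fd: "(f has_derivative frechet_derivative f (at y)) (at y)" if "y \<in> U" for y
    using f that by (simp add: numeral_2_eq_2 frechet_derivative_works[symmetric])
  have f1d: "(?f1 has_derivative frechet_derivative ?f1 (at y)) (at y)" if "y \<in> U" for y
    using f that by (simp add: numeral_2_eq_2 frechet_derivative_works[symmetric])
  have inU: "u + s *\<^sub>R v + t *\<^sub>R w \<in> U \<and> dist (u + s *\<^sub>R v + t *\<^sub>R w) u \<le> h * (norm v + norm w)"
    if "0 \<le> s" "s \<le> h" "0 \<le> t" "t \<le> h" for s t
  proof -
    have "norm (s *\<^sub>R v + t *\<^sub>R w) \<le> s * norm v + t * norm w"
      using norm_triangle_ineq[of "s *\<^sub>R v" "t *\<^sub>R w"] that by simp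
    also have "\<dots> \<le> h * norm v + h * norm w"
      using that by (intro add_mono mult_right_mono) auto
    finally have "dist (u + s *\<^sub>R v + t *\<^sub>R w) u \<le> h * (norm v + norm w)"
      by (simp add: dist_norm algebra_simps)
    then show ?thesis using U h by (auto simp: dist_commute subset_iff)
  qed
  have scale: "frechet_derivative g (at y) (c *\<^sub>R x) = c * frechet_derivative g (at y) x"
    if "(g has_derivative frechet_derivative g (at y)) (at y)" for g :: "'a \<Rightarrow> real" and y c x
    using has_derivative_linear[OF that] by (simp add: linear_scale)
  let ?g = "\<lambda>s. f (u + s *\<^sub>R v + h *\<^sub>R w) - f (u + s *\<^sub>R v)"
  have "\<exists>s\<in>{0<..<h}. ?g h - ?g 0 =
      (\<lambda>x. frechet_derivative f (at (u + s *\<^sub>R v + h *\<^sub>R w)) (x *\<^sub>R v)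
          - frechet_derivative f (at (u + s *\<^sub>R v)) (x *\<^sub>R v)) (h - 0)"
  proof (rule mvt_simple[OF h(1)])
    fix s assume s: "0 \<le> s" "s \<le> h"
    have 1: "((\<lambda>s. u + s *\<^sub>R v + h *\<^sub>R w) has_derivative (\<lambda>x. x *\<^sub>R v)) (at s within {0..h})"
      by (auto intro!: derivative_eq_intros)
    have 2: "((\<lambda>s. u + s *\<^sub>R v) has_derivative (\<lambda>x. x *\<^sub>R v)) (at s within {0..h})"
      by (auto intro!: derivative_eq_intros)
    have "u + s *\<^sub>R v + h *\<^sub>R w \<in> U" "u + s *\<^sub>R v \<in> U"
      using inU[of s h] inU[of s 0] s h(1) by auto
    then show "(?g has_derivative (\<lambda>x. frechet_derivative f (at (u + s *\<^sub>R v + h *\<^sub>R w)) (x *\<^sub>R v)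
          - frechet_derivative f (at (u + s *\<^sub>R v)) (x *\<^sub>R v))) (at s within {0..h})"
      by (intro has_derivative_diff has_derivative_compose[OF 1 fd] has_derivative_compose[OF 2 fd])
  qed
  then obtain s where s: "0 < s" "s < h" and
    "?g h - ?g 0 = frechet_derivative f (at (u + s *\<^sub>R v + h *\<^sub>R w)) (h *\<^sub>R v)
          - frechet_derivative f (at (u + s *\<^sub>R v)) (h *\<^sub>R v)" by auto
  moreover have "u + s *\<^sub>R v + h *\<^sub>R w \<in> U" "u + s *\<^sub>R v \<in> U"
    using inU[of s h] inU[of s 0] s h(1) by auto
  ultimately have eq1: "?g h - ?g 0 = h * (?f1 (u + s *\<^sub>R v + h *\<^sub>R w) - ?f1 (u + s *\<^sub>R v))"
    by (simp add: scale[OF fd] algebra_simps)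
  have "\<exists>t\<in>{0<..<h}. ?f1 (u + s *\<^sub>R v + h *\<^sub>R w) - ?f1 (u + s *\<^sub>R v + 0 *\<^sub>R w) =
     (\<lambda>x. frechet_derivative ?f1 (at (u + s *\<^sub>R v + t *\<^sub>R w)) (x *\<^sub>R w)) (h - 0)"
  proof (rule mvt_simple[OF h(1)])
    fix t assume t: "0 \<le> t" "t \<le> h"
    have 1: "((\<lambda>t. u + s *\<^sub>R v + t *\<^sub>R w) has_derivative (\<lambda>x. x *\<^sub>R w)) (at t within {0..h})"
      by (auto intro!: derivative_eq_intros)
    show "((\<lambda>t. ?f1 (u + s *\<^sub>R v + t *\<^sub>R w)) has_derivative
        (\<lambda>x. frechet_derivative ?f1 (at (u + s *\<^sub>R v + t *\<^sub>R w)) (x *\<^sub>R w))) (at t within {0..h})"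
      using inU[of s t] s t by (intro has_derivative_compose[OF 1 f1d]) auto
  qed
  then obtain t where t: "0 < t" "t < h" and
    eq2: "?f1 (u + s *\<^sub>R v + h *\<^sub>R w) - ?f1 (u + s *\<^sub>R v) =
      frechet_derivative ?f1 (at (u + s *\<^sub>R v + t *\<^sub>R w)) (h *\<^sub>R w)" by auto
  have "u + s *\<^sub>R v + t *\<^sub>R w \<in> U" using inU[of s t] s t by auto
  then have "?g h - ?g 0 = h^2 * frechet_derivative ?f1 (at (u + s *\<^sub>R v + t *\<^sub>R w)) w"
    using eq1 eq2 scale[OF f1d] by (simp add: power2_eq_square)
  then show ?thesis using inU[of s t] s t
    by (intro exI[of _ "u + s *\<^sub>R v + t *\<^sub>R w"]) auto
qed

lemma mixed_derivatives_commute_real: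
  fixes f :: "'a::real_normed_vector \<Rightarrow> real"
  assumes U: "open U" "u \<in> U" and f: "Ck_on 2 f U"
  shows "frechet_derivative (\<lambda>y. frechet_derivative f (at y) v) (at u) w =
         frechet_derivative (\<lambda>y. frechet_derivative f (at y) w) (at u) v"
proof -
  define F where "F v w z = frechet_derivative (\<lambda>y. frechet_derivative f (at y) v) (at z) w" for v w z
  have cont: "continuous (at u) (F v w)" for v w
  proof -
    have "continuous_on U (\<lambda>z. frechet_derivative (\<lambda>y. frechet_derivative f (at y) v) (at z) w)"
      using f by (simp add: numeral_2_eq_2)
    then show ?thesis using U by (simp add: F_def[abs_def] continuous_on_eq_continuous_at)
  qed
  have "\<bar>F v w u - F w v u\<bar> \<le> e" if e: "e > 0" for e
  proof -
    obtain d0 where d0: "d0 > 0" "ball u d0 \<subseteq> U" using U open_contains_ball by blast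
    have "\<exists>d>0. \<forall>z. dist z u < d \<longrightarrow> dist (F v w z) (F v w u) < e/2" for v w
      using cont[of v w] e unfolding continuous_at_eps_delta by (metis half_gt_zero_iff)
    then obtain d1 d2 where d1: "d1 > 0" "\<And>z. dist z u < d1 \<Longrightarrow> dist (F v w z) (F v w u) < e/2"
      and d2: "d2 > 0" "\<And>z. dist z u < d2 \<Longrightarrow> dist (F w v z) (F w v u) < e/2" by metis
    define d where "d = min d0 (min d1 d2)"
    \<comment> \<open>The summand 1 keeps the denominator positive when
      \<open>v = w = 0\<close>.\<close>
    define h where "h = d / (2 * (norm v + norm w + 1))"
    have d: "d > 0" using d0 d1 d2 by (simp add: d_def)
    have h0: "h > 0" using d by (auto simp: h_def intro!: divide_pos_pos add_nonneg_pos)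
    have nn: "norm v + norm w + 1 > 0" by (simp add: add_nonneg_pos)
    have "h * (norm v + norm w) < h * (2 * (norm v + norm w + 1))"
      using h0 by (intro mult_strict_left_mono) (auto simp: add_nonneg_pos intro: order.strict_trans2[of _ "norm v + norm w + 1"])
    also have "\<dots> = d" using nn by (simp add: h_def)
    finally have h: "h * (norm v + norm w) < d" .
    have b: "ball u d \<subseteq> U" using d0 by (auto simp: d_def)
    obtain z1 where "dist z1 u \<le> h * (norm v + norm w)" and
      e1: "f (u + h *\<^sub>R v + h *\<^sub>R w) - f (u + h *\<^sub>R v) - f (u + h *\<^sub>R w) + f u = h^2 * F v w z1"
      using second_difference_mean_value[OF U(1) b f h0 h] unfolding F_def by blast
    moreover obtain z2 where "dist z2 u \<le> h * (norm w + norm v)" and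
      e2: "f (u + h *\<^sub>R w + h *\<^sub>R v) - f (u + h *\<^sub>R w) - f (u + h *\<^sub>R v) + f u = h^2 * F w v z2"
      using second_difference_mean_value[OF U(1) b f h0, of w v] h unfolding F_def
      by (metis add.commute)
    ultimately have z1: "dist z1 u < d" and z2: "dist z2 u < d" using h by (auto simp: add.commute)
    have eq: "u + h *\<^sub>R w + h *\<^sub>R v = u + h *\<^sub>R v + h *\<^sub>R w" by (simp add: add_ac)
    have "h^2 * F v w z1 = h^2 * F w v z2" using e1 e2[unfolded eq] by linarith
    then have "F v w z1 = F w v z2" using h0 by simp
    moreover have "dist (F v w z1) (F v w u) < e/2" "dist (F w v z2) (F w v u) < e/2"
      using z1 z2 d1 d2 by (auto simp: d_def)
    ultimately show ?thesis unfolding dist_real_def by linarith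
  qed
  then have "F v w u = F w v u" by (metis abs_le_zero_iff dense_ge eq_iff_diff_eq_0)
  then show ?thesis by (simp add: F_def)
qed

lemma mixed_derivatives_commute:
  fixes f :: "'a::real_normed_vector \<Rightarrow> 'b::euclidean_space"
  assumes U: "open U" "u \<in> U" and f: "Ck_on 2 f U"
  shows "frechet_derivative (\<lambda>y. frechet_derivative f (at y) v) (at u) w =
         frechet_derivative (\<lambda>y. frechet_derivative f (at y) w) (at u) v"
proof (rule euclidean_eqI)
  fix b :: 'b assume "b \<in> Basis"
  let ?g = "\<lambda>y. f y \<bullet> b"
  have L: "bounded_linear (\<lambda>y::'b. y \<bullet> b)" by (rule bounded_linear_inner_left)
  have comp: "frechet_derivative (\<lambda>y. frechet_derivative f (at y) v) (at u) w \<bullet> b =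
      frechet_derivative (\<lambda>y. frechet_derivative ?g (at y) v) (at u) w" for v w
  proof -
    have 1: "frechet_derivative ?g (at y) v = frechet_derivative f (at y) v \<bullet> b" if "y \<in> U" for y v
    proof -
      have "(f has_derivative frechet_derivative f (at y)) (at y)"
        using f that by (simp add: numeral_2_eq_2 frechet_derivative_works[symmetric])
      from bounded_linear.has_derivative[OF L this] show ?thesis
        using frechet_derivative_at by metis
    qed
    have "((\<lambda>y. frechet_derivative f (at y) v) has_derivative
        frechet_derivative (\<lambda>y. frechet_derivative f (at y) v) (at u)) (at u)"
      using f U by (simp add: numeral_2_eq_2 frechet_derivative_works[symmetric])
    from bounded_linear.has_derivative[OF L this]
    have "((\<lambda>y. frechet_derivative ?g (at y) v) has_derivative
        (\<lambda>w. frechet_derivative (\<lambda>y. frechet_derivative f (at y) v) (at u) w \<bullet> b)) (at u)"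
      by (rule has_derivative_transform_within_open[OF _ U]) (simp add: 1)
    then show ?thesis using frechet_derivative_at by metis
  qed
  show "frechet_derivative (\<lambda>y. frechet_derivative f (at y) v) (at u) w \<bullet> b =
        frechet_derivative (\<lambda>y. frechet_derivative f (at y) w) (at u) v \<bullet> b"
    unfolding comp
    by (rule mixed_derivatives_commute_real[OF U Ck_on_bounded_linear[OF L U(1) f]])
qed

subsection \<open>Sections of discrete bundles over simply connected spaces\<close>

text \<open>No topology is put on the union of the fibres \<open>K p\<close>: local sections through
  every point of every fibre, together with the uniform gap \<delta>, stand in for a covering map
  over \<open>S\<close>.\<close>

context
  fixes K :: "'a::t2_space \<Rightarrow> 'b::real_normed_vector set"
    and S :: "'a set" and \<delta> :: real
  assumes loc: "\<And>p. p \<in> S \<Longrightarrow> \<exists>U. p \<in> U \<and> openin (top_of_set S) U \<and> path_connected U \<and>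
      (\<forall>x\<in>U. \<forall>k\<in>K x. \<exists>f. continuous_on U f \<and> f x = k \<and> (\<forall>y\<in>U. f y \<in> K y))"
    and ne: "\<And>p. p \<in> S \<Longrightarrow> K p \<noteq> {}"
    and \<delta>: "0 < \<delta>"
    and sep: "\<And>p k k'. p \<in> S \<Longrightarrow> k \<in> K p \<Longrightarrow> k' \<in> K p \<Longrightarrow> k \<noteq> k' \<Longrightarrow> \<delta> \<le> dist k k'"
begin

text \<open>The distance of the two lifts is continuous and takes no value strictly between 0 and
  \<delta>, so on a connected set it stays 0 once it is 0.\<close>

lemma discrete_lift_unique:
  fixes T :: "'c::topological_space set"
  assumes "connected T" and g: "g ` T \<subseteq> S"
    and f1: "continuous_on T f1" "\<And>t. t \<in> T \<Longrightarrow> f1 t \<in> K (g t)"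
    and f2: "continuous_on T f2" "\<And>t. t \<in> T \<Longrightarrow> f2 t \<in> K (g t)"
    and a: "a \<in> T" "f1 a = f2 a" and t: "t \<in> T"
  shows "f1 t = f2 t"
proof (rule ccontr)
  assume neq: "f1 t \<noteq> f2 t"
  let ?d = "\<lambda>t. dist (f1 t) (f2 t)"
  have "connected (?d ` T)"
    by (intro connected_continuous_image continuous_intros assms)
  moreover have "0 \<in> ?d ` T" using a by force
  moreover have "?d t \<in> ?d ` T" using t by blast
  moreover have "\<delta> \<le> ?d t" using sep[of "g t"] g t f1 f2 neq by blast
  ultimately have "\<delta>/2 \<in> ?d ` T"
    using \<delta> connectedD_interval[of "?d ` T" 0 "?d t" "\<delta>/2"] by auto
  then obtain s where "s \<in> T" "?d s = \<delta>/2" by force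
  then show False using sep[of "g s" "f1 s" "f2 s"] g f1 f2 \<delta> by force
qed

text \<open>Pulled back along \<open>g\<close> to a subset of a normed space, the bundle becomes a
  covering in the usual sense, to which path and homotopy lifting apply. The sheets are the graphs
  of the local sections: open because of the gap \<delta>, disjoint because sections over a path
  connected set that meet once agree.\<close>

lemma discrete_covering_space:
  fixes T :: "'c::real_normed_vector set"
  assumes g: "continuous_on T g" "g ` T \<subseteq> S"
  shows "covering_space {(z, k). z \<in> T \<and> k \<in> K (g z)} fst T" (is "covering_space ?c _ _")
  unfolding covering_space_def
proof (intro conjI ballI)
  show "continuous_on ?c fst" by (intro continuous_intros)
  show "fst ` ?c = T" using ne g by force
  fix z0 assume z0: "z0 \<in> T"
  then have "g z0 \<in> S" using g by blast
  then obtain U where U: "g z0 \<in> U" "openin (top_of_set S) U" "path_connected U"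
    and sec: "\<And>x k. x \<in> U \<Longrightarrow> k \<in> K x \<Longrightarrow> \<exists>f. continuous_on U f \<and> f x = k \<and> (\<forall>y\<in>U. f y \<in> K y)"
    using loc[of "g z0"] by metis
  have US: "U \<subseteq> S" using U(2) openin_imp_subset by blast
  define W where "W = T \<inter> g -` U"
  have W: "openin (top_of_set T) W"
    unfolding W_def using continuous_on_open_gen[of g T S] g U(2) by blast
  define F where "F = {f. continuous_on U f \<and> (\<forall>y\<in>U. f y \<in> K y)}"
  define G where "G f = (\<lambda>z. (z, f (g z))) ` W" for f :: "'a \<Rightarrow> 'b"
  have gW: "continuous_on W g" "g ` W \<subseteq> U" using g by (auto simp: W_def intro: continuous_on_subset)
  have fgW: "continuous_on W (\<lambda>z. f (g z))" if "f \<in> F" for f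
    using that gW by (auto simp: F_def intro!: continuous_on_compose2[of U f W g])
  show "\<exists>W. z0 \<in> W \<and> openin (top_of_set T) W \<and>
       (\<exists>v. \<Union> v = ?c \<inter> fst -` W \<and> (\<forall>u\<in>v. openin (top_of_set ?c) u) \<and> pairwise disjnt v \<and>
            (\<forall>u\<in>v. \<exists>q. homeomorphism u W fst q))"
  proof (rule exI[of _ W], intro conjI exI[of _ "G ` F"])
    show "z0 \<in> W" "openin (top_of_set T) W" using z0 U W by (auto simp: W_def)
    show "\<Union> (G ` F) = ?c \<inter> fst -` W"
    proof (intro set_eqI iffI)
      fix x assume "x \<in> \<Union> (G ` F)"
      then show "x \<in> ?c \<inter> fst -` W" by (auto simp: G_def F_def W_def)
    next
      fix x assume x: "x \<in> ?c \<inter> fst -` W"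
      then have "g (fst x) \<in> U" "snd x \<in> K (g (fst x))" "fst x \<in> W" by (auto simp: W_def)
      then obtain f where "f \<in> F" "f (g (fst x)) = snd x" using sec by (force simp: F_def)
      then have "x \<in> G f" using \<open>fst x \<in> W\<close> by (auto simp: G_def image_iff intro!: bexI[of _ "fst x"] prod_eqI)
      then show "x \<in> \<Union> (G ` F)" using \<open>f \<in> F\<close> by blast
    qed
    show "\<forall>u\<in>G ` F. openin (top_of_set ?c) u"
    proof clarify
      fix f assume f: "f \<in> F"
      let ?X = "{x \<in> ?c. fst x \<in> W}"
      have "openin (top_of_set ?c) (?c \<inter> fst -` W)"
        by (rule continuous_openin_preimage[of _ _ T]) (use W in \<open>auto intro: continuous_intros\<close>)
      moreover have "?c \<inter> fst -` W = ?X" by auto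
      ultimately have X: "openin (top_of_set ?c) ?X" by simp
      have cont: "continuous_on ?X (\<lambda>x. dist (snd x) (f (g (fst x))))"
        by (intro continuous_intros continuous_on_compose2[OF fgW[OF f]]) auto
      have "openin (top_of_set ?X) (?X \<inter> (\<lambda>x. dist (snd x) (f (g (fst x)))) -` {..<\<delta>})"
        by (rule continuous_openin_preimage_gen[OF cont]) auto
      moreover have "?X \<inter> (\<lambda>x. dist (snd x) (f (g (fst x)))) -` {..<\<delta>} = G f"
      proof (intro set_eqI iffI)
        fix x assume x: "x \<in> ?X \<inter> (\<lambda>x. dist (snd x) (f (g (fst x)))) -` {..<\<delta>}"
        then have "snd x = f (g (fst x))"
          using sep[of "g (fst x)" "snd x" "f (g (fst x))"] f US by (fastforce simp: F_def W_def)
        with x show "x \<in> G f" by (auto simp: G_def image_iff intro!: bexI[of _ "fst x"] prod_eqI)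
      qed (use f \<delta> in \<open>auto simp: G_def F_def W_def\<close>)
      ultimately have "openin (top_of_set ?X) (G f)" by simp
      then show "openin (top_of_set ?c) (G f)" by (rule openin_trans[OF _ X])
    qed
    show "pairwise disjnt (G ` F)"
    proof (rule pairwiseI, clarify)
      fix f f' assume f: "f \<in> F" "f' \<in> F" and neq: "G f \<noteq> G f'"
      show "disjnt (G f) (G f')"
      proof (rule ccontr)
        assume "\<not> disjnt (G f) (G f')"
        then obtain z where "z \<in> W" "f (g z) = f' (g z)" by (auto simp: G_def disjnt_iff)
        then have "f y = f' y" if "y \<in> U" for y
          using discrete_lift_unique[of U id f f' "g z" y] f U(3) US that gW
          by (auto simp: F_def path_connected_imp_connected)
        then have "G f = G f'" using gW by (auto simp: G_def image_iff)
        with neq show False by blast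
      qed
    qed
    show "\<forall>u\<in>G ` F. \<exists>q. homeomorphism u W fst q"
    proof clarify
      fix f assume f: "f \<in> F"
      have "homeomorphism (G f) W fst (\<lambda>z. (z, f (g z)))"
        unfolding homeomorphism_def by (auto simp: G_def image_image intro!: continuous_intros fgW[OF f])
      then show "\<exists>q. homeomorphism (G f) W fst q" by blast
    qed
  qed
qed

lemma discrete_lift:
  fixes T :: "'c::real_normed_vector set"
  assumes T: "convex T" "z0 \<in> T" and g: "continuous_on T g" "g ` T \<subseteq> S" and k: "k0 \<in> K (g z0)"
  obtains f where "continuous_on T f" "\<And>z. z \<in> T \<Longrightarrow> f z \<in> K (g z)" "f z0 = k0"
proof -
  let ?c = "{(z, k). z \<in> T \<and> k \<in> K (g z)}"
  have 1: "(z0, k0) \<in> ?c" using T k by simp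
  have 2: "simply_connected T" using T by (simp add: convex_imp_simply_connected)
  have 3: "locally path_connected T" using T convex_imp_locally_path_connected by blast
  obtain h where h: "continuous_on T h" "h \<in> T \<rightarrow> ?c" "h z0 = (z0, k0)" "\<And>y. y \<in> T \<Longrightarrow> fst (h y) = y"
    using covering_space_lift_strong[OF discrete_covering_space[OF g] 1 T(2) 2 3 continuous_on_id, simplified id_def]
    by (metis (no_types, lifting) Pi_I fst_conv)
  show ?thesis
  proof (rule that[of "snd \<circ> h"])
    show "continuous_on T (snd \<circ> h)" by (intro continuous_on_compose h continuous_intros)
    show "(snd \<circ> h) z \<in> K (g z)" if "z \<in> T" for z
    proof -
      have "h z \<in> ?c" using h(2) that by (rule funcset_mem)
      then show ?thesis using h(4)[OF that] by (auto simp: case_prod_beta)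
    qed
    show "(snd \<circ> h) z0 = k0" using h(3) by simp
  qed
qed

text \<open>Lift a contraction of the loop to a constant loop. Over the final edge the base point is
  fixed, so the lift is constant there. The two side edges lie over the same path and agree at that
  end, hence also at the other end, where they carry \<open>f 0\<close> and
  \<open>f 1\<close>.\<close>

lemma discrete_lift_loop:
  assumes S: "simply_connected S"
    and g: "path g" "path_image g \<subseteq> S" "pathfinish g = pathstart g"
    and f: "continuous_on {0..1} f" "\<And>t. t \<in> {0..1} \<Longrightarrow> f t \<in> K (g t)"
  shows "f 1 = f 0"
proof -
  let ?p = "g 0"
  have "?p \<in> S" using g(2) pathstart_in_path_image[of g] by (auto simp: pathstart_def)
  then have "path (\<lambda>_. ?p) \<and> path_image (\<lambda>_. ?p) \<subseteq> S \<and> pathfinish (\<lambda>_. ?p) = pathstart (\<lambda>_. ?p)"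
    by (auto simp: path_def path_image_def pathstart_def pathfinish_def)
  then have "homotopic_loops S g (\<lambda>_. ?p)"
    using S[unfolded simply_connected_def, rule_format, of g "\<lambda>_. ?p"] g by simp
  then obtain H where H: "continuous_on ({0..1::real} \<times> {0..1::real}) H" "H \<in> ({0..1} \<times> {0..1}) \<rightarrow> S"
    and H': "\<forall>x\<in>{0..1}. H (0, x) = g x" "\<forall>x\<in>{0..1}. H (1, x) = ?p" "\<forall>t\<in>{0..1}. H (t, 1) = H (t, 0)"
    unfolding homotopic_loops pathfinish_def pathstart_def comp_def by blast
  have H0: "H (0, x) = g x" and H1: "H (1, x) = ?p" and Hl: "H (x, 1) = H (x, 0)" if "x \<in> {0..1}" for x
    using H' that by blast+
  obtain F where F: "continuous_on ({0..1} \<times> {0..1}) F"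
      "\<And>z. z \<in> {0..1} \<times> {0..1} \<Longrightarrow> F z \<in> K (H z)" "F (0, 0) = f 0"
  proof (rule discrete_lift[of "{0..1} \<times> {0..1}" "(0,0)" H "f 0"])
    show "f 0 \<in> K (H (0, 0))" using H0[of 0] f(2)[of 0] by simp
  qed (use H in \<open>auto intro: convex_Times\<close>)
  have c1: "continuous_on {0..1} (\<lambda>x. F (a, x))" "continuous_on {0..1} (\<lambda>x. F (x, a))"
    if "a \<in> {0..1}" for a
    using that by (auto intro!: continuous_on_compose2[OF F(1)] continuous_intros)
  have HS: "(\<lambda>x. H (a, x)) ` {0..1} \<subseteq> S" "(\<lambda>x. H (x, a)) ` {0..1} \<subseteq> S" if "a \<in> {0..1}" for a
    using that H by auto
  have FK: "F (a, x) \<in> K (H (a, x))" if "a \<in> {0..1}" "x \<in> {0..1}" for a x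
    using F(2) that by simp
  have F1: "F (1, 1) = F (1, 0)"
  proof (rule discrete_lift_unique[of "{0..1}" "\<lambda>_. ?p" "\<lambda>x. F (1, x)" "\<lambda>_. F (1, 0)" 0])
    show "F (1, t) \<in> K ?p" "F (1, 0) \<in> K ?p" if "t \<in> {0..1}" for t
      using FK[of 1 t] FK[of 1 0] H1[of t] H1[of 0] that by simp_all
  qed (use c1(1)[of 1] \<open>?p \<in> S\<close> in auto)
  have "F (0, 1) = F (0, 0)"
  proof (rule discrete_lift_unique[of "{0..1}" "\<lambda>x. H (x, 0)" "\<lambda>x. F (x, 1)" "\<lambda>x. F (x, 0)" 1])
    show "F (t, 1) \<in> K (H (t, 0))" "F (t, 0) \<in> K (H (t, 0))" if "t \<in> {0..1}" for t
      using FK[of t 1] FK[of t 0] Hl[of t] that by simp_all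
  qed (use F1 c1(2)[of 1] c1(2)[of 0] HS(2)[of 0] in auto)
  moreover have "F (0, x) = f x" if "x \<in> {0..1}" for x
  proof (rule discrete_lift_unique[of "{0..1}" g "\<lambda>x. F (0, x)" f 0])
    show "F (0, t) \<in> K (g t)" "f t \<in> K (g t)" if "t \<in> {0..1}" for t
      using FK[of 0 t] H0[of t] f(2)[of t] that by simp_all
  qed (use F(3) c1(1)[of 0] f(1) g(2) that in \<open>auto simp: path_image_def\<close>)
  ultimately show ?thesis by simp
qed

text \<open>The value at a point is the end of the lift, started at \<open>k0\<close>, of any path
  from \<open>p0\<close>. Trivial monodromy makes it independent of the path, and the local sections
  make it continuous.\<close>

lemma simply_connected_discrete_section:
  assumes S: "simply_connected S"
  obtains f where "continuous_on S f" "\<And>p. p \<in> S \<Longrightarrow> f p \<in> K p"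
proof (cases "S = {}")
  case True
  then show ?thesis using that by auto
next
  case False
  then obtain p0 where p0: "p0 \<in> S" by blast
  then obtain k0 where k0: "k0 \<in> K p0" using ne by blast
  define L where "L g f \<longleftrightarrow> path g \<and> path_image g \<subseteq> S \<and> pathstart g = p0 \<and> continuous_on {0..1} f \<and>
      (\<forall>t\<in>{0..1}. f t \<in> K (g t)) \<and> f 0 = k0" for g and f :: "real \<Rightarrow> 'b"
  have ex: "\<exists>g f. L g f \<and> g 1 = p" if p: "p \<in> S" for p
  proof -
    have "path (\<lambda>_. q) \<and> path_image (\<lambda>_. q) \<subseteq> S \<and> pathfinish (\<lambda>_. q) = pathstart (\<lambda>_. q)"
      if "q \<in> S" for q
      using that by (auto simp: path_def path_image_def pathstart_def pathfinish_def)
    \<comment> \<open>Simple connectedness speaks of loops; a free homotopy between the constant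
      loops at \<open>p0\<close> and \<open>p\<close> traces a path joining these points.\<close>
    then have "homotopic_loops S (\<lambda>_. p0) (\<lambda>_. p)"
      using S[unfolded simply_connected_def, rule_format, of "\<lambda>_. p0" "\<lambda>_. p"] p p0 by simp
    then obtain H where H: "continuous_on ({0..1::real} \<times> {0..1::real}) H" "H \<in> ({0..1} \<times> {0..1}) \<rightarrow> S"
      "\<forall>x\<in>{0..1}. H (0, x) = p0" "\<forall>x\<in>{0..1}. H (1, x) = p"
      unfolding homotopic_loops by blast
    let ?g = "\<lambda>t. H (t, 0)"
    have c: "continuous_on {0..1} ?g"
      by (auto intro!: continuous_on_compose2[OF H(1)] continuous_intros)
    have g: "?g 0 = p0" "?g 1 = p" "?g ` {0..1} \<subseteq> S" using H by auto
    obtain f where "continuous_on {0..1} f" "\<And>t. t \<in> {0..1} \<Longrightarrow> f t \<in> K (?g t)" "f 0 = k0"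
      using discrete_lift[of "{0..1::real}" 0 ?g k0] c g k0 by auto
    then show ?thesis using c g
      by (intro exI[of _ ?g] exI[of _ f]) (auto simp: L_def path_def path_image_def pathstart_def)
  qed
  have uniq: "f1 1 = f2 1" if L: "L g1 f1" "L g2 f2" and e: "g1 1 = g2 1" for g1 f1 g2 f2
  proof -
    define g where "g = g1 +++ reversepath g2"
    note Ld = L[unfolded L_def pathstart_def]
    have pg: "path g" "path_image g \<subseteq> S" "pathfinish g = pathstart g" "pathstart g = p0"
    proof -
      have "pathfinish g1 = pathfinish g2" using e by (simp add: pathfinish_def)
      moreover have "path g1" "path g2" "path_image g1 \<subseteq> S" "path_image g2 \<subseteq> S"
        "pathstart g1 = p0" "pathstart g2 = p0" using L by (auto simp: L_def)
      ultimately show "path g" "path_image g \<subseteq> S" "pathfinish g = pathstart g" "pathstart g = p0"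
        by (simp_all add: g_def subset_path_image_join)
    qed
    obtain h where h: "continuous_on {0..1} h" "\<And>t. t \<in> {0..1} \<Longrightarrow> h t \<in> K (g t)" "h 0 = k0"
      using discrete_lift[of "{0..1::real}" 0 g k0] pg k0
      by (auto simp: path_def path_image_def pathstart_def)
    have h1: "h 1 = k0" using discrete_lift_loop[OF S pg(1-3) h(1,2)] h(3) by simp
    \<comment> \<open>The closed loop lifts to \<open>h\<close> with \<open>h 1 = k0\<close>. Its
      first half is a lift of \<open>g1\<close>, its second half run backwards a lift of
      \<open>g2\<close>, and the two meet at 1/2.\<close>
    have gl: "g (t/2) = g1 t" if "t \<in> {0..1}" for t
      using that by (auto simp: g_def joinpaths_def)
    have gr: "g (1 - t/2) = g2 t" if "t \<in> {0..1}" for t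
      using that e by (cases "t = 1") (auto simp: g_def joinpaths_def reversepath_def)
    have hl: "h (t/2) \<in> K (g1 t)" and hr: "h (1 - t/2) \<in> K (g2 t)" if "t \<in> {0..1}" for t
      using h(2)[of "t/2"] h(2)[of "1 - t/2"] gl[OF that] gr[OF that] that by auto
    have "h (1/2) = f1 1"
      by (rule discrete_lift_unique[of "{0..1}" g1 "\<lambda>t. h (t/2)" f1 0 1])
        (use Ld h hl in \<open>auto simp: path_image_def intro!: continuous_on_compose2[OF h(1)] continuous_intros\<close>)
    moreover have "h (1 - 1/2) = f2 1"
      by (rule discrete_lift_unique[of "{0..1}" g2 "\<lambda>t. h (1 - t/2)" f2 0 1])
        (use Ld h h1 hr in \<open>auto simp: path_image_def intro!: continuous_on_compose2[OF h(1)] continuous_intros\<close>)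
    ultimately show ?thesis by simp
  qed
  define \<sigma> where "\<sigma> p = (SOME k. \<exists>g f. L g f \<and> g 1 = p \<and> f 1 = k)" for p
  have \<sigma>: "\<exists>g f. L g f \<and> g 1 = p \<and> f 1 = \<sigma> p" if "p \<in> S" for p
    unfolding \<sigma>_def using someI_ex[of "\<lambda>k. \<exists>g f. L g f \<and> g 1 = p \<and> f 1 = k"] ex[OF that] by blast
  have \<sigma>_eq: "\<sigma> (g 1) = f 1" if "L g f" for g f
  proof -
    have "g 1 \<in> S" using that pathfinish_in_path_image[of g] by (auto simp: L_def pathfinish_def)
    then obtain g' f' where "L g' f'" "g' 1 = g 1" "f' 1 = \<sigma> (g 1)" using \<sigma> by blast
    then show ?thesis using uniq[of g' f' g f] that by simp
  qed
  have \<sigma>K: "\<sigma> p \<in> K p" if p: "p \<in> S" for p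
  proof -
    obtain g f where "L g f" "g 1 = p" "f 1 = \<sigma> p" using \<sigma>[OF p] by blast
    then show ?thesis unfolding L_def by (metis atLeastAtMost_iff order_refl zero_le_one)
  qed
  have local: "\<exists>U. p \<in> U \<and> openin (top_of_set S) U \<and> continuous_on U \<sigma>" if p: "p \<in> S" for p
  proof -
    obtain U where U: "p \<in> U" "openin (top_of_set S) U" "path_connected U"
      and "\<exists>\<phi>. continuous_on U \<phi> \<and> \<phi> p = \<sigma> p \<and> (\<forall>y\<in>U. \<phi> y \<in> K y)"
      using loc[OF p] \<sigma>K[OF p] by blast
    then obtain \<phi> where \<phi>: "continuous_on U \<phi>" "\<phi> p = \<sigma> p" "\<And>y. y \<in> U \<Longrightarrow> \<phi> y \<in> K y" by blast
    have US: "U \<subseteq> S" using U(2) openin_imp_subset by blast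
    obtain g f where gf: "L g f" "g 1 = p" "f 1 = \<sigma> p" using \<sigma>[OF p] by blast
    have "\<sigma> x = \<phi> x" if x: "x \<in> U" for x
    proof -
      obtain d where d: "path d" "path_image d \<subseteq> U" "pathstart d = p" "pathfinish d = x"
        using U x unfolding path_connected_def by blast
      have "continuous_on {0..1} (\<phi> \<circ> d)"
        using d \<phi> by (intro continuous_on_compose) (auto simp: path_def path_image_def intro: continuous_on_subset)
      then have "path (\<phi> \<circ> d)" by (simp add: path_def)
      then have pj: "path (f +++ (\<phi> \<circ> d))"
        using gf d \<phi> by (intro path_join_imp) (auto simp: L_def path_def pathfinish_def pathstart_def)
      have dU: "d t \<in> U" if "0 \<le> t" "t \<le> 1" for t using d that by (auto simp: path_image_def)
      \<comment> \<open>Going on from \<open>p\<close> to \<open>x\<close> inside \<open>U\<close>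
        prolongs the lift by the local section, so \<sigma> coincides with that section on
        \<open>U\<close>.\<close>
      have "L (g +++ d) (f +++ (\<phi> \<circ> d))"
        unfolding L_def
      proof (intro conjI ballI)
        show "path (g +++ d)" using gf d by (auto simp: L_def pathfinish_def)
        show "path_image (g +++ d) \<subseteq> S" using gf d US by (auto simp: L_def subset_path_image_join)
        show "continuous_on {0..1} (f +++ (\<phi> \<circ> d))" using pj by (simp add: path_def)
        show "(f +++ (\<phi> \<circ> d)) t \<in> K ((g +++ d) t)" if "t \<in> {0..1}" for t
          using that gf dU \<phi> by (auto simp: joinpaths_def L_def)
      qed (use gf in \<open>auto simp: L_def joinpaths_def pathstart_def\<close>)
      from \<sigma>_eq[OF this] show ?thesis using d by (simp add: joinpaths_def pathfinish_def)
    qed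
    then have "continuous_on U \<sigma>" using \<phi>(1) by (simp cong: continuous_on_cong)
    with U show ?thesis by blast
  qed
  have "continuous_on S \<sigma>"
    unfolding continuous_on_eq_continuous_within
  proof
    fix p assume "p \<in> S"
    then obtain W where W: "p \<in> W" "open W" "continuous_on (S \<inter> W) \<sigma>"
      using local by (metis IntD2 openin_open)
    then have "continuous (at p within S \<inter> W) \<sigma>"
      using \<open>p \<in> S\<close> by (simp add: continuous_on_eq_continuous_within)
    moreover have "at p within S \<inter> W = at p within S"
      using W by (intro at_within_nhd[of p W]) auto
    ultimately show "continuous (at p within S) \<sigma>" by simp
  qed
  with \<sigma>K that show ?thesis by blast
qed

end

subsection \<open>Quaternions and bivectors\<close>

text \<open>Quaternion product, with the real part in the first coordinate. Only products with an
  imaginary factor occur, so that factor lives in \<open>real^3\<close>; \<open>qright\<close> has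
  it on the other side.\<close>

definition qleft :: "real^3 \<Rightarrow> real^4 \<Rightarrow> real^4" where
  "qleft a q = vector
    [- a$1 * q$2 - a$2 * q$3 - a$3 * q$4,
     a$1 * q$1 + a$2 * q$4 - a$3 * q$3,
     a$2 * q$1 + a$3 * q$2 - a$1 * q$4,
     a$3 * q$1 + a$1 * q$3 - a$2 * q$2]"

definition qright :: "real^4 \<Rightarrow> real^3 \<Rightarrow> real^4" where
  "qright q a = vector
    [- q$2 * a$1 - q$3 * a$2 - q$4 * a$3,
     q$1 * a$1 + q$3 * a$3 - q$4 * a$2,
     q$1 * a$2 + q$4 * a$1 - q$2 * a$3,
     q$1 * a$3 + q$2 * a$2 - q$3 * a$1]"

lemma vector_4 [simp]:
  "(vector [w, x, y, z] :: 'a::zero^4) $ 1 = w"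
  "(vector [w, x, y, z] :: 'a::zero^4) $ 2 = x"
  "(vector [w, x, y, z] :: 'a::zero^4) $ 3 = y"
  "(vector [w, x, y, z] :: 'a::zero^4) $ 4 = z"
  by (simp_all add: vector_def)

lemmas quat_simps = qleft_def qright_def inner_vec_def sum_3 sum_4 vec_eq_iff forall_4 forall_3 cross3_def

lemma qleft_qleft: "qleft a (qleft b q) = qleft (cross3 a b) q - (a \<bullet> b) *\<^sub>R q"
  by (simp add: quat_simps algebra_simps)

lemma qright_qright: "qright (qright q a) b = qright q (cross3 a b) - (a \<bullet> b) *\<^sub>R q"
  by (simp add: quat_simps algebra_simps)

lemma qleft_qright: "qleft a (qright q b) = qright (qleft a q) b"
  by (simp add: quat_simps algebra_simps)

lemma bounded_bilinear_qleft: "bounded_bilinear qleft"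
  unfolding bilinear_conv_bounded_bilinear[symmetric] bilinear_def
  by (intro conjI allI linearI) (simp_all add: quat_simps algebra_simps)

lemma bounded_bilinear_qright: "bounded_bilinear qright"
  unfolding bilinear_conv_bounded_bilinear[symmetric] bilinear_def
  by (intro conjI allI linearI) (simp_all add: quat_simps algebra_simps)

lemma qleft_inner: "qleft a x \<bullet> y = - (x \<bullet> qleft a y)"
  by (simp add: quat_simps algebra_simps)

lemma qleft_inner_qleft: "qleft a x \<bullet> qleft b x = (a \<bullet> b) * (x \<bullet> x)"
  by (simp add: quat_simps algebra_simps)

lemma qright_inner_qright: "qright x a \<bullet> qright x b = (a \<bullet> b) * (x \<bullet> x)"
  by (simp add: quat_simps algebra_simps)

lemma qleft_inner_self: "qleft a x \<bullet> x = 0"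
  by (simp add: quat_simps algebra_simps)

text \<open>\<open>w\<close> and its products with the three imaginary units are orthogonal and of
  equal length, so every vector is a quaternion multiple of \<open>w\<close>.\<close>

lemma quat_expand:
  "(w \<bullet> w) *\<^sub>R x = qleft (\<chi> k. qleft (axis k 1) w \<bullet> x) w + (x \<bullet> w) *\<^sub>R w"
  by (simp add: quat_simps axis_def algebra_simps)

lemma qleft_eq_0_iff: "qleft a x = 0 \<longleftrightarrow> a = 0 \<or> x = 0"
  by (metis inner_eq_zero_iff mult_eq_0_iff qleft_inner_qleft)

text \<open>Pairing with a self-dual basis bivector is a left multiplication by an imaginary unit,
  with an anti-self-dual one (\<open>dual_coords_wedge_m1\<close>) a right multiplication. This ties
  the two sphere factors to the two sides of the quaternion product.\<close>

lemma dual_coords_wedge_1: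
  "dual_coords 1 (wedge v w) = (\<chi> k. (qleft (axis k 1) v \<bullet> w) / sqrt 2)"
  by (simp add: dual_coords_def dual_basis_def bivector_inner_def wedge_def quat_simps axis_def field_simps)

lemma dual_coords_wedge_m1:
  "dual_coords (-1) (wedge v w) = (\<chi> k. (qright v (axis k 1) \<bullet> w) / sqrt 2)"
  by (simp add: dual_coords_def dual_basis_def bivector_inner_def wedge_def quat_simps axis_def field_simps)

lemma linear_dual_coords: "linear (dual_coords s)"
  by (auto intro!: linearI simp: dual_coords_def bivector_inner_def vec_eq_iff inner_left_distrib add_divide_distrib)

lemma det_4:
  "det (A::real^4^4) =
    A$1$1 * (A$2$2 * (A$3$3 * A$4$4 - A$3$4 * A$4$3) - A$2$3 * (A$3$2 * A$4$4 - A$3$4 * A$4$2) + A$2$4 * (A$3$2 * A$4$3 - A$3$3 * A$4$2))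
  - A$1$2 * (A$2$1 * (A$3$3 * A$4$4 - A$3$4 * A$4$3) - A$2$3 * (A$3$1 * A$4$4 - A$3$4 * A$4$1) + A$2$4 * (A$3$1 * A$4$3 - A$3$3 * A$4$1))
  + A$1$3 * (A$2$1 * (A$3$2 * A$4$4 - A$3$4 * A$4$2) - A$2$2 * (A$3$1 * A$4$4 - A$3$4 * A$4$1) + A$2$4 * (A$3$1 * A$4$2 - A$3$2 * A$4$1))
  - A$1$4 * (A$2$1 * (A$3$2 * A$4$3 - A$3$3 * A$4$2) - A$2$2 * (A$3$1 * A$4$3 - A$3$3 * A$4$1) + A$2$3 * (A$3$1 * A$4$2 - A$3$2 * A$4$1))"
proof -
  have f1234: "finite {2::4, 3, 4}" "1 \<notin> {2::4, 3, 4}" by auto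
  have f234: "finite {3::4, 4}" "2 \<notin> {3::4, 4}" by auto
  have f34: "finite {4::4}" "3 \<notin> {4::4}" by auto
  show ?thesis
    unfolding det_def UNIV_4
    unfolding sum_over_permutations_insert[OF f1234]
    unfolding sum_over_permutations_insert[OF f234]
    unfolding sum_over_permutations_insert[OF f34]
    unfolding permutes_sing
    by (simp add: sign_swap_id permutation_swap_id permutation_compose sign_compose sign_id swap_id_eq algebra_simps)
qed

text \<open>Fixes the orientation: for unit \<open>a\<close>, \<open>v\<close> and \<open>w\<close>
  with \<open>w\<close> orthogonal to \<open>v\<close> and \<open>a v\<close>, the value is 1, so
  both a plane and its complement are turned positively by the same left multiplication.\<close>

lemma det_qleft:
  "det (vector [v, qleft a v, w, qleft a w] :: real^4^4) =
    (a \<bullet> a) * ((v \<bullet> v) * (w \<bullet> w) - (v \<bullet> w)\<^sup>2) - (qleft a v \<bullet> w)\<^sup>2"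
  unfolding det_4 by (simp add: quat_simps algebra_simps power2_eq_square)

subsection \<open>Complex linear algebra\<close>

text \<open>\<open>Im (cnj x * y)\<close> is the determinant of \<open>x\<close> and
  \<open>y\<close> as vectors of the real plane; this lemma and the next two are linear dependence,
  independence and Cramer's rule in that form.\<close>

lemma complex_real_dependent:
  assumes "Im (cnj x * y) = 0"
  obtains s t :: real where "s \<noteq> 0 \<or> t \<noteq> 0" "complex_of_real s * x + complex_of_real t * y = 0"
proof (cases "x = 0")
  case True
  then show ?thesis using that[of 1 0] by simp
next
  case False
  have "cnj x * y = complex_of_real (Re (cnj x * y))" using assms by (simp add: complex_eq_iff)
  then have "x * (cnj x * y) = complex_of_real (Re (cnj x * y)) * x" by simp
  then have "complex_of_real (- Re (cnj x * y)) * x + complex_of_real ((cmod x)\<^sup>2) * y = 0"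
    by (simp only: of_real_minus complex_norm_square) (simp add: algebra_simps)
  then show ?thesis using that[of "- Re (cnj x * y)" "(cmod x)\<^sup>2"] False by auto
qed

lemma complex_real_independent:
  assumes "Im (cnj x * y) \<noteq> 0" "complex_of_real s * x + complex_of_real t * y = 0"
  shows "s = 0 \<and> t = 0"
proof -
  have 1: "s * Re x + t * Re y = 0" "s * Im x + t * Im y = 0"
    using assms(2) by (auto simp: complex_eq_iff)
  have "s * Im (cnj x * y) = Im y * (s * Re x + t * Re y) - Re y * (s * Im x + t * Im y)"
    by (simp add: algebra_simps)
  moreover have "t * Im (cnj x * y) = Re x * (s * Im x + t * Im y) - Im x * (s * Re x + t * Re y)"
    by (simp add: algebra_simps)
  ultimately show ?thesis using 1 assms(1) by auto
qed

lemma complex_eq_0_of_two_Im: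
  assumes "Im (cnj x * y) \<noteq> 0" "Im (z * cnj x) = 0" "Im (z * cnj y) = 0"
  shows "z = 0"
proof -
  have "Re z * Im (cnj x * y) = - (Re x * Im (z * cnj y)) + Re y * Im (z * cnj x)"
    "Im z * Im (cnj x * y) = - (Im x * Im (z * cnj y)) + Im y * Im (z * cnj x)"
    by (simp_all add: algebra_simps)
  with assms show ?thesis by (simp add: complex_eq_iff)
qed

text \<open>The two hypotheses say that \<open>e = \<alpha> + \<beta>\<close> and \<open>l = \<alpha> - \<beta>\<close> satisfy \<open>cnj e1 * l2 = cnj e2 * l1\<close>, so
  that \<open>l\<close> is a multiple of the conjugate of \<open>e\<close>.\<close>

lemma conjugate_multiple:
  fixes \<alpha>1 \<alpha>2 \<beta>1 \<beta>2 :: complex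
  assumes lag: "Im (cnj \<alpha>1 * \<alpha>2) = Im (cnj \<beta>1 * \<beta>2)"
    and phase: "Re (cnj \<alpha>1 * \<beta>2) = Re (cnj \<alpha>2 * \<beta>1)"
    and ne: "\<alpha>1 + \<beta>1 \<noteq> 0 \<or> \<alpha>2 + \<beta>2 \<noteq> 0"
  obtains \<mu> where "\<alpha>1 - \<beta>1 = \<mu> * cnj (\<alpha>1 + \<beta>1)" "\<alpha>2 - \<beta>2 = \<mu> * cnj (\<alpha>2 + \<beta>2)"
proof -
  have eq: "cnj (\<alpha>1 + \<beta>1) * (\<alpha>2 - \<beta>2) = cnj (\<alpha>2 + \<beta>2) * (\<alpha>1 - \<beta>1)"
    using lag phase by (simp add: complex_eq_iff algebra_simps)
  consider "\<alpha>1 + \<beta>1 \<noteq> 0" | "\<alpha>1 + \<beta>1 = 0" "\<alpha>2 + \<beta>2 \<noteq> 0" using ne by blast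
  then show ?thesis
  proof cases
    case 1
    then have "cnj (\<alpha>1 + \<beta>1) \<noteq> 0" by (metis complex_cnj_zero_iff)
    then show ?thesis
      using that[of "(\<alpha>1 - \<beta>1) / cnj (\<alpha>1 + \<beta>1)"] eq by (simp add: field_simps del: complex_cnj_add)
  next
    case 2
    then have "cnj (\<alpha>2 + \<beta>2) \<noteq> 0" by (metis complex_cnj_zero_iff)
    then show ?thesis
      using that[of "(\<alpha>2 - \<beta>2) / cnj (\<alpha>2 + \<beta>2)"] eq by (simp add: field_simps del: complex_cnj_add)
  qed
qed

text \<open>In an orthonormal frame, degeneracy of \<open>\<alpha> + \<beta>\<close> forces \<open>\<beta> = - \<alpha>\<close> with \<open>\<surd>2 \<alpha>\<close> an isometry, whose
  Jacobian is \<open>\<plusminus>1/2\<close>.\<close>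

lemma sum_nondegenerate:
  fixes \<alpha>1 \<alpha>2 \<beta>1 \<beta>2 :: complex
  assumes on: "(cmod \<alpha>1)\<^sup>2 + (cmod \<beta>1)\<^sup>2 = 1" "(cmod \<alpha>2)\<^sup>2 + (cmod \<beta>2)\<^sup>2 = 1"
      "Re (cnj \<alpha>1 * \<alpha>2) + Re (cnj \<beta>1 * \<beta>2) = 0"
    and lag: "Im (cnj \<alpha>1 * \<alpha>2) = Im (cnj \<beta>1 * \<beta>2)"
    and phase: "Re (cnj \<alpha>1 * \<beta>2) = Re (cnj \<alpha>2 * \<beta>1)"
    and C: "(Im (cnj \<alpha>1 * \<alpha>2))\<^sup>2 < 1/4"
  shows "Im (cnj (\<alpha>1 + \<beta>1) * (\<alpha>2 + \<beta>2)) \<noteq> 0"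
proof
  assume 0: "Im (cnj (\<alpha>1 + \<beta>1) * (\<alpha>2 + \<beta>2)) = 0"
  show False
  proof (cases "\<alpha>1 + \<beta>1 = 0 \<and> \<alpha>2 + \<beta>2 = 0")
    case True
    then have \<beta>: "\<beta>1 = - \<alpha>1" "\<beta>2 = - \<alpha>2" by (simp_all add: eq_neg_iff_add_eq_0 add.commute)
    have "(cmod \<alpha>1)\<^sup>2 = 1/2" "(cmod \<alpha>2)\<^sup>2 = 1/2" "Re (cnj \<alpha>1 * \<alpha>2) = 0" using on by (simp_all add: \<beta>)
    moreover have "(cmod (cnj \<alpha>1 * \<alpha>2))\<^sup>2 = (Re (cnj \<alpha>1 * \<alpha>2))\<^sup>2 + (Im (cnj \<alpha>1 * \<alpha>2))\<^sup>2"
      by (rule cmod_power2)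
    moreover have "(cmod (cnj \<alpha>1 * \<alpha>2))\<^sup>2 = (cmod \<alpha>1)\<^sup>2 * (cmod \<alpha>2)\<^sup>2"
      by (simp add: norm_mult power_mult_distrib)
    ultimately have "(Im (cnj \<alpha>1 * \<alpha>2))\<^sup>2 = 1/2 * (1/2)" by (metis add_0 zero_power2)
    with C show False by linarith
  next
    case False
    then obtain \<mu> where \<mu>: "\<alpha>1 - \<beta>1 = \<mu> * cnj (\<alpha>1 + \<beta>1)" "\<alpha>2 - \<beta>2 = \<mu> * cnj (\<alpha>2 + \<beta>2)"
      using conjugate_multiple[OF lag phase] by blast
    obtain s t :: real where st: "s \<noteq> 0 \<or> t \<noteq> 0"
      and e: "complex_of_real s * (\<alpha>1 + \<beta>1) + complex_of_real t * (\<alpha>2 + \<beta>2) = 0"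
      using complex_real_dependent[OF 0] by blast
    have "complex_of_real s * (\<alpha>1 - \<beta>1) + complex_of_real t * (\<alpha>2 - \<beta>2) =
        \<mu> * cnj (complex_of_real s * (\<alpha>1 + \<beta>1) + complex_of_real t * (\<alpha>2 + \<beta>2))"
      unfolding \<mu> by (simp add: algebra_simps)
    with e have l: "complex_of_real s * (\<alpha>1 - \<beta>1) + complex_of_real t * (\<alpha>2 - \<beta>2) = 0" by simp
    have "complex_of_real s * \<alpha>1 + complex_of_real t * \<alpha>2 = 0"
      "complex_of_real s * \<beta>1 + complex_of_real t * \<beta>2 = 0"
      using e l by (simp_all add: complex_eq_iff algebra_simps)
    then have r: "s * Re \<alpha>1 + t * Re \<alpha>2 = 0" "s * Im \<alpha>1 + t * Im \<alpha>2 = 0"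
        "s * Re \<beta>1 + t * Re \<beta>2 = 0" "s * Im \<beta>1 + t * Im \<beta>2 = 0"
      by (auto simp: complex_eq_iff)
    have "s\<^sup>2 * ((cmod \<alpha>1)\<^sup>2 + (cmod \<beta>1)\<^sup>2) + t\<^sup>2 * ((cmod \<alpha>2)\<^sup>2 + (cmod \<beta>2)\<^sup>2)
        + 2 * s * t * (Re (cnj \<alpha>1 * \<alpha>2) + Re (cnj \<beta>1 * \<beta>2)) =
      (s * Re \<alpha>1 + t * Re \<alpha>2)\<^sup>2 + (s * Im \<alpha>1 + t * Im \<alpha>2)\<^sup>2 + (s * Re \<beta>1 + t * Re \<beta>2)\<^sup>2 + (s * Im \<beta>1 + t * Im \<beta>2)\<^sup>2"
      unfolding cmod_power2 by (simp add: power2_eq_square algebra_simps)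
    then have "s\<^sup>2 + t\<^sup>2 = 0" unfolding r on by simp
    with st show False by (simp add: sum_power2_eq_zero_iff)
  qed
qed

text \<open>The equation \<open>eq\<close> makes \<beta> a multiple \<kappa> of the conjugate of
  \<alpha>, which reverses area, while \<open>lag\<close> says that the areas are equal. So both
  areas vanish, and \<alpha> and \<beta> satisfy the same real linear relation.\<close>

lemma phase_forms_dependent:
  fixes \<alpha>1 \<alpha>2 \<beta>1 \<beta>2 :: complex
  assumes lag: "Im (cnj \<alpha>1 * \<alpha>2) = Im (cnj \<beta>1 * \<beta>2)" and eq: "cnj \<alpha>1 * \<beta>2 = cnj \<alpha>2 * \<beta>1"
  obtains s t :: real where "s \<noteq> 0 \<or> t \<noteq> 0" "complex_of_real s * \<alpha>1 + complex_of_real t * \<alpha>2 = 0"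
    "complex_of_real s * \<beta>1 + complex_of_real t * \<beta>2 = 0"
proof (cases "\<alpha>1 = 0 \<and> \<alpha>2 = 0")
  case True
  then have "Im (cnj \<beta>1 * \<beta>2) = 0" using lag by simp
  then obtain s t :: real where "s \<noteq> 0 \<or> t \<noteq> 0" "complex_of_real s * \<beta>1 + complex_of_real t * \<beta>2 = 0"
    using complex_real_dependent by blast
  then show ?thesis using that[of s t] True by simp
next
  case False
  obtain \<kappa> where \<kappa>: "\<beta>1 = \<kappa> * cnj \<alpha>1" "\<beta>2 = \<kappa> * cnj \<alpha>2"
  proof (cases "\<alpha>1 = 0")
    case True
    then show ?thesis using that[of "\<beta>2 / cnj \<alpha>2"] False eq by (auto simp: field_simps)
  next
    case False
    then show ?thesis using that[of "\<beta>1 / cnj \<alpha>1"] eq by (auto simp: field_simps)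
  qed
  have "Im (cnj \<beta>1 * \<beta>2) = - (cmod \<kappa>)\<^sup>2 * Im (cnj \<alpha>1 * \<alpha>2)"
    unfolding \<kappa> cmod_power2 by (simp add: power2_eq_square algebra_simps)
  then have "(1 + (cmod \<kappa>)\<^sup>2) * Im (cnj \<alpha>1 * \<alpha>2) = 0" using lag by (simp add: algebra_simps)
  moreover have "1 + (cmod \<kappa>)\<^sup>2 \<noteq> 0" by (metis add_eq_0_iff neg_less_0_iff_less not_less zero_le_power2 zero_less_one)
  ultimately have "Im (cnj \<alpha>1 * \<alpha>2) = 0" by (metis mult_eq_0_iff)
  then obtain s t :: real where st: "s \<noteq> 0 \<or> t \<noteq> 0" "complex_of_real s * \<alpha>1 + complex_of_real t * \<alpha>2 = 0"
    using complex_real_dependent by blast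
  have "complex_of_real s * \<beta>1 + complex_of_real t * \<beta>2 =
     \<kappa> * cnj (complex_of_real s * \<alpha>1 + complex_of_real t * \<alpha>2)"
    unfolding \<kappa> by (simp add: algebra_simps)
  with st that show ?thesis by simp
qed

text \<open>The pointwise core of the theorem.  With \<open>n\<^sub>i\<^sub>j = \<mu> * cnj (A\<^sub>i\<^sub>j + B\<^sub>i\<^sub>j) - (A\<^sub>i\<^sub>j - B\<^sub>i\<^sub>j)\<close> and \<open>e = \<alpha> + \<beta>\<close> put
  \<open>Z\<^sub>k = n\<^sub>1\<^sub>k * cnj e2 - n\<^sub>2\<^sub>k * cnj e1\<close>.  The Lagrangian condition makes \<open>Z\<^sub>k\<close> real, the vanishing of the mean
  curvature gives \<open>e2 * Z1 = e1 * Z2\<close>, and \<open>e1, e2\<close> are independent over the reals.\<close>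

lemma phase_derivative_zero:
  fixes \<alpha>1 \<alpha>2 \<beta>1 \<beta>2 A11 A12 A22 B11 B12 B22 :: complex
  assumes lag: "Im (cnj \<alpha>1 * \<alpha>2) = Im (cnj \<beta>1 * \<beta>2)"
    and phase: "Re (cnj \<alpha>1 * \<beta>2) = Re (cnj \<alpha>2 * \<beta>1)"
    and ind: "Im (cnj (\<alpha>1 + \<beta>1) * (\<alpha>2 + \<beta>2)) \<noteq> 0"
    and lag1: "Im (cnj A11 * \<alpha>2 + cnj \<alpha>1 * A12) = Im (cnj B11 * \<beta>2 + cnj \<beta>1 * B12)"
    and lag2: "Im (cnj A12 * \<alpha>2 + cnj \<alpha>1 * A22) = Im (cnj B12 * \<beta>2 + cnj \<beta>1 * B22)"
    and g: "g11 = (cmod \<alpha>1)\<^sup>2 + (cmod \<beta>1)\<^sup>2" "g22 = (cmod \<alpha>2)\<^sup>2 + (cmod \<beta>2)\<^sup>2"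
      "g12 = Re (cnj \<alpha>1 * \<alpha>2) + Re (cnj \<beta>1 * \<beta>2)"
    and tr: "\<And>\<alpha> \<beta>. (\<alpha>, \<beta>) = (\<alpha>1, \<beta>1) \<or> (\<alpha>, \<beta>) = (\<alpha>2, \<beta>2) \<Longrightarrow>
       g22 * Im (cnj A11 * \<alpha> - cnj B11 * \<beta>) - 2 * g12 * Im (cnj A12 * \<alpha> - cnj B12 * \<beta>)
       + g11 * Im (cnj A22 * \<alpha> - cnj B22 * \<beta>) = 0"
  shows "Re (cnj A11 * \<beta>2 + cnj \<alpha>1 * B12 - cnj A12 * \<beta>1 - cnj \<alpha>2 * B11) = 0"
    and "Re (cnj A12 * \<beta>2 + cnj \<alpha>1 * B22 - cnj A22 * \<beta>1 - cnj \<alpha>2 * B12) = 0"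
proof -
  have "\<alpha>1 + \<beta>1 \<noteq> 0" using ind by (metis complex_cnj_zero mult_zero_left zero_complex.simps(2))
  then obtain \<mu> where \<mu>: "\<alpha>1 - \<beta>1 = \<mu> * cnj (\<alpha>1 + \<beta>1)" "\<alpha>2 - \<beta>2 = \<mu> * cnj (\<alpha>2 + \<beta>2)"
    using conjugate_multiple[OF lag phase] by blast
  define e1 e2 where "e1 = \<alpha>1 + \<beta>1" and "e2 = \<alpha>2 + \<beta>2"
  have \<alpha>: "\<alpha>1 = (e1 + \<mu> * cnj e1) / 2" "\<alpha>2 = (e2 + \<mu> * cnj e2) / 2"
    and \<beta>: "\<beta>1 = (e1 - \<mu> * cnj e1) / 2" "\<beta>2 = (e2 - \<mu> * cnj e2) / 2"
    using \<mu> by (simp_all add: e1_def e2_def field_simps)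
  define n where "n A B = \<mu> * cnj (A + B) - (A - B)" for A B :: complex
  have S: "Im (cnj A * ((e + \<mu> * cnj e) / 2) - cnj B * ((e - \<mu> * cnj e) / 2)) = Im (n A B * cnj e) / 2" for A B e
    by (simp add: n_def field_simps)
  define Z1 where "Z1 = n A11 B11 * cnj e2 - n A12 B12 * cnj e1"
  define Z2 where "Z2 = n A12 B12 * cnj e2 - n A22 B22 * cnj e1"
  have ImZ: "Im Z1 = 0" "Im Z2 = 0"
    using lag1 lag2 unfolding Z1_def Z2_def n_def \<alpha> \<beta> by (simp_all add: field_simps)
  define c where "c = (1 + (cmod \<mu>)\<^sup>2) / 2"
  have c: "c > 0" by (simp add: c_def add_pos_nonneg)
  \<comment> \<open>The cross terms between \<open>e\<close> and \<open>\<mu> * cnj e\<close> cancel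
    in the sum of the two squares, so the metric is conformal to the one pulled back by
    \<open>e\<close>.\<close>
  have g': "g11 = c * Re (cnj e1 * e1)" "g22 = c * Re (cnj e2 * e2)" "g12 = c * Re (cnj e1 * e2)"
    unfolding g \<alpha> \<beta> c_def cmod_power2 by (simp_all add: power2_eq_square field_simps)
  define T where "T = complex_of_real (Re (cnj e2 * e2)) * n A11 B11
      - 2 * complex_of_real (Re (cnj e1 * e2)) * n A12 B12 + complex_of_real (Re (cnj e1 * e1)) * n A22 B22"
  have ImT: "c / 2 * Im (T * cnj e) = g22 * (Im (n A11 B11 * cnj e) / 2) - 2 * g12 * (Im (n A12 B12 * cnj e) / 2)
      + g11 * (Im (n A22 B22 * cnj e) / 2)" for e
    unfolding T_def g' by (simp add: field_simps)
  \<comment> \<open>The trace condition holds for both tangent directions, and as \<open>e1\<close>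
    and \<open>e2\<close> are independent it kills the complex number \<open>T\<close>.\<close>
  have "Im (T * cnj e1) = 0" "Im (T * cnj e2) = 0"
    using tr[of \<alpha>1 \<beta>1] tr[of \<alpha>2 \<beta>2] ImT[of e1] ImT[of e2] c unfolding \<alpha> \<beta> S by auto
  moreover have ind': "Im (cnj e1 * e2) \<noteq> 0" using ind unfolding e1_def e2_def .
  ultimately have "T = 0" using complex_eq_0_of_two_Im by blast
  moreover have "T = e2 * Z1 - e1 * Z2"
    unfolding T_def Z1_def Z2_def by (simp add: complex_eq_iff algebra_simps)
  moreover have "Z1 = complex_of_real (Re Z1)" "Z2 = complex_of_real (Re Z2)"
    using ImZ by (simp_all add: complex_eq_iff)
  ultimately have dep: "complex_of_real (- Re Z2) * e1 + complex_of_real (Re Z1) * e2 = 0"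
    by (metis add.commute diff_conv_add_uminus mult.commute mult_minus_left of_real_minus)
  have "Re Z1 = 0" "Re Z2 = 0" using complex_real_independent[OF ind' dep] by simp_all
  then show "Re (cnj A11 * \<beta>2 + cnj \<alpha>1 * B12 - cnj A12 * \<beta>1 - cnj \<alpha>2 * B11) = 0"
    and "Re (cnj A12 * \<beta>2 + cnj \<alpha>1 * B22 - cnj A22 * \<beta>1 - cnj \<alpha>2 * B12) = 0"
    unfolding Z1_def Z2_def n_def \<alpha> \<beta> by (simp_all add: field_simps)
qed

text \<open>The symmetric form is the imaginary part of a quadratic form of type (0,2), like a
  conjugate Hopf differential, and such a form has trace zero for the metric
  \<open>Re (cnj e * e')\<close>; the left side is that trace times the Gram determinant.\<close>

lemma trace_free_of_conjugate_multiple: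
  fixes e1 e2 \<mu> :: complex
  shows "Re (cnj e2 * e2) * Im (\<mu> * cnj e1 * cnj e1) - 2 * Re (cnj e1 * e2) * Im (\<mu> * cnj e1 * cnj e2)
    + Re (cnj e1 * e1) * Im (\<mu> * cnj e2 * cnj e2) = 0"
  by (simp add: algebra_simps)

subsection \<open>Planes in the 4-space as pairs of unit vectors\<close>

interpretation qleft: bounded_bilinear qleft by (rule bounded_bilinear_qleft)
interpretation qright: bounded_bilinear qright by (rule bounded_bilinear_qright)

lemma qleft_inner_qleft_gen: "qleft a x \<bullet> qleft a y = (a \<bullet> a) * (x \<bullet> y)"
  by (simp add: quat_simps algebra_simps)

lemma qright_inner_qright_gen: "qright x a \<bullet> qright y a = (a \<bullet> a) * (x \<bullet> y)"
  by (simp add: quat_simps algebra_simps)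

lemma cross3_eq_0_unit:
  assumes "norm a = 1" "cross3 a c = 0"
  shows "c = (c \<bullet> a) *\<^sub>R a"
proof -
  have "cross3 a (cross3 a c) = (a \<bullet> c) *\<^sub>R a - (a \<bullet> a) *\<^sub>R c"
    by (simp add: quat_simps algebra_simps)
  with assms show ?thesis by (simp add: dot_square_norm inner_commute)
qed

text \<open>For unit vectors \<open>\<phi>\<close> and \<open>\<psi>\<close> the plane with self-dual part \<open>\<phi>\<close> and anti-self-dual part \<open>\<psi>\<close> is
  \<open>{x. in_plane \<phi> \<psi> x}\<close>, where \<open>x \<mapsto> \<phi> x\<close> is the rotation by a right angle; \<open>{x. in_plane \<phi> (- \<psi>) x}\<close> is its
  orthogonal complement.\<close>

definition in_plane :: "real^3 \<Rightarrow> real^3 \<Rightarrow> real^4 \<Rightarrow> bool" where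
  "in_plane \<phi> \<psi> x \<longleftrightarrow> qleft \<phi> x = qright x \<psi>"

lemma in_plane_minus: "in_plane \<phi> (- \<psi>) x \<longleftrightarrow> qleft \<phi> x = - qright x \<psi>"
  by (simp add: in_plane_def qright.minus_right)

lemma in_plane_add: "in_plane \<phi> \<psi> x \<Longrightarrow> in_plane \<phi> \<psi> y \<Longrightarrow> in_plane \<phi> \<psi> (x + y)"
  by (simp add: in_plane_def qleft.add_right qright.add_left)

lemma in_plane_scaleR: "in_plane \<phi> \<psi> x \<Longrightarrow> in_plane \<phi> \<psi> (c *\<^sub>R x)"
  by (simp add: in_plane_def qleft.scaleR_right qright.scaleR_left)

lemma in_plane_uminus: "in_plane \<phi> \<psi> x \<Longrightarrow> in_plane \<phi> \<psi> (- x)"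
  by (simp add: in_plane_def qleft.minus_right qright.minus_left)

lemma in_plane_diff: "in_plane \<phi> \<psi> x \<Longrightarrow> in_plane \<phi> \<psi> y \<Longrightarrow> in_plane \<phi> \<psi> (x - y)"
  by (simp add: in_plane_def qleft.diff_right qright.diff_left)

lemma in_plane_rotate: "in_plane \<phi> \<psi> x \<Longrightarrow> in_plane \<phi> \<psi> (qleft \<phi> x)"
  by (simp add: in_plane_def qleft_qright)

lemma qleft_anticommute:
  assumes "a \<bullet> b = 0"
  shows "qleft a (qleft b x) = - qleft b (qleft a x)"
  using assms cross_skew[of a b] by (simp add: qleft_qleft inner_commute qleft.minus_left)

lemma qright_anticommute:
  assumes "a \<bullet> b = 0"
  shows "qright (qright x a) b = - qright (qright x b) a"
  using assms cross_skew[of a b] by (simp add: qright_qright inner_commute qright.minus_right)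

text \<open>\<open>a\<close> anticommutes with \<phi>, so
  \<open>\<phi> (a x) = - a (\<phi> x) = - (a x) \<psi>\<close>: Clifford multiplication by a
  tangent vector of the sphere exchanges the plane and its complement.\<close>

lemma in_plane_qleft:
  assumes "in_plane \<phi> \<psi> x" "a \<bullet> \<phi> = 0"
  shows "in_plane \<phi> (- \<psi>) (qleft a x)"
  using assms qleft_anticommute[of a \<phi> x]
  by (simp add: in_plane_def qright.minus_right qleft_qright[symmetric])

lemma in_plane_qright:
  assumes "in_plane \<phi> \<psi> x" "b \<bullet> \<psi> = 0"
  shows "in_plane \<phi> (- \<psi>) (qright x b)"
  using assms qright_anticommute[of b \<psi> x]
  by (simp add: in_plane_def qright.minus_right qleft_qright)

lemma qleft_qleft_unit: "norm \<phi> = 1 \<Longrightarrow> qleft \<phi> (qleft \<phi> x) = - x"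
  by (simp add: qleft_qleft dot_square_norm qleft.zero_left)

lemma qright_qright_unit: "norm \<phi> = 1 \<Longrightarrow> qright (qright x \<phi>) \<phi> = - x"
  by (simp add: qright_qright dot_square_norm qright.zero_right)

text \<open>Multiplications by \<phi> and by \<psi> are isometries that agree on \<open>x\<close>
  and are opposite on \<open>y\<close>, so the inner product equals its own negative.\<close>

lemma in_plane_orthogonal:
  assumes "norm \<phi> = 1" "norm \<psi> = 1" "in_plane \<phi> \<psi> x" "in_plane \<phi> (- \<psi>) y"
  shows "x \<bullet> y = 0"
proof -
  have "qleft \<phi> x \<bullet> qleft \<phi> y = - (qright x \<psi> \<bullet> qright y \<psi>)"
    using assms by (simp add: in_plane_def qright.minus_right)
  then show ?thesis
    unfolding qleft_inner_qleft_gen qright_inner_qright_gen using assms by (simp add: dot_square_norm)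
qed

text \<open>Shows that the plane has dimension two. Writing \<open>x = c w + r w\<close> with
  \<open>c\<close> imaginary, membership forces \<open>c\<close> to commute with \<phi>, hence to be
  a real multiple of it.\<close>

lemma in_plane_expand:
  assumes "norm \<phi> = 1" "norm w = 1" "in_plane \<phi> \<psi> w" "in_plane \<phi> \<psi> x"
  shows "x = (x \<bullet> w) *\<^sub>R w + (x \<bullet> qleft \<phi> w) *\<^sub>R qleft \<phi> w"
proof -
  obtain c where c: "x = qleft c w + (x \<bullet> w) *\<^sub>R w"
    using quat_expand[of w x] assms by (metis dot_square_norm one_power2 scaleR_one)
  have "in_plane \<phi> \<psi> (qleft c w)"
    using in_plane_diff[OF assms(4) in_plane_scaleR[OF assms(3)]] c by (metis add_diff_cancel)
  then have "qleft \<phi> (qleft c w) = qleft c (qleft \<phi> w)"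
    using assms(3) by (simp add: in_plane_def qleft_qright)
  then have "qleft (cross3 \<phi> c - cross3 c \<phi>) w = 0"
    by (simp add: qleft_qleft qleft.diff_left inner_commute)
  then have "cross3 \<phi> c = cross3 c \<phi>" using assms(2) qleft_eq_0_iff by force
  then have "cross3 \<phi> c = - cross3 \<phi> c" by (metis cross_skew)
  then have "cross3 \<phi> c = 0" by (simp add: vec_eq_iff)
  from cross3_eq_0_unit[OF assms(1) this]
  have x: "x = (c \<bullet> \<phi>) *\<^sub>R qleft \<phi> w + (x \<bullet> w) *\<^sub>R w" using c by (metis qleft.scaleR_left)
  have "qleft \<phi> w \<bullet> qleft \<phi> w = 1"
    unfolding qleft_inner_qleft using assms(1,2) by (simp add: dot_square_norm)
  moreover have "w \<bullet> qleft \<phi> w = 0" using qleft_inner_self[of \<phi> w] by (simp only: inner_commute)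
  ultimately have "x \<bullet> qleft \<phi> w = c \<bullet> \<phi>"
    using arg_cong[OF x, of "\<lambda>y. y \<bullet> qleft \<phi> w"] by (simp add: inner_add_left)
  with x show ?thesis by (metis add.commute)
qed

lemma in_plane_exists_unit:
  assumes "norm \<phi> = 1" "norm \<psi> = 1"
  obtains q where "norm q = 1" "in_plane \<phi> \<psi> q"
proof -
  define f where "f x = x - qleft \<phi> (qright x \<psi>)" for x
  have f: "in_plane \<phi> \<psi> (f x)" for x
    using assms by (simp add: in_plane_def f_def qleft.diff_right qright.diff_left qleft_qright[symmetric]
        qleft_qleft_unit qright_qright_unit qleft.minus_right)
  \<comment> \<open>\<open>f\<close> is twice the orthogonal projection onto the plane; its trace 4
    is nonzero, so it does not kill every basis vector.\<close>
  have "(\<Sum>k\<in>UNIV. f (axis k 1) \<bullet> axis k 1) = 4"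
    by (simp add: f_def sum_4 quat_simps axis_def algebra_simps)
  then obtain k where "f (axis k 1) \<noteq> 0" by (metis (no_types, lifting) inner_zero_left sum.neutral zero_neq_numeral)
  then show ?thesis
    using that[of "(1 / norm (f (axis k 1))) *\<^sub>R f (axis k 1)"] in_plane_scaleR[OF f] by simp
qed

locale normal_frame =
  fixes \<phi> \<psi> :: "real^3" and q w :: "real^4"
  assumes unit: "norm \<phi> = 1" "norm \<psi> = 1" "norm q = 1" "norm w = 1"
    and normal: "in_plane \<phi> (- \<psi>) q" and tangent: "in_plane \<phi> \<psi> w"
begin

text \<open>Complex coordinate of the tangential part of \<open>x\<close>, in which left
  multiplication by \<phi> is multiplication by \<open>\<i>\<close>. Another choice of
  \<open>w\<close> changes it by a unit complex factor only.\<close>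

definition \<zeta> :: "real^4 \<Rightarrow> complex" where
  "\<zeta> x = Complex (x \<bullet> w) (x \<bullet> qleft \<phi> w)"

lemma \<zeta>_add: "\<zeta> (x + y) = \<zeta> x + \<zeta> y"
  and \<zeta>_diff: "\<zeta> (x - y) = \<zeta> x - \<zeta> y"
  and \<zeta>_scaleR: "\<zeta> (c *\<^sub>R x) = complex_of_real c * \<zeta> x"
  and \<zeta>_0: "\<zeta> 0 = 0"
  by (simp_all add: \<zeta>_def complex_eq_iff inner_add_left inner_diff_left)

lemma \<zeta>_rotate: "\<zeta> (qleft \<phi> x) = \<i> * \<zeta> x"
proof -
  have "qleft \<phi> x \<bullet> qleft \<phi> w = x \<bullet> w"
    using unit by (simp add: qleft_inner_qleft_gen dot_square_norm)
  then show ?thesis by (simp add: \<zeta>_def complex_eq_iff qleft_inner)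
qed

lemma inner_eq_\<zeta>:
  assumes "in_plane \<phi> \<psi> x"
  shows "y \<bullet> x = Re (cnj (\<zeta> y) * \<zeta> x)"
  using arg_cong[OF in_plane_expand[OF unit(1,4) tangent assms], of "\<lambda>z. y \<bullet> z"]
  by (simp add: \<zeta>_def inner_add_right mult.commute)

lemma \<zeta>_normal: "in_plane \<phi> (- \<psi>) y \<Longrightarrow> \<zeta> y = 0"
  using in_plane_orthogonal[OF unit(1,2) tangent, of y] in_plane_orthogonal[OF unit(1,2) in_plane_rotate[OF tangent], of y]
  by (simp add: \<zeta>_def complex_eq_iff inner_commute[of y])

lemma plane_qleft: "a \<bullet> \<phi> = 0 \<Longrightarrow> in_plane \<phi> \<psi> (qleft a q)"
  using in_plane_qleft[OF normal, of a] by simp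

lemma plane_qright: "b \<bullet> \<psi> = 0 \<Longrightarrow> in_plane \<phi> \<psi> (qright q b)"
  using in_plane_qright[OF normal, of b] by simp

lemma inner_qleft_\<zeta>: "a' \<bullet> \<phi> = 0 \<Longrightarrow> a \<bullet> a' = Re (cnj (\<zeta> (qleft a q)) * \<zeta> (qleft a' q))"
  using inner_eq_\<zeta>[OF plane_qleft, of a' "qleft a q"] unit by (simp add: qleft_inner_qleft dot_square_norm)

lemma inner_qright_\<zeta>: "b' \<bullet> \<psi> = 0 \<Longrightarrow> b \<bullet> b' = Re (cnj (\<zeta> (qright q b)) * \<zeta> (qright q b'))"
  using inner_eq_\<zeta>[OF plane_qright, of b' "qright q b"] unit by (simp add: qright_inner_qright dot_square_norm)

text \<open>The complex structure of the first sphere becomes \<open>\<i>\<close>. A component of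
  \<open>a\<close> along \<phi> contributes a multiple of the normal vector \<open>\<phi> q\<close>,
  where \<zeta> vanishes, so second derivatives may be inserted for \<open>a\<close>.\<close>

lemma cross_qleft_\<zeta>:
  assumes "a' \<bullet> \<phi> = 0"
  shows "cross3 \<phi> a \<bullet> a' = Im (cnj (\<zeta> (qleft a q)) * \<zeta> (qleft a' q))"
proof -
  have "qleft (cross3 \<phi> a) q = qleft \<phi> (qleft a q) + (\<phi> \<bullet> a) *\<^sub>R q" by (simp add: qleft_qleft)
  then have "\<zeta> (qleft (cross3 \<phi> a) q) = \<i> * \<zeta> (qleft a q)"
    using \<zeta>_normal[OF normal] by (simp add: \<zeta>_add \<zeta>_scaleR \<zeta>_rotate)
  then show ?thesis unfolding inner_qleft_\<zeta>[OF assms] by simp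
qed

text \<open>Normality reads \<open>q \<psi> = - \<phi> q\<close>, so the complex structure of the
  second sphere becomes \<open>- \<i>\<close>. This sign turns the Lagrangian condition into the
  equality of two area forms.\<close>

lemma cross_qright_\<zeta>:
  assumes "b' \<bullet> \<psi> = 0"
  shows "cross3 \<psi> b \<bullet> b' = - Im (cnj (\<zeta> (qright q b)) * \<zeta> (qright q b'))"
proof -
  have "qright q (cross3 \<psi> b) = qright (qright q \<psi>) b + (\<psi> \<bullet> b) *\<^sub>R q" by (simp add: qright_qright)
  also have "qright (qright q \<psi>) b = - qleft \<phi> (qright q b)"
    using normal by (simp add: in_plane_minus qleft_qright qright.minus_left)
  finally have "\<zeta> (qright q (cross3 \<psi> b)) = - \<i> * \<zeta> (qright q b)"
    using \<zeta>_normal[OF normal] by (simp add: \<zeta>_diff \<zeta>_scaleR \<zeta>_rotate)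
  then show ?thesis unfolding inner_qright_\<zeta>[OF assms] by simp
qed

end

lemma normal_frame_exists:
  assumes "norm \<phi> = 1" "norm \<psi> = 1" "norm q = 1" "in_plane \<phi> (- \<psi>) q"
  obtains w where "normal_frame \<phi> \<psi> q w"
proof -
  obtain w where "norm w = 1" "in_plane \<phi> \<psi> w" using in_plane_exists_unit assms by metis
  then show ?thesis using that[of w] assms by (simp add: normal_frame_def)
qed

text \<open>The real part, and \<open>conjugate_phase_form\<close> the imaginary part, of
  \<open>cnj \<alpha> * \<beta>' - cnj \<alpha>' * \<beta>\<close>, where \<alpha> and \<beta> are
  the \<zeta>-coordinates of \<open>a q\<close> and \<open>q b\<close>: a 2-form of type (0,2) on
  the product of spheres.\<close>

definition phase_form :: "real^3 \<Rightarrow> real^3 \<Rightarrow> real^3 \<Rightarrow> real^3 \<Rightarrow> real^4 \<Rightarrow> real" where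
  "phase_form a a' b b' q = qleft a q \<bullet> qright q b' - qleft a' q \<bullet> qright q b"

definition conjugate_phase_form :: "real^3 \<Rightarrow> real^3 \<Rightarrow> real^3 \<Rightarrow> real^3 \<Rightarrow> real^3 \<Rightarrow> real^4 \<Rightarrow> real" where
  "conjugate_phase_form \<phi> a a' b b' q =
     qleft \<phi> (qleft a q) \<bullet> qright q b' - qleft \<phi> (qleft a' q) \<bullet> qright q b"

text \<open>For \<open>c = cos \<theta>\<close>, \<open>d = sin \<theta>\<close> the coordinate
  \<alpha> is multiplied by exp(-i \<theta>), since \<open>a\<close> anticommutes with \<phi>, and
  \<beta> by exp(i \<theta>); the complex form therefore turns by the double angle.\<close>

lemma phase_form_rotate:
  assumes "norm \<phi> = 1" "a \<bullet> \<phi> = 0" "a' \<bullet> \<phi> = 0"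
  shows "phase_form a a' b b' (c *\<^sub>R q + d *\<^sub>R qleft \<phi> q) =
    (c\<^sup>2 - d\<^sup>2) * phase_form a a' b b' q - 2 * c * d * conjugate_phase_form \<phi> a a' b b' q"
proof -
  have *: "qleft a (c *\<^sub>R q + d *\<^sub>R qleft \<phi> q) \<bullet> qright (c *\<^sub>R q + d *\<^sub>R qleft \<phi> q) b =
     (c\<^sup>2 - d\<^sup>2) * (qleft a q \<bullet> qright q b) - 2 * c * d * (qleft \<phi> (qleft a q) \<bullet> qright q b)"
    if "a \<bullet> \<phi> = 0" for a b
  proof -
    have 1: "qleft a (c *\<^sub>R q + d *\<^sub>R qleft \<phi> q) = c *\<^sub>R qleft a q - d *\<^sub>R qleft \<phi> (qleft a q)"
      using qleft_anticommute[OF that] by (simp add: qleft.add_right qleft.scaleR_right)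
    have 2: "qright (c *\<^sub>R q + d *\<^sub>R qleft \<phi> q) b = c *\<^sub>R qright q b + d *\<^sub>R qleft \<phi> (qright q b)"
      by (simp add: qright.add_left qright.scaleR_left qleft_qright)
    have 3: "qleft \<phi> (qleft a q) \<bullet> qleft \<phi> (qright q b) = qleft a q \<bullet> qright q b"
      using assms by (simp add: qleft_inner_qleft_gen dot_square_norm)
    have 4: "qleft a q \<bullet> qleft \<phi> (qright q b) = - (qleft \<phi> (qleft a q) \<bullet> qright q b)"
      by (simp add: qleft_inner)
    show ?thesis unfolding 1 2
      by (simp add: inner_add_right inner_diff_left 3 4 power2_eq_square algebra_simps)
  qed
  show ?thesis
    unfolding phase_form_def conjugate_phase_form_def *[OF assms(2)] *[OF assms(3)]
    by (simp add: algebra_simps)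
qed

subsection \<open>Mean curvature of surfaces\<close>

lemma closest_point_subspace:
  fixes M :: "'e::euclidean_space set"
  assumes "subspace M"
  shows "closest_point M x \<in> M" and "m \<in> M \<Longrightarrow> closest_point M x \<bullet> m = x \<bullet> m"
proof -
  have cl: "closed M" "convex M" "M \<noteq> {}"
    using assms by (auto simp: closed_subspace subspace_imp_convex subspace_0 dest: subspace_0)
  show in_M: "closest_point M x \<in> M" using closest_point_in_set[OF cl(1,3)] .
  assume m: "m \<in> M"
  let ?c = "closest_point M x"
  have "(x - ?c) \<bullet> ((?c + m) - ?c) \<le> 0" "(x - ?c) \<bullet> ((?c - m) - ?c) \<le> 0"
    using closest_point_dot[OF cl(2,1) subspace_add[OF assms in_M m], where a=x]
      closest_point_dot[OF cl(2,1) subspace_diff[OF assms in_M m], where a=x] by simp_all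
  then show "?c \<bullet> m = x \<bullet> m" by (simp add: inner_diff_left)
qed

lemma matrix_inv_2:
  fixes A :: "real^2^2"
  assumes "det A \<noteq> 0"
  shows "matrix_inv A $ 1 $ 1 = A$2$2 / det A" "matrix_inv A $ 1 $ 2 = - A$1$2 / det A"
    "matrix_inv A $ 2 $ 1 = - A$2$1 / det A" "matrix_inv A $ 2 $ 2 = A$1$1 / det A"
proof -
  define B :: "real^2^2" where
    "B = vector [vector [A$2$2 / det A, - A$1$2 / det A], vector [- A$2$1 / det A, A$1$1 / det A]]"
  have AB: "A ** B = mat 1" "B ** A = mat 1"
    using assms
    by (auto simp: vec_eq_iff forall_2 matrix_matrix_mult_def sum_2 mat_def B_def diff_divide_distrib[symmetric]
        add_divide_distrib[symmetric] det_2 mult.commute)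
  have "\<exists>A'. A ** A' = mat 1 \<and> A' ** A = mat 1" using AB by blast
  then have "A ** matrix_inv A = mat 1 \<and> matrix_inv A ** A = mat 1"
    unfolding matrix_inv_def by (rule someI_ex)
  then have "matrix_inv A = B" using AB by (metis matrix_mul_assoc matrix_mul_lid matrix_mul_rid)
  then show "matrix_inv A $ 1 $ 1 = A$2$2 / det A" "matrix_inv A $ 1 $ 2 = - A$1$2 / det A"
    "matrix_inv A $ 2 $ 1 = - A$2$1 / det A" "matrix_inv A $ 2 $ 2 = A$1$1 / det A"
    by (simp_all add: B_def)
qed

lemma vec2_expand: "(v::real^2) = v$1 *\<^sub>R axis 1 1 + v$2 *\<^sub>R axis 2 1"
  by (simp add: vec_eq_iff forall_2 axis_def)

lemma gram_det_neq_0: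
  fixes L :: "real^2 \<Rightarrow> 'e::euclidean_space"
  assumes "linear L" "inj L"
  shows "(L (axis 1 1) \<bullet> L (axis 1 1)) * (L (axis 2 1) \<bullet> L (axis 2 1)) - (L (axis 1 1) \<bullet> L (axis 2 1))\<^sup>2 \<noteq> 0"
proof
  let ?a = "L (axis 1 1)" and ?b = "L (axis 2 1)"
  assume 0: "(?a \<bullet> ?a) * (?b \<bullet> ?b) - (?a \<bullet> ?b)\<^sup>2 = 0"
  \<comment> \<open>\<open>L v\<close> is \<open>?b \<bullet> ?b\<close> times the part of
    \<open>?a\<close> orthogonal to \<open>?b\<close>, so its squared length contains the Gram
    determinant.\<close>
  define v :: "real^2" where "v = (?b \<bullet> ?b) *\<^sub>R axis 1 1 - (?a \<bullet> ?b) *\<^sub>R axis 2 1"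
  have Lv: "L v = (?b \<bullet> ?b) *\<^sub>R ?a - (?a \<bullet> ?b) *\<^sub>R ?b"
    using assms(1) by (simp add: v_def linear_diff linear_scale)
  have "L v \<bullet> L v = (?b \<bullet> ?b) * ((?a \<bullet> ?a) * (?b \<bullet> ?b) - (?a \<bullet> ?b)\<^sup>2)"
    unfolding Lv by (simp add: inner_diff_left inner_diff_right inner_commute power2_eq_square algebra_simps)
  with 0 have "v = 0" using assms linear_injective_0 by fastforce
  then have "v $ 1 = 0" by simp
  then have "?b \<bullet> ?b = 0" by (simp add: v_def axis_def)
  then have "axis 2 1 = (0::real^2)" using assms linear_injective_0 by fastforce
  then show False by (simp add: axis_eq_0_iff)
qed

text \<open>Pairing with a normal vector \<open>n\<close> makes the projection in the second
  fundamental form disappear, and multiplying by the Gram determinant clears the inverse metric.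
  What remains is polynomial in the first two derivatives.\<close>

lemma mean_curvature_vector_inner:
  fixes X :: "real^2 \<Rightarrow> 'e::euclidean_space" and u :: "real^2" and TN :: "'e \<Rightarrow> 'e set"
  defines "D \<equiv> frechet_derivative X (at u)"
  defines "M \<equiv> {n \<in> TN (X u). \<forall>z. n \<bullet> D z = 0}"
  defines "XX \<equiv> \<lambda>i j. frechet_derivative (\<lambda>y. frechet_derivative X (at y) (axis j 1)) (at u) (axis i 1)"
  assumes D: "linear D" "inj D" and M: "subspace M"
  shows "mean_curvature_vector TN X u \<in> M"
    and "n \<in> M \<Longrightarrow> 2 * ((D (axis 1 1) \<bullet> D (axis 1 1)) * (D (axis 2 1) \<bullet> D (axis 2 1)) - (D (axis 1 1) \<bullet> D (axis 2 1))\<^sup>2)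
        * (mean_curvature_vector TN X u \<bullet> n) =
      (D (axis 2 1) \<bullet> D (axis 2 1)) * (XX 1 1 \<bullet> n) - (D (axis 1 1) \<bullet> D (axis 2 1)) * (XX 1 2 \<bullet> n)
      - (D (axis 1 1) \<bullet> D (axis 2 1)) * (XX 2 1 \<bullet> n) + (D (axis 1 1) \<bullet> D (axis 1 1)) * (XX 2 2 \<bullet> n)"
proof -
  have sff: "second_fundamental_form TN X u (axis i 1) (axis j 1) = closest_point M (XX i j)" for i j
    by (simp add: second_fundamental_form_def M_def XX_def D_def)
  let ?g = "induced_metric X u"
  have g: "?g $ i $ j = D (axis i 1) \<bullet> D (axis j 1)" for i j
    by (simp add: induced_metric_def D_def)
  have det: "det ?g = (D (axis 1 1) \<bullet> D (axis 1 1)) * (D (axis 2 1) \<bullet> D (axis 2 1)) - (D (axis 1 1) \<bullet> D (axis 2 1))\<^sup>2"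
    by (simp add: det_2 g power2_eq_square inner_commute)
  then have det0: "det ?g \<noteq> 0" using gram_det_neq_0[OF D] by simp
  show "mean_curvature_vector TN X u \<in> M"
    unfolding mean_curvature_vector_def sff
    by (intro subspace_scale[OF M] subspace_sum[OF M] closest_point_subspace[OF M])
  assume n: "n \<in> M"
  have "mean_curvature_vector TN X u \<bullet> n = 1/2 * (\<Sum>i\<in>UNIV. \<Sum>j\<in>UNIV. matrix_inv ?g $ i $ j * (XX i j \<bullet> n))"
    unfolding mean_curvature_vector_def sff
    by (simp add: inner_sum_left closest_point_subspace(2)[OF M n])
  then have "mean_curvature_vector TN X u \<bullet> n = (?g$2$2 * (XX 1 1 \<bullet> n) - ?g$1$2 * (XX 1 2 \<bullet> n)
      - ?g$2$1 * (XX 2 1 \<bullet> n) + ?g$1$1 * (XX 2 2 \<bullet> n)) / (2 * det ?g)"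
    using det0 by (simp add: sum_2 matrix_inv_2 add_divide_distrib diff_divide_distrib)
  then have "2 * det ?g * (mean_curvature_vector TN X u \<bullet> n) =
      ?g$2$2 * (XX 1 1 \<bullet> n) - ?g$1$2 * (XX 1 2 \<bullet> n) - ?g$2$1 * (XX 2 1 \<bullet> n) + ?g$1$1 * (XX 2 2 \<bullet> n)"
    using det0 by simp
  then show "2 * ((D (axis 1 1) \<bullet> D (axis 1 1)) * (D (axis 2 1) \<bullet> D (axis 2 1)) - (D (axis 1 1) \<bullet> D (axis 2 1))\<^sup>2)
        * (mean_curvature_vector TN X u \<bullet> n) =
      (D (axis 2 1) \<bullet> D (axis 2 1)) * (XX 1 1 \<bullet> n) - (D (axis 1 1) \<bullet> D (axis 2 1)) * (XX 1 2 \<bullet> n)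
      - (D (axis 1 1) \<bullet> D (axis 2 1)) * (XX 2 1 \<bullet> n) + (D (axis 1 1) \<bullet> D (axis 1 1)) * (XX 2 2 \<bullet> n)"
    unfolding det g by (simp add: inner_commute)
qed

subsection \<open>Lagrangian charts\<close>

lemma has_derivative_constant_on_open:
  assumes "open U" "u \<in> U" "\<And>x. x \<in> U \<Longrightarrow> f x = c" "(f has_derivative f') (at u)"
  shows "f' v = 0"
proof -
  have "((\<lambda>_. c) has_derivative f') (at u)"
    by (rule has_derivative_transform_within_open[OF assms(4,1,2)]) (use assms(3) in simp)
  then have "f' = (\<lambda>_. 0)" using has_derivative_unique has_derivative_const by blast
  then show ?thesis by simp
qed

lemma cross3_coplanar:
  assumes "norm a = 1" "x \<bullet> a = 0" "y \<bullet> a = 0" "z \<bullet> a = 0"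
  shows "cross3 x y \<bullet> z = 0"
proof -
  have "cross3 a (cross3 x y) = (a \<bullet> y) *\<^sub>R x - (a \<bullet> x) *\<^sub>R y"
    by (simp add: quat_simps algebra_simps)
  then have "cross3 a (cross3 x y) = 0" using assms by (simp add: inner_commute)
  from cross3_eq_0_unit[OF assms(1) this] have "cross3 x y \<bullet> z = (cross3 x y \<bullet> a) * (a \<bullet> z)"
    by (metis inner_scaleR_left)
  then show ?thesis using assms(4) by (simp add: inner_commute)
qed

lemma cross3_inner_swap: "cross3 a x \<bullet> y = - (cross3 a y \<bullet> x)"
  by (simp add: quat_simps algebra_simps)

lemma orthonormal_pair_exists:
  fixes L :: "real^2 \<Rightarrow> 'e::euclidean_space"
  assumes L: "linear L" "inj L" and v: "v \<noteq> 0"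
  obtains x y c where "norm (L x) = 1" "norm (L y) = 1" "L x \<bullet> L y = 0" "v = c *\<^sub>R x"
proof -
  have L0: "L z = 0 \<longleftrightarrow> z = 0" for z using L linear_injective_0 linear_0 by blast
  define x where "x = (1 / norm (L v)) *\<^sub>R v"
  have x: "norm (L x) = 1" "v = norm (L v) *\<^sub>R x" using v L0 by (simp_all add: x_def linear_scale[OF L(1)])
  \<comment> \<open>A quarter turn of \<open>v\<close> in the parameter plane is independent of
    \<open>v\<close>; Gram-Schmidt for the pulled back metric starts from it.\<close>
  define y0 :: "real^2" where "y0 = vector [- v$2, v$1]"
  define z where "z = y0 - (L y0 \<bullet> L x) *\<^sub>R x"
  have "z \<noteq> 0"
  proof
    assume "z = 0"
    then have "y0 = ((L y0 \<bullet> L x) / norm (L v)) *\<^sub>R v" by (simp add: z_def x_def)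
    then obtain t where "y0 = t *\<^sub>R v" by blast
    then have t: "- v$2 = t * v$1" "v$1 = t * v$2" by (auto simp: y0_def vec_eq_iff forall_2)
    have "(1 + t\<^sup>2) * v$2 = v$2 + t * (t * v$2)" by (simp add: power2_eq_square algebra_simps)
    also have "\<dots> = 0" using t(1) unfolding t(2) by linarith
    finally have "(1 + t\<^sup>2) * v$2 = 0" .
    moreover have "1 + t\<^sup>2 \<noteq> 0" by (metis power_one sum_power2_eq_zero_iff zero_neq_one)
    ultimately have "v$2 = 0" by simp
    with t v show False by (simp add: vec_eq_iff forall_2)
  qed
  then have Lz: "L z \<noteq> 0" using L0 by simp
  have "L z = L y0 - (L y0 \<bullet> L x) *\<^sub>R L x"
    by (simp add: z_def linear_diff[OF L(1)] linear_scale[OF L(1)])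
  then have "L z \<bullet> L x = 0" using x(1) by (simp add: inner_diff_left dot_square_norm)
  then show ?thesis
    using that[of x "(1 / norm (L z)) *\<^sub>R z" "norm (L v)"] x Lz
    by (simp add: linear_scale[OF L(1)] inner_commute)
qed

lemma differentiable_bounded_bilinear:
  assumes "bounded_bilinear B" "f differentiable (at u)" "g differentiable (at u)"
  shows "(\<lambda>u. B (f u) (g u)) differentiable (at u)"
  using assms bounded_bilinear.FDERIV[OF assms(1)] unfolding differentiable_def by blast

text \<open>The candidates for the value at \<open>p\<close> of a minimal immersion with Gauss map \<open>(\<phi>, \<psi>)\<close>: \<open>q\<close> is a unit normal
  of the plane, and the last condition says that the derivatives of \<open>q\<close> and of \<open>\<phi> q\<close> in the normal
  connection are related by a trace-free operator.\<close>

definition gauss_lifts :: "(real^3) \<times> (real^3) \<Rightarrow> ((real^3) \<times> (real^3)) set \<Rightarrow> (real^4) set" where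
  "gauss_lifts p T = {q. norm q = 1 \<and> in_plane (fst p) (- snd p) q \<and>
     (\<forall>E\<in>T. \<forall>F\<in>T. phase_form (fst E) (fst F) (snd E) (snd F) q = 0)}"

abbreviation e1 :: "real^2" where "e1 \<equiv> axis 1 1"
abbreviation e2 :: "real^2" where "e2 \<equiv> axis 2 1"

text \<open>The hypotheses of the theorem read in one chart; \<open>jac\<close> is the bound on
  \<open>C_squared\<close>, evaluated on orthonormal pairs.\<close>

locale lagrangian_chart =
  fixes V :: "(real^2) set" and X :: "real^2 \<Rightarrow> (real^3) \<times> (real^3)"
  assumes open_V: "open V" and smooth: "smooth_on V X"
    and inj: "\<And>u. u \<in> V \<Longrightarrow> inj (frechet_derivative X (at u))"
    and on_spheres: "\<And>u. u \<in> V \<Longrightarrow> X u \<in> S2xS2"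
    and lag: "\<And>u v w. u \<in> V \<Longrightarrow> omega_S2xS2 (X u) (frechet_derivative X (at u) v) (frechet_derivative X (at u) w) = 0"
    and minimal: "\<And>u. u \<in> V \<Longrightarrow> mean_curvature_vector tangent_S2xS2 X u = 0"
    and jac: "\<And>u v w. u \<in> V \<Longrightarrow> norm (frechet_derivative X (at u) v) = 1 \<Longrightarrow> norm (frechet_derivative X (at u) w) = 1 \<Longrightarrow>
       frechet_derivative X (at u) v \<bullet> frechet_derivative X (at u) w = 0 \<Longrightarrow>
       (cross3 (fst (X u)) (fst (frechet_derivative X (at u) v)) \<bullet> fst (frechet_derivative X (at u) w))\<^sup>2 < 1/4"
begin

abbreviation "dX u \<equiv> frechet_derivative X (at u)"

definition "\<phi> u = fst (X u)"
definition "\<psi> u = snd (X u)"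
definition "a v u = fst (dX u v)"
definition "b v u = snd (dX u v)"
definition "aa v w u = fst (frechet_derivative (\<lambda>y. frechet_derivative X (at y) v) (at u) w)"
definition "bb v w u = snd (frechet_derivative (\<lambda>y. frechet_derivative X (at y) v) (at u) w)"

abbreviation "phase u \<equiv> phase_form (a e1 u) (a e2 u) (b e1 u) (b e2 u)"
abbreviation "conjugate_phase u \<equiv> conjugate_phase_form (\<phi> u) (a e1 u) (a e2 u) (b e1 u) (b e2 u)"

definition "lifts u = gauss_lifts (X u) (range (dX u))"

lemma linear_D: "u \<in> V \<Longrightarrow> linear (dX u)"
  using has_derivative_linear[OF smooth_on_has_derivative[OF smooth]] .

lemma linear_a: "u \<in> V \<Longrightarrow> linear (\<lambda>v. a v u)" and linear_b: "u \<in> V \<Longrightarrow> linear (\<lambda>v. b v u)"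
  using linear_D by (simp_all add: a_def b_def linear_iff)

lemma has_derivative_\<phi>: "u \<in> V \<Longrightarrow> (\<phi> has_derivative (\<lambda>v. a v u)) (at u)"
  and has_derivative_\<psi>: "u \<in> V \<Longrightarrow> (\<psi> has_derivative (\<lambda>v. b v u)) (at u)"
  unfolding \<phi>_def[abs_def] \<psi>_def[abs_def] a_def b_def
  by (intro has_derivative_fst has_derivative_snd smooth_on_has_derivative[OF smooth]; assumption)+

lemma has_derivative_a: "u \<in> V \<Longrightarrow> (a v has_derivative (\<lambda>w. aa v w u)) (at u)"
  and has_derivative_b: "u \<in> V \<Longrightarrow> (b v has_derivative (\<lambda>w. bb v w u)) (at u)"
  unfolding a_def[abs_def] b_def[abs_def] aa_def bb_def
  by (intro has_derivative_fst has_derivative_snd smooth_on_has_derivative[OF smooth_on_frechet_derivative[OF smooth]]; assumption)+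

lemma aa_commute: "u \<in> V \<Longrightarrow> aa v w u = aa w v u"
  and bb_commute: "u \<in> V \<Longrightarrow> bb v w u = bb w v u"
  using mixed_derivatives_commute[OF open_V, of u X v w] smooth unfolding aa_def bb_def smooth_on_def by simp_all

lemma unit_\<phi>: "u \<in> V \<Longrightarrow> norm (\<phi> u) = 1" and unit_\<psi>: "u \<in> V \<Longrightarrow> norm (\<psi> u) = 1"
  using on_spheres[of u] by (auto simp: S2xS2_def \<phi>_def \<psi>_def mem_Times_iff)

lemma a_tangent: "u \<in> V \<Longrightarrow> a v u \<bullet> \<phi> u = 0"
proof -
  assume u: "u \<in> V"
  have "\<phi> u \<bullet> a v u + a v u \<bullet> \<phi> u = 0"
    by (rule has_derivative_constant_on_open[OF open_V u _ has_derivative_inner[OF has_derivative_\<phi>[OF u] has_derivative_\<phi>[OF u]]])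
      (simp add: unit_\<phi> dot_square_norm)
  then show ?thesis by (simp add: inner_commute)
qed

lemma b_tangent: "u \<in> V \<Longrightarrow> b v u \<bullet> \<psi> u = 0"
proof -
  assume u: "u \<in> V"
  have "\<psi> u \<bullet> b v u + b v u \<bullet> \<psi> u = 0"
    by (rule has_derivative_constant_on_open[OF open_V u _ has_derivative_inner[OF has_derivative_\<psi>[OF u] has_derivative_\<psi>[OF u]]])
      (simp add: unit_\<psi> dot_square_norm)
  then show ?thesis by (simp add: inner_commute)
qed

lemma lagrangian_eq: "u \<in> V \<Longrightarrow> cross3 (\<phi> u) (a v u) \<bullet> a w u + cross3 (\<psi> u) (b v u) \<bullet> b w u = 0"
  using lag[of u v w] by (simp add: omega_S2xS2_def J_S2xS2_def \<phi>_def \<psi>_def a_def b_def inner_prod_def)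

text \<open>Where the derivative falls on the complex structure, it leaves a triple product of three
  vectors tangent to one sphere at the same point, which is zero.\<close>

lemma lagrangian_derivative:
  assumes u: "u \<in> V"
  shows "cross3 (\<phi> u) (aa v k u) \<bullet> a w u - cross3 (\<phi> u) (aa w k u) \<bullet> a v u
     + (cross3 (\<psi> u) (bb v k u) \<bullet> b w u - cross3 (\<psi> u) (bb w k u) \<bullet> b v u) = 0"
proof -
  have bc: "bounded_bilinear cross3" unfolding bilinear_conv_bounded_bilinear[symmetric] by (rule bilinear_cross)
  have "cross3 (\<phi> u) (a v u) \<bullet> aa w k u + (cross3 (\<phi> u) (aa v k u) + cross3 (a k u) (a v u)) \<bullet> a w u
    + (cross3 (\<psi> u) (b v u) \<bullet> bb w k u + (cross3 (\<psi> u) (bb v k u) + cross3 (b k u) (b v u)) \<bullet> b w u) = 0"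
    by (rule has_derivative_constant_on_open[OF open_V u lagrangian_eq
          has_derivative_add[OF
            has_derivative_inner[OF bounded_bilinear.FDERIV[OF bc has_derivative_\<phi>[OF u] has_derivative_a[OF u]] has_derivative_a[OF u]]
            has_derivative_inner[OF bounded_bilinear.FDERIV[OF bc has_derivative_\<psi>[OF u] has_derivative_b[OF u]] has_derivative_b[OF u]]]])
  moreover have "cross3 (a k u) (a v u) \<bullet> a w u = 0" "cross3 (b k u) (b v u) \<bullet> b w u = 0"
    using cross3_coplanar u unit_\<phi> unit_\<psi> a_tangent b_tangent by blast+
  ultimately show ?thesis
    using cross3_inner_swap[of "\<phi> u" "a v u" "aa w k u"] cross3_inner_swap[of "\<psi> u" "b v u" "bb w k u"]
    by (simp add: inner_add_left)
qed

text \<open>On a Lagrangian surface \<open>J\<close> sends tangent vectors to normal ones, so the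
  mean curvature vector may be tested against \<open>J dX k\<close>.\<close>

lemma trace_zero:
  fixes k :: "real^2"
  assumes u: "u \<in> V"
  defines "S \<equiv> \<lambda>v w. cross3 (\<phi> u) (aa v w u) \<bullet> a k u + cross3 (\<psi> u) (bb v w u) \<bullet> b k u"
  shows "(a e2 u \<bullet> a e2 u + b e2 u \<bullet> b e2 u) * S e1 e1 - 2 * (a e1 u \<bullet> a e2 u + b e1 u \<bullet> b e2 u) * S e1 e2
    + (a e1 u \<bullet> a e1 u + b e1 u \<bullet> b e1 u) * S e2 e2 = 0"
proof -
  define n where "n = (cross3 (\<phi> u) (a k u), cross3 (\<psi> u) (b k u))"
  let ?M = "{n \<in> tangent_S2xS2 (X u). \<forall>z. n \<bullet> dX u z = 0}"
  have M: "subspace ?M"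
    by (auto simp: subspace_def tangent_S2xS2_def inner_add_left inner_add_right)
  have "n \<in> ?M"
    using lagrangian_eq[OF u] unfolding n_def
    by (simp add: tangent_S2xS2_def inner_prod_def \<phi>_def \<psi>_def a_def b_def dot_cross_self)
  then have H: "0 = (dX u e2 \<bullet> dX u e2) * (frechet_derivative (\<lambda>y. frechet_derivative X (at y) e1) (at u) e1 \<bullet> n)
    - (dX u e1 \<bullet> dX u e2) * (frechet_derivative (\<lambda>y. frechet_derivative X (at y) e2) (at u) e1 \<bullet> n)
    - (dX u e1 \<bullet> dX u e2) * (frechet_derivative (\<lambda>y. frechet_derivative X (at y) e1) (at u) e2 \<bullet> n)
    + (dX u e1 \<bullet> dX u e1) * (frechet_derivative (\<lambda>y. frechet_derivative X (at y) e2) (at u) e2 \<bullet> n)"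
    using mean_curvature_vector_inner(2)[where X=X and u=u and TN=tangent_S2xS2 and n=n, OF linear_D[OF u] inj[OF u] M] minimal[OF u]
    by simp
  have S: "frechet_derivative (\<lambda>y. frechet_derivative X (at y) v) (at u) w \<bullet> n = - S v w" for v w
    using cross3_inner_swap[of "\<phi> u" "a k u" "aa v w u"] cross3_inner_swap[of "\<psi> u" "b k u" "bb v w u"]
    by (simp add: S_def n_def inner_prod_def aa_def bb_def inner_commute)
  have D: "dX u v \<bullet> dX u w = a v u \<bullet> a w u + b v u \<bullet> b w u" for v w
    by (simp add: inner_prod_def a_def b_def)
  have "S e2 e1 = S e1 e2" by (simp add: S_def aa_commute[OF u, of e2] bb_commute[OF u, of e2])
  with H show ?thesis unfolding S D by (simp add: algebra_simps)
qed

text \<open>The phase form is bilinear and alternating in the two tangent vectors, so the condition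
  over the whole tangent plane, which does not depend on a chart, reduces to one equation on
  \<open>e1\<close>, \<open>e2\<close>.\<close>

lemma lifts_iff:
  assumes u: "u \<in> V"
  shows "q \<in> lifts u \<longleftrightarrow> norm q = 1 \<and> in_plane (\<phi> u) (- \<psi> u) q \<and>
    phase u q = 0"
proof -
  have "phase_form (a v u) (a w u) (b v u) (b w u) q = (v$1 * w$2 - v$2 * w$1) * phase u q" for v w
  proof -
    have 1: "a v u = v$1 *\<^sub>R a e1 u + v$2 *\<^sub>R a e2 u" "b v u = v$1 *\<^sub>R b e1 u + v$2 *\<^sub>R b e2 u" for v
      by (subst vec2_expand[of v], simp add: linear_add[OF linear_a[OF u]] linear_scale[OF linear_a[OF u]]
          linear_add[OF linear_b[OF u]] linear_scale[OF linear_b[OF u]])+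
    show ?thesis
      unfolding phase_form_def 1[of v] 1[of w]
      by (simp add: qleft.add_left qright.add_right qleft.scaleR_left qright.scaleR_right inner_add_left inner_add_right algebra_simps)
  qed
  then have "(\<forall>v w. phase_form (a v u) (a w u) (b v u) (b w u) q = 0) \<longleftrightarrow>
      phase u q = 0" by (metis mult_zero_right)
  then show ?thesis
    unfolding lifts_def gauss_lifts_def \<phi>_def \<psi>_def a_def b_def by simp
qed

lemma lifts_normal_frame:
  assumes "u \<in> V" "q \<in> lifts u"
  obtains w where "normal_frame (\<phi> u) (\<psi> u) q w"
  using normal_frame_exists[of "\<phi> u" "\<psi> u" q] assms lifts_iff unit_\<phi> unit_\<psi> by blast

text \<open>The derivatives of the two factors, carried into the tangent plane by Clifford
  multiplication on \<open>q\<close> and read as complex-valued one-forms.\<close>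

definition "\<alpha> w q u v = normal_frame.\<zeta> (\<phi> u) w (qleft (a v u) q)"
definition "\<beta> w q u v = normal_frame.\<zeta> (\<phi> u) w (qright q (b v u))"

context
  fixes u :: "real^2" and q w :: "real^4"
  assumes u: "u \<in> V" and nf: "normal_frame (\<phi> u) (\<psi> u) q w"
begin

interpretation nf: normal_frame "\<phi> u" "\<psi> u" q w by (rule nf)

lemma frame_lagrangian: "Im (cnj (\<alpha> w q u v) * \<alpha> w q u v') = Im (cnj (\<beta> w q u v) * \<beta> w q u v')"
  using lagrangian_eq[OF u, of v v'] nf.cross_qleft_\<zeta>[OF a_tangent[OF u]] nf.cross_qright_\<zeta>[OF b_tangent[OF u]]
  by (simp add: \<alpha>_def \<beta>_def)

lemma frame_inner_a: "a v u \<bullet> a v' u = Re (cnj (\<alpha> w q u v) * \<alpha> w q u v')"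
  and frame_inner_b: "b v u \<bullet> b v' u = Re (cnj (\<beta> w q u v) * \<beta> w q u v')"
  using nf.inner_qleft_\<zeta>[OF a_tangent[OF u]] nf.inner_qright_\<zeta>[OF b_tangent[OF u]] by (simp_all add: \<alpha>_def \<beta>_def)

lemma frame_norm_a: "a v u \<bullet> a v u = (cmod (\<alpha> w q u v))\<^sup>2"
  and frame_norm_b: "b v u \<bullet> b v u = (cmod (\<beta> w q u v))\<^sup>2"
  unfolding frame_inner_a frame_inner_b cmod_power2 by (simp_all add: power2_eq_square)

lemma frame_linear_a: "\<alpha> w q u (s *\<^sub>R v + t *\<^sub>R v') = complex_of_real s * \<alpha> w q u v + complex_of_real t * \<alpha> w q u v'"
  and frame_linear_b: "\<beta> w q u (s *\<^sub>R v + t *\<^sub>R v') = complex_of_real s * \<beta> w q u v + complex_of_real t * \<beta> w q u v'"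
  by (simp_all add: \<alpha>_def \<beta>_def linear_add[OF linear_a[OF u]] linear_scale[OF linear_a[OF u]]
     linear_add[OF linear_b[OF u]] linear_scale[OF linear_b[OF u]] qleft.add_left qleft.scaleR_left
     qright.add_right qright.scaleR_right nf.\<zeta>_add nf.\<zeta>_scaleR)

lemma frame_inner_mixed: "qleft x q \<bullet> qright q (b v u) = Re (cnj (nf.\<zeta> (qleft x q)) * \<beta> w q u v)"
  and frame_inner_mixed': "qleft (a v u) q \<bullet> qright q y = Re (cnj (\<alpha> w q u v) * nf.\<zeta> (qright q y))"
  and frame_inner_conjugate: "qleft (\<phi> u) (qleft x q) \<bullet> qright q (b v u) = Im (cnj (nf.\<zeta> (qleft x q)) * \<beta> w q u v)"
  using nf.inner_eq_\<zeta>[OF nf.plane_qright[OF b_tangent[OF u]]]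
    nf.inner_eq_\<zeta>[OF nf.plane_qleft[OF a_tangent[OF u]], of "qright q y" v]
  by (simp_all add: \<alpha>_def \<beta>_def nf.\<zeta>_rotate inner_commute[of "qleft (a v u) q"] algebra_simps)

lemma frame_phase_form:
  "phase_form (a v u) (a v' u) (b v u) (b v' u) q = Re (cnj (\<alpha> w q u v) * \<beta> w q u v') - Re (cnj (\<alpha> w q u v') * \<beta> w q u v)"
  unfolding phase_form_def frame_inner_mixed by (simp add: \<alpha>_def)

lemma frame_conjugate_phase_form:
  "conjugate_phase_form (\<phi> u) (a v u) (a v' u) (b v u) (b v' u) q =
     Im (cnj (\<alpha> w q u v) * \<beta> w q u v') - Im (cnj (\<alpha> w q u v') * \<beta> w q u v)"
  unfolding conjugate_phase_form_def frame_inner_conjugate by (simp add: \<alpha>_def)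

lemma frame_\<zeta>_sum: "nf.\<zeta> (qleft (a v u) q + qright q (b v u)) = \<alpha> w q u v + \<beta> w q u v"
  by (simp add: \<alpha>_def \<beta>_def nf.\<zeta>_add)

text \<open>If both vanished, some nonzero \<open>v\<close> would be annihilated by both one-forms,
  hence by the derivative of the immersion.\<close>

lemma frame_phase_forms_nonzero:
  "phase u q \<noteq> 0 \<or>
   conjugate_phase u q \<noteq> 0"
proof (rule ccontr)
  assume "\<not> ?thesis"
  then have "cnj (\<alpha> w q u e1) * \<beta> w q u e2 = cnj (\<alpha> w q u e2) * \<beta> w q u e1"
    unfolding frame_phase_form frame_conjugate_phase_form by (simp add: complex_eq_iff)
  from phase_forms_dependent[OF frame_lagrangian this] obtain s t
    where st: "s \<noteq> 0 \<or> t \<noteq> 0" and 0: "complex_of_real s * \<alpha> w q u e1 + complex_of_real t * \<alpha> w q u e2 = 0"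
      "complex_of_real s * \<beta> w q u e1 + complex_of_real t * \<beta> w q u e2 = 0" by blast
  define v where "v = s *\<^sub>R e1 + t *\<^sub>R e2"
  have "\<alpha> w q u v = 0" "\<beta> w q u v = 0" using 0 by (simp_all add: v_def frame_linear_a frame_linear_b)
  then have "a v u = 0" "b v u = 0" using frame_norm_a[of v] frame_norm_b[of v] by simp_all
  then have "dX u v = 0" by (simp add: a_def b_def prod_eq_iff)
  then have "v = 0" using linear_injective_0[OF linear_D[OF u]] inj[OF u] by blast
  then have "s = 0" "t = 0" by (auto simp: v_def vec_eq_iff forall_2 axis_def)
  with st show False by simp
qed

text \<open>Up to the factor i/2, \<open>\<alpha> + \<beta>\<close> is the derivative of the lift;
  this is where the bound on C^2 makes the lift an immersion. As the bound concerns orthonormal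
  pairs, a pair beginning in the direction of \<open>v\<close> is used.\<close>

lemma frame_sum_nonzero:
  assumes q: "q \<in> lifts u" and v: "v \<noteq> 0"
  shows "\<alpha> w q u v + \<beta> w q u v \<noteq> 0"
proof -
  let ?D = "dX u"
  obtain x y c where on: "norm (?D x) = 1" "norm (?D y) = 1" "?D x \<bullet> ?D y = 0" and vc: "v = c *\<^sub>R x"
    using orthonormal_pair_exists[OF linear_D[OF u] inj[OF u] v] by blast
  have D: "?D x' \<bullet> ?D y' = Re (cnj (\<alpha> w q u x') * \<alpha> w q u y') + Re (cnj (\<beta> w q u x') * \<beta> w q u y')" for x' y'
    unfolding frame_inner_a[symmetric] frame_inner_b[symmetric] by (simp add: inner_prod_def a_def b_def)
  have sq: "Re (cnj z * z) = (cmod z)\<^sup>2" for z unfolding cmod_power2 by (simp add: power2_eq_square)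
  have "(cmod (\<alpha> w q u x))\<^sup>2 + (cmod (\<beta> w q u x))\<^sup>2 = 1" "(cmod (\<alpha> w q u y))\<^sup>2 + (cmod (\<beta> w q u y))\<^sup>2 = 1"
      "Re (cnj (\<alpha> w q u x) * \<alpha> w q u y) + Re (cnj (\<beta> w q u x) * \<beta> w q u y) = 0"
    unfolding sq[symmetric] D[symmetric] using on by (simp_all add: dot_square_norm)
  moreover have "Re (cnj (\<alpha> w q u x) * \<beta> w q u y) = Re (cnj (\<alpha> w q u y) * \<beta> w q u x)"
    using q frame_phase_form[of x y] by (simp add: lifts_def gauss_lifts_def a_def b_def)
  moreover have "(Im (cnj (\<alpha> w q u x) * \<alpha> w q u y))\<^sup>2 < 1/4"
    using jac[OF u on] nf.cross_qleft_\<zeta>[OF a_tangent[OF u]]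
    by (simp add: \<phi>_def[symmetric] a_def[symmetric] \<alpha>_def)
  ultimately have "Im (cnj (\<alpha> w q u x + \<beta> w q u x) * (\<alpha> w q u y + \<beta> w q u y)) \<noteq> 0"
    using frame_lagrangian by (intro sum_nondegenerate)
  then have "\<alpha> w q u x + \<beta> w q u x \<noteq> 0" by (metis complex_cnj_zero mult_zero_left zero_complex.simps(2))
  moreover have "\<alpha> w q u v + \<beta> w q u v = complex_of_real c * (\<alpha> w q u x + \<beta> w q u x)"
    using frame_linear_a[of c x 0 x] frame_linear_b[of c x 0 x] by (simp add: vc algebra_simps)
  moreover have "c \<noteq> 0" using v vc by auto
  ultimately show ?thesis by simp
qed

lemma frame_sum_independent:
  assumes q: "q \<in> lifts u"
  shows "Im (cnj (\<alpha> w q u e1 + \<beta> w q u e1) * (\<alpha> w q u e2 + \<beta> w q u e2)) \<noteq> 0"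
proof
  assume "Im (cnj (\<alpha> w q u e1 + \<beta> w q u e1) * (\<alpha> w q u e2 + \<beta> w q u e2)) = 0"
  from complex_real_dependent[OF this] obtain s t where st: "s \<noteq> 0 \<or> t \<noteq> 0"
    and 0: "complex_of_real s * (\<alpha> w q u e1 + \<beta> w q u e1) + complex_of_real t * (\<alpha> w q u e2 + \<beta> w q u e2) = 0" by blast
  have "\<alpha> w q u (s *\<^sub>R e1 + t *\<^sub>R e2) + \<beta> w q u (s *\<^sub>R e1 + t *\<^sub>R e2) = 0"
    using 0 by (simp add: frame_linear_a frame_linear_b algebra_simps)
  then have "s *\<^sub>R e1 + t *\<^sub>R e2 = 0" using frame_sum_nonzero[OF q] by blast
  then have "s = 0" "t = 0" by (auto simp: vec_eq_iff forall_2 axis_def)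
  with st show False by simp
qed

text \<open>Here the minimality of \<Phi> enters: with \<open>q\<close> held fixed, the phase form
  has derivative zero.\<close>

lemma frame_phase_derivative:
  assumes q: "q \<in> lifts u" and k: "k = e1 \<or> k = e2"
  shows "qleft (aa e1 k u) q \<bullet> qright q (b e2 u) + qleft (a e1 u) q \<bullet> qright q (bb e2 k u)
     - qleft (aa e2 k u) q \<bullet> qright q (b e1 u) - qleft (a e2 u) q \<bullet> qright q (bb e1 k u) = 0"
proof -
  \<comment> \<open>The second derivatives are not tangent to the spheres, but their components
    along \<phi> and \<psi> give multiples of \<open>\<phi> q\<close>, which \<zeta> kills.\<close>
  define A where "A v k = nf.\<zeta> (qleft (aa v k u) q)" for v k
  define B where "B v k = nf.\<zeta> (qright q (bb v k u))" for v k
  have comm: "A e2 e1 = A e1 e2" "B e2 e1 = B e1 e2"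
    by (simp_all add: A_def B_def aa_commute[OF u, of e2] bb_commute[OF u, of e2])
  have cA: "cross3 (\<phi> u) (aa v k u) \<bullet> a v' u = Im (cnj (A v k) * \<alpha> w q u v')"
    and cB: "cross3 (\<psi> u) (bb v k u) \<bullet> b v' u = - Im (cnj (B v k) * \<beta> w q u v')" for v v' k
    using nf.cross_qleft_\<zeta>[OF a_tangent[OF u]] nf.cross_qright_\<zeta>[OF b_tangent[OF u]]
    by (simp_all add: A_def B_def \<alpha>_def \<beta>_def)
  have lag: "Im (cnj (A e1 k) * \<alpha> w q u e2 + cnj (\<alpha> w q u e1) * A e2 k) =
      Im (cnj (B e1 k) * \<beta> w q u e2 + cnj (\<beta> w q u e1) * B e2 k)" for k
    using lagrangian_derivative[OF u, of e1 k e2] unfolding cA cB by (simp add: algebra_simps)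
  have tr: "(a e2 u \<bullet> a e2 u + b e2 u \<bullet> b e2 u) * Im (cnj (A e1 e1) * \<alpha> w q u k - cnj (B e1 e1) * \<beta> w q u k)
      - 2 * (a e1 u \<bullet> a e2 u + b e1 u \<bullet> b e2 u) * Im (cnj (A e1 e2) * \<alpha> w q u k - cnj (B e1 e2) * \<beta> w q u k)
      + (a e1 u \<bullet> a e1 u + b e1 u \<bullet> b e1 u) * Im (cnj (A e2 e2) * \<alpha> w q u k - cnj (B e2 e2) * \<beta> w q u k) = 0" for k
    using trace_zero[OF u, of k] unfolding cA cB by (simp only: minus_complex.simps add_uminus_conv_diff)
  have phase: "Re (cnj (\<alpha> w q u e1) * \<beta> w q u e2) = Re (cnj (\<alpha> w q u e2) * \<beta> w q u e1)"
    using q lifts_iff[OF u] frame_phase_form[of e1 e2] by simp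
  have tr': "(a e2 u \<bullet> a e2 u + b e2 u \<bullet> b e2 u) * Im (cnj (A e1 e1) * x - cnj (B e1 e1) * y)
      - 2 * (a e1 u \<bullet> a e2 u + b e1 u \<bullet> b e2 u) * Im (cnj (A e1 e2) * x - cnj (B e1 e2) * y)
      + (a e1 u \<bullet> a e1 u + b e1 u \<bullet> b e1 u) * Im (cnj (A e2 e2) * x - cnj (B e2 e2) * y) = 0"
    if "(x, y) = (\<alpha> w q u e1, \<beta> w q u e1) \<or> (x, y) = (\<alpha> w q u e2, \<beta> w q u e2)" for x y
    using tr[of e1] tr[of e2] that by blast
  note zero = phase_derivative_zero[where ?A11.0="A e1 e1" and ?A12.0="A e1 e2" and ?A22.0="A e2 e2"
    and ?B11.0="B e1 e1" and ?B12.0="B e1 e2" and ?B22.0="B e2 e2",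
    OF frame_lagrangian phase frame_sum_independent[OF q] _ _ _ _ _ tr',
    unfolded frame_norm_a frame_norm_b frame_inner_a frame_inner_b, OF _ _ refl refl refl]
  have "Re (cnj (A e1 e1) * \<beta> w q u e2 + cnj (\<alpha> w q u e1) * B e1 e2 - cnj (A e1 e2) * \<beta> w q u e1 - cnj (\<alpha> w q u e2) * B e1 e1) = 0"
    "Re (cnj (A e1 e2) * \<beta> w q u e2 + cnj (\<alpha> w q u e1) * B e2 e2 - cnj (A e2 e2) * \<beta> w q u e1 - cnj (\<alpha> w q u e2) * B e1 e2) = 0"
    by (rule zero; use lag[of e1] lag[of e2] in \<open>simp add: comm\<close>)+
  then show ?thesis
    using k unfolding frame_inner_mixed frame_inner_mixed' by (auto simp: A_def B_def comm[unfolded A_def B_def])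
qed

end

lemma phase_forms_nonzero:
  assumes "u \<in> V" "norm q = 1" "in_plane (\<phi> u) (- \<psi> u) q"
  shows "phase u q \<noteq> 0 \<or>
   conjugate_phase u q \<noteq> 0"
  using normal_frame_exists[OF unit_\<phi> unit_\<psi> assms(2,3)] assms(1) frame_phase_forms_nonzero by metis

lemma sum_nonzero:
  assumes "u \<in> V" "q \<in> lifts u" "v \<noteq> 0"
  shows "qleft (a v u) q + qright q (b v u) \<noteq> 0"
proof -
  obtain w where w: "normal_frame (\<phi> u) (\<psi> u) q w" using lifts_normal_frame assms by blast
  show ?thesis
    using frame_sum_nonzero[OF assms(1) w assms(2,3)] frame_\<zeta>_sum[OF assms(1) w, of v] normal_frame.\<zeta>_0[OF w] by metis
qed

end

section \<open>Existence, number and differentiability of the lifts in a chart\<close>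

lemma differentiable_sqrt:
  fixes f :: "'a::real_normed_vector \<Rightarrow> real"
  assumes "f differentiable (at u)" "f u > 0"
  shows "(\<lambda>u. sqrt (f u)) differentiable (at u)"
  using assms has_derivative_real_sqrt unfolding differentiable_def by blast

text \<open>With \<open>t = h / D\<close> the phase form vanishes on \<open>s + t \<phi> s\<close>; the denominator \<open>D\<close> is chosen so as not to vanish.\<close>

lemma phase_root:
  fixes h k \<sigma> :: real
  assumes "\<sigma>\<^sup>2 = 1" "\<sigma> * k > 0"
  defines "D \<equiv> k + \<sigma> * sqrt (h\<^sup>2 + k\<^sup>2)"
  shows "D \<noteq> 0" and "(1 - (h / D)\<^sup>2) * h - 2 * (h / D) * k = 0"
proof -
  have s: "(sqrt (h\<^sup>2 + k\<^sup>2))\<^sup>2 = h\<^sup>2 + k\<^sup>2" by simp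
  have "\<sigma> * D = \<sigma> * k + \<sigma>\<^sup>2 * sqrt (h\<^sup>2 + k\<^sup>2)" by (simp add: D_def power2_eq_square algebra_simps)
  also have "\<dots> > 0" using assms(1,2) by (simp add: add_pos_nonneg)
  finally show D: "D \<noteq> 0" by auto
  have "D\<^sup>2 = k\<^sup>2 + 2 * k * (\<sigma> * sqrt (h\<^sup>2 + k\<^sup>2)) + \<sigma>\<^sup>2 * (sqrt (h\<^sup>2 + k\<^sup>2))\<^sup>2"
    by (simp add: D_def power2_sum power_mult_distrib)
  also have "\<dots> = 2 * k * D + h\<^sup>2" unfolding s assms(1) by (simp add: D_def power2_eq_square algebra_simps)
  finally have D2: "D\<^sup>2 = 2 * k * D + h\<^sup>2" .
  have "D\<^sup>2 * ((1 - (h / D)\<^sup>2) * h - 2 * (h / D) * k) = h * (D\<^sup>2 - h\<^sup>2 - 2 * k * D)"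
    using D by (simp add: field_simps power2_eq_square)
  then have "D\<^sup>2 * ((1 - (h / D)\<^sup>2) * h - 2 * (h / D) * k) = 0" using D2 by simp
  then show "(1 - (h / D)\<^sup>2) * h - 2 * (h / D) * k = 0" using D by simp
qed

lemma in_plane_projection:
  assumes "norm \<phi> = 1" "norm \<psi> = 1"
  shows "in_plane \<phi> (- \<psi>) (x + qleft \<phi> (qright x \<psi>))"
  using assms
  by (simp add: in_plane_minus qleft.add_right qright.add_left qleft_qleft_unit qleft_qright qright_qright_unit qleft.minus_right qright.minus_left)

context lagrangian_chart
begin

lemma lifts_unit: "u \<in> V \<Longrightarrow> q \<in> lifts u \<Longrightarrow> norm q = 1"
  and lifts_normal: "u \<in> V \<Longrightarrow> q \<in> lifts u \<Longrightarrow> in_plane (\<phi> u) (- \<psi> u) q"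
  and lifts_phase: "u \<in> V \<Longrightarrow> q \<in> lifts u \<Longrightarrow> phase u q = 0"
  by (simp_all add: lifts_iff)

text \<open>\<open>t\<close> is the tangent of the rotation angle; the phase form is quadratic in
  the normal vector, so the final normalization only rescales the equation for
  \<open>t\<close>.\<close>

lemma lifts_rotate_gen:
  assumes u: "u \<in> V" and q: "in_plane (\<phi> u) (- \<psi> u) q" "q \<noteq> 0"
    and ph: "(1 - t\<^sup>2) * phase u q
      - 2 * t * conjugate_phase u q = 0"
    and r: "r = q + t *\<^sub>R qleft (\<phi> u) q" "r \<noteq> 0"
  shows "(1 / norm r) *\<^sub>R r \<in> lifts u"
proof -
  have "(1 / norm r) *\<^sub>R r = (1 / norm r) *\<^sub>R q + (t / norm r) *\<^sub>R qleft (\<phi> u) q"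
    by (simp add: r scaleR_add_right)
  then have "phase u ((1 / norm r) *\<^sub>R r) =
     ((1 / norm r)\<^sup>2 - (t / norm r)\<^sup>2) * phase u q
     - 2 * (1 / norm r) * (t / norm r) * conjugate_phase u q"
    using phase_form_rotate[OF unit_\<phi>[OF u] a_tangent[OF u] a_tangent[OF u]] by simp
  also have "\<dots> = (1 / norm r)\<^sup>2 * ((1 - t\<^sup>2) * phase u q
      - 2 * t * conjugate_phase u q)"
    by (simp add: power2_eq_square algebra_simps)
  finally show ?thesis
    unfolding lifts_iff[OF u] using ph r
    by (auto intro!: in_plane_scaleR in_plane_add in_plane_rotate q)
qed

lemma lifts_uminus:
  assumes u: "u \<in> V" and q: "q \<in> lifts u"
  shows "- q \<in> lifts u"
  using q phase_form_rotate[OF unit_\<phi>[OF u] a_tangent[OF u] a_tangent[OF u], of e1 e2 "b e1 u" "b e2 u" "-1" q 0]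
  by (simp add: lifts_iff[OF u] in_plane_uminus)

lemma lifts_rotate:
  assumes u: "u \<in> V" and q: "q \<in> lifts u"
  shows "qleft (\<phi> u) q \<in> lifts u"
proof -
  have "qleft (\<phi> u) q \<bullet> qleft (\<phi> u) q = 1"
    unfolding qleft_inner_qleft using unit_\<phi>[OF u] lifts_unit[OF u q] by (simp add: dot_square_norm)
  then show ?thesis
    using q phase_form_rotate[OF unit_\<phi>[OF u] a_tangent[OF u] a_tangent[OF u], of e1 e2 "b e1 u" "b e2 u" 0 q 1]
    by (simp add: lifts_iff[OF u] in_plane_rotate norm_eq_1)
qed

text \<open>For \<open>q' = c q + d \<phi> q\<close> the rotation formula leaves
  \<open>c * d * conjugate_phase u q = 0\<close>, and the conjugate form is nonzero where the phase
  form vanishes. So \<open>c\<close> or \<open>d\<close> is 0 and the other is 1 or -1.\<close>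

lemma lifts_cases:
  assumes u: "u \<in> V" and q: "q \<in> lifts u" and q': "q' \<in> lifts u"
  shows "q' = q \<or> q' = - q \<or> q' = qleft (\<phi> u) q \<or> q' = - qleft (\<phi> u) q"
proof -
  let ?c = "q' \<bullet> q" and ?d = "q' \<bullet> qleft (\<phi> u) q"
  have e: "q' = ?c *\<^sub>R q + ?d *\<^sub>R qleft (\<phi> u) q"
    using in_plane_expand[OF unit_\<phi>[OF u] lifts_unit[OF u q] lifts_normal[OF u q] lifts_normal[OF u q']] .
  then have "0 = (?c\<^sup>2 - ?d\<^sup>2) * 0 - 2 * ?c * ?d * conjugate_phase u q"
    using phase_form_rotate[OF unit_\<phi>[OF u] a_tangent[OF u] a_tangent[OF u], of e1 e2 "b e1 u" "b e2 u" ?c q ?d]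
      lifts_phase[OF u q] lifts_phase[OF u q'] by metis
  then have cd: "?c = 0 \<or> ?d = 0"
    using phase_forms_nonzero[OF u lifts_unit[OF u q] lifts_normal[OF u q]] lifts_phase[OF u q] by simp
  have "norm (qleft (\<phi> u) q) = 1" using lifts_unit[OF u lifts_rotate[OF u q]] .
  then have "\<bar>?c\<bar> = 1 \<or> \<bar>?d\<bar> = 1"
    using cd arg_cong[OF e, of norm] lifts_unit[OF u q] lifts_unit[OF u q'] by auto
  with cd have "(?c = 1 \<or> ?c = -1) \<and> ?d = 0 \<or> ?c = 0 \<and> (?d = 1 \<or> ?d = -1)" by auto
  then show ?thesis using e by (elim disjE conjE) simp_all
qed

text \<open>Distinct candidates are orthogonal or antipodal unit vectors; 1 serves as the uniform
  gap \<delta>.\<close>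

lemma lifts_separated:
  assumes u: "u \<in> V" and q: "q \<in> lifts u" and q': "q' \<in> lifts u" and "q \<noteq> q'"
  shows "1 \<le> dist q q'"
proof -
  have qq: "q \<bullet> q = 1" "q' \<bullet> q' = 1" using lifts_unit[OF u] q q' by (simp_all add: dot_square_norm)
  have "q' \<bullet> q \<le> 0"
    using lifts_cases[OF u q q'] \<open>q \<noteq> q'\<close> qq qleft_inner_self[of "\<phi> u" q] by auto
  then have "1 \<le> (dist q q')\<^sup>2"
    using qq by (simp add: dist_norm power2_norm_eq_inner inner_diff_left inner_diff_right inner_commute)
  then show ?thesis by (metis one_power2 power2_le_imp_le zero_le_dist)
qed

lemma lifts_nonempty:
  assumes u: "u \<in> V"
  shows "lifts u \<noteq> {}"
proof -
  obtain q where q: "norm q = 1" "in_plane (\<phi> u) (- \<psi> u) q"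
    using in_plane_exists_unit[of "\<phi> u" "- \<psi> u"] unit_\<phi>[OF u] unit_\<psi>[OF u] by auto
  let ?h = "phase u q"
  let ?k = "conjugate_phase u q"
  show ?thesis
  proof (cases "?h = 0")
    case True
    then have "q \<in> lifts u" using q u by (simp add: lifts_iff)
    then show ?thesis by blast
  next
    case False
    \<comment> \<open>A root of \<open>h t^2 + 2 k t - h = 0\<close>, with discriminant the sum of
      squares \<open>k^2 + h^2\<close>.\<close>
    define t where "t = (- ?k + sqrt (?k\<^sup>2 + ?h\<^sup>2)) / ?h"
    have "?h * t + ?k = sqrt (?k\<^sup>2 + ?h\<^sup>2)" using False by (simp add: t_def)
    then have "(?h * t + ?k)\<^sup>2 = ?k\<^sup>2 + ?h\<^sup>2" by simp
    then have "?h * ((1 - t\<^sup>2) * ?h - 2 * t * ?k) = 0"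
      by (simp add: power2_eq_square algebra_simps)
    then have ph: "(1 - t\<^sup>2) * ?h - 2 * t * ?k = 0" using False by (metis mult_eq_0_iff)
    define r where "r = q + t *\<^sub>R qleft (\<phi> u) q"
    have "r \<bullet> q = 1" using q(1) by (simp add: r_def inner_add_left qleft_inner_self dot_square_norm)
    then have "r \<noteq> 0" by auto
    then show ?thesis using lifts_rotate_gen[OF u q(2) _ ph r_def] q(1) by force
  qed
qed

text \<open>\<open>s\<close> projects the fixed vector \<open>q0\<close> to the normal plane at
  \<open>u\<close>, and \<open>h\<close>, \<open>k\<close> measure its phase. Rotating by the angle
  with tangent \<open>h / D\<close>, a half-angle formula, restores the phase condition; \<sigma> is
  the sign of \<open>k\<close> at \<open>u0\<close>, so this is the root that is 0 at
  \<open>u0\<close>. Only differentiable operations occur as long as \<open>k\<close> keeps its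
  sign.\<close>

lemma local_lift:
  assumes u0: "u0 \<in> V" and q0: "q0 \<in> lifts u0"
  obtains W f where "open W" "u0 \<in> W" "W \<subseteq> V" "f u0 = q0"
    "\<And>u. u \<in> W \<Longrightarrow> f differentiable (at u)" "\<And>u. u \<in> W \<Longrightarrow> f u \<in> lifts u"
proof -
  define s where "s u = (1/2) *\<^sub>R (q0 + qleft (\<phi> u) (qright q0 (\<psi> u)))" for u
  define h where "h u = phase u (s u)" for u
  define k where "k u = conjugate_phase u (s u)" for u
  note bil = differentiable_bounded_bilinear[OF bounded_bilinear_qleft] differentiable_bounded_bilinear[OF bounded_bilinear_qright]
    differentiable_bounded_bilinear[OF bounded_bilinear_inner]
  have basic: "\<phi> differentiable (at u)" "\<psi> differentiable (at u)" "a v differentiable (at u)" "b v differentiable (at u)" if "u \<in> V" for u v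
    using has_derivative_\<phi>[OF that] has_derivative_\<psi>[OF that] has_derivative_a[OF that] has_derivative_b[OF that]
    by (auto simp: differentiable_def)
  have ds: "s differentiable (at u)" if "u \<in> V" for u
    unfolding s_def[abs_def] using basic[OF that] by (intro differentiable_scaleR differentiable_add differentiable_const bil)
  have dh: "h differentiable (at u)" if "u \<in> V" for u
    unfolding h_def[abs_def] phase_form_def using basic[OF that] ds[OF that] by (intro differentiable_diff bil)
  have dk: "k differentiable (at u)" if "u \<in> V" for u
    unfolding k_def[abs_def] conjugate_phase_form_def using basic[OF that] ds[OF that] by (intro differentiable_diff bil)
  have s0: "s u0 = q0"
    using lifts_normal[OF u0 q0] unit_\<phi>[OF u0]
    by (simp add: s_def in_plane_minus qleft_qright[symmetric] qleft_qleft_unit minus_equation_iff[of _ "qright q0 _"] qleft.minus_right)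
       (metis (no_types) add.inverse_inverse qleft.minus_right qleft_qleft_unit scaleR_half_double unit_\<phi>[OF u0])
  have s_normal: "in_plane (\<phi> u) (- \<psi> u) (s u)" if "u \<in> V" for u
    unfolding s_def by (intro in_plane_scaleR in_plane_projection unit_\<phi> unit_\<psi> that)
  have h0: "h u0 = 0" using lifts_phase[OF u0 q0] by (simp add: h_def s0)
  have k0: "k u0 \<noteq> 0"
    using phase_forms_nonzero[OF u0 lifts_unit[OF u0 q0] lifts_normal[OF u0 q0]] h0 by (simp add: h_def k_def s0)
  define \<sigma> where "\<sigma> = sgn (k u0)"
  have \<sigma>: "\<sigma>\<^sup>2 = 1" "\<sigma> * k u0 > 0" using k0 by (auto simp: \<sigma>_def sgn_real_def power2_eq_square)
  define D where "D u = k u + \<sigma> * sqrt ((h u)\<^sup>2 + (k u)\<^sup>2)" for u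
  define r where "r u = s u + (h u / D u) *\<^sub>R qleft (\<phi> u) (s u)" for u
  define W0 where "W0 = {u \<in> V. 0 < \<sigma> * k u}"
  have "continuous_on V (\<lambda>u. \<sigma> * k u)"
    by (intro continuous_on_mult continuous_on_const continuous_at_imp_continuous_on ballI differentiable_imp_continuous_within dk)
  then have "open (V \<inter> (\<lambda>u. \<sigma> * k u) -` {0<..})"
    by (rule continuous_open_preimage[OF _ open_V]) simp
  moreover have "W0 = V \<inter> (\<lambda>u. \<sigma> * k u) -` {0<..}" by (auto simp: W0_def)
  ultimately have W0: "open W0" by simp
  have D0: "D u \<noteq> 0" if "u \<in> W0" for u
    using phase_root(1)[OF \<sigma>(1), of "k u" "h u"] that by (simp add: D_def W0_def)
  have dD: "D differentiable (at u)" if "u \<in> W0" for u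
  proof -
    have "k u \<noteq> 0" using that by (auto simp: W0_def)
    then have "(h u)\<^sup>2 + (k u)\<^sup>2 > 0" by (simp add: add_nonneg_pos)
    then show ?thesis
      unfolding D_def[abs_def] using dh[of u] dk[of u] that
      by (intro differentiable_add differentiable_mult differentiable_const differentiable_sqrt differentiable_power) (auto simp: W0_def)
  qed
  have dr: "r differentiable (at u)" if "u \<in> W0" for u
    unfolding r_def[abs_def] using ds[of u] dh[of u] dD[OF that] D0[OF that] basic(1)[of u] that
    by (intro differentiable_add differentiable_scaleR differentiable_divide bil) (auto simp: W0_def)
  define W where "W = {u \<in> W0. r u \<noteq> 0}"
  have "continuous_on W0 r"
    by (intro continuous_at_imp_continuous_on ballI differentiable_imp_continuous_within dr)
  then have "open (W0 \<inter> r -` (- {0}))"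
    by (rule continuous_open_preimage[OF _ W0]) auto
  moreover have "W = W0 \<inter> r -` (- {0})" by (auto simp: W_def)
  ultimately have W: "open W" by simp
  have r0: "r u0 = q0" by (simp add: r_def s0 h0)
  show ?thesis
  proof (rule that[of W "\<lambda>u. (1 / norm (r u)) *\<^sub>R r u"])
    show "open W" by (rule W)
    show "u0 \<in> W" using \<sigma> u0 r0 lifts_unit[OF u0 q0] by (auto simp: W_def W0_def)
    show "W \<subseteq> V" by (auto simp: W_def W0_def)
    show "(1 / norm (r u0)) *\<^sub>R r u0 = q0" using r0 lifts_unit[OF u0 q0] by simp
    show "(\<lambda>u. (1 / norm (r u)) *\<^sub>R r u) differentiable (at u)" if "u \<in> W" for u
    proof -
      have "(\<lambda>u. norm (r u)) differentiable (at u)"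
        using that differentiable_chain_at[OF dr differentiable_norm_at, of u] by (simp add: W_def o_def)
      then show ?thesis using dr[of u] that by (intro differentiable_scaleR differentiable_divide differentiable_const) (auto simp: W_def)
    qed
    show "(1 / norm (r u)) *\<^sub>R r u \<in> lifts u" if "u \<in> W" for u
    proof (rule lifts_rotate_gen)
      show "u \<in> V" using that by (simp add: W_def W0_def)
      then show "in_plane (\<phi> u) (- \<psi> u) (s u)" by (rule s_normal)
      show "s u \<noteq> 0" using that by (auto simp: W_def r_def qleft.zero_right)
      show "(1 - (h u / D u)\<^sup>2) * phase u (s u)
         - 2 * (h u / D u) * conjugate_phase u (s u) = 0"
        using phase_root(2)[OF \<sigma>(1), of "k u" "h u"] that by (simp add: D_def W_def W0_def h_def k_def)
      show "r u = s u + (h u / D u) *\<^sub>R qleft (\<phi> u) (s u)" "r u \<noteq> 0" using that by (simp_all add: r_def W_def)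
    qed
  qed
qed

text \<open>Differentiating \<open>\<phi> q + q \<psi> = 0\<close> gives
  \<open>\<phi> D + D \<psi> = - (a q + q b)\<close>. On the tangent plane both terms on the left
  agree, so the tangential solution \<open>D\<close> is half of
  \<open>\<phi> (a q + q b)\<close>.\<close>

definition "lift_differential u q v = (1/2) *\<^sub>R qleft (\<phi> u) (qleft (a v u) q + qright q (b v u))"

lemma tangent_sum:
  assumes "u \<in> V" "q \<in> lifts u"
  shows "in_plane (\<phi> u) (\<psi> u) (qleft (a v u) q + qright q (b v u))"
  using in_plane_qleft[OF lifts_normal[OF assms] a_tangent[OF assms(1)], of v]
    in_plane_qright[OF lifts_normal[OF assms], of "b v u"] b_tangent[OF assms(1), of v]
  by (simp add: in_plane_add)

lemma lift_differential_tangent: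
  assumes "u \<in> V" "q \<in> lifts u"
  shows "in_plane (\<phi> u) (\<psi> u) (lift_differential u q v)"
  unfolding lift_differential_def by (intro in_plane_scaleR in_plane_rotate tangent_sum assms)

lemma rotate_lift_differential:
  assumes "u \<in> V"
  shows "qleft (\<phi> u) (lift_differential u q v) = - (1/2) *\<^sub>R (qleft (a v u) q + qright q (b v u))"
  unfolding lift_differential_def qleft.scaleR_right qleft_qleft_unit[OF unit_\<phi>[OF assms]]
  by (simp only: scaleR_minus_right scaleR_minus_left)

text \<open>Differentiating the defining equations of the lift leaves a multiple \<open>\<kappa> v\<close> of \<open>\<phi> q\<close> undetermined.  Since
  Clifford multiplication by tangent vectors exchanges the plane with its complement, differentiating the phase
  condition gives \<open>\<kappa> = 0\<close>.\<close>

lemma lift_has_derivative: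
  assumes W: "open W" "W \<subseteq> V" and f: "\<And>u. u \<in> W \<Longrightarrow> f u \<in> lifts u"
    and d: "\<And>u. u \<in> W \<Longrightarrow> f differentiable (at u)" and uW: "u \<in> W"
  shows "(f has_derivative lift_differential u (f u)) (at u)"
proof -
  have u: "u \<in> V" using W uW by blast
  obtain D where D: "(f has_derivative D) (at u)" using d[OF uW] unfolding differentiable_def by blast
  define q where "q = f u"
  have q: "q \<in> lifts u" using f[OF uW] by (simp add: q_def)
  note N = lifts_normal[OF u q] and U = unit_\<phi>[OF u] unit_\<psi>[OF u] lifts_unit[OF u q]
  have ff: "f x \<bullet> f x = 1" if "x \<in> W" for x
    using lifts_unit[of x "f x"] f[OF that] W that by (auto simp: dot_square_norm)
  have "f u \<bullet> D v + D v \<bullet> f u = 0" for v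
    by (rule has_derivative_constant_on_open[OF W(1) uW ff has_derivative_inner[OF D D]])
  then have Dq: "D v \<bullet> q = 0" for v by (simp add: q_def inner_commute)
  have nf: "qleft (\<phi> x) (f x) + qright (f x) (\<psi> x) = 0" if "x \<in> W" for x
    using lifts_normal[of x "f x"] f[OF that] W that by (auto simp: in_plane_minus)
  have "qleft (\<phi> u) (D v) + qleft (a v u) (f u) + (qright (f u) (b v u) + qright (D v) (\<psi> u)) = 0" for v
    by (rule has_derivative_constant_on_open[OF W(1) uW nf has_derivative_add[OF
      bounded_bilinear.FDERIV[OF bounded_bilinear_qleft has_derivative_\<phi>[OF u] D]
      bounded_bilinear.FDERIV[OF bounded_bilinear_qright D has_derivative_\<psi>[OF u]]]])
  then have eq: "qleft (\<phi> u) (D v) + qright (D v) (\<psi> u) = - (qleft (a v u) q + qright q (b v u))" for v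
    by (simp add: q_def algebra_simps eq_neg_iff_add_eq_0)
  define E where "E = lift_differential u q"
  have ET: "in_plane (\<phi> u) (\<psi> u) (E v)" for v unfolding E_def by (rule lift_differential_tangent[OF u q])
  have Eeq: "qleft (\<phi> u) (E v) + qright (E v) (\<psi> u) = - (qleft (a v u) q + qright q (b v u))" for v
  proof -
    have 1: "qleft (\<phi> u) (E v) = - (1/2) *\<^sub>R (qleft (a v u) q + qright q (b v u))"
      unfolding E_def by (rule rotate_lift_differential[OF u])
    then have 2: "qright (E v) (\<psi> u) = - (1/2) *\<^sub>R (qleft (a v u) q + qright q (b v u))"
      using ET[of v] by (simp add: in_plane_def)
    show ?thesis unfolding 1 2 scaleR_left_distrib[symmetric] by simp
  qed
  define \<kappa> where "\<kappa> v = D v \<bullet> qleft (\<phi> u) q" for v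
  have DE: "D v = E v + \<kappa> v *\<^sub>R qleft (\<phi> u) q" for v
  proof -
    \<comment> \<open>Both solve the same inhomogeneous equation, so the difference is normal; being
      orthogonal to \<open>q\<close> as well, it is a multiple of \<open>\<phi> q\<close>.\<close>
    have "in_plane (\<phi> u) (- \<psi> u) (D v - E v)"
    proof -
      have *: "x + y = z + t \<Longrightarrow> x - z = - (y - t)" for x y z t :: "real^4" by (simp add: algebra_simps)
      show ?thesis
        unfolding in_plane_minus qleft.diff_right qright.diff_left
        by (rule *) (simp only: eq Eeq)
    qed
    from in_plane_expand[OF U(1,3) N this]
    have "D v - E v = ((D v - E v) \<bullet> q) *\<^sub>R q + ((D v - E v) \<bullet> qleft (\<phi> u) q) *\<^sub>R qleft (\<phi> u) q" .
    moreover have "E v \<bullet> q = 0" "E v \<bullet> qleft (\<phi> u) q = 0"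
      using in_plane_orthogonal[OF U(1,2) ET] N in_plane_rotate[OF N] by blast+
    ultimately show ?thesis by (simp add: inner_diff_left Dq \<kappa>_def algebra_simps)
  qed
  let ?k = "conjugate_phase u q"
  have mixed: "qleft x q \<bullet> qright (D v) y + qleft x (D v) \<bullet> qright q y
      = - 2 * \<kappa> v * (qleft (\<phi> u) (qleft x q) \<bullet> qright q y)"
    if x: "x \<bullet> \<phi> u = 0" and y: "y \<bullet> \<psi> u = 0" for x y v
  proof -
    have xq: "in_plane (\<phi> u) (\<psi> u) (qleft x q)" and qy: "in_plane (\<phi> u) (\<psi> u) (qright q y)"
      using in_plane_qleft[OF N x] in_plane_qright[OF N, of y] y by simp_all
    have "qleft x q \<bullet> qright (E v) y = 0"
      using in_plane_orthogonal[OF U(1,2) xq in_plane_qright[OF ET y]] .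
    moreover have "qleft x (E v) \<bullet> qright q y = 0"
      using in_plane_orthogonal[OF U(1,2) qy in_plane_qleft[OF ET x]] by (simp add: inner_commute)
    moreover have "qleft x q \<bullet> qright (qleft (\<phi> u) q) y = - (qleft (\<phi> u) (qleft x q) \<bullet> qright q y)"
      by (simp add: qleft_qright[symmetric] qleft_inner)
    moreover have "qleft x (qleft (\<phi> u) q) \<bullet> qright q y = - (qleft (\<phi> u) (qleft x q) \<bullet> qright q y)"
      using qleft_anticommute[OF x, of q] by simp
    ultimately show ?thesis
      by (simp add: DE qleft.add_right qright.add_left qleft.scaleR_right qright.scaleR_left inner_add_left inner_add_right)
  qed
  have ph: "qleft (a e1 x) (f x) \<bullet> qright (f x) (b e2 x) - qleft (a e2 x) (f x) \<bullet> qright (f x) (b e1 x) = 0" if "x \<in> W" for x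
    using lifts_phase[of x "f x"] f[OF that] W that by (auto simp: phase_form_def)
  have "qleft (a e1 u) (f u) \<bullet> (qright (f u) (bb e2 v u) + qright (D v) (b e2 u))
      + (qleft (a e1 u) (D v) + qleft (aa e1 v u) (f u)) \<bullet> qright (f u) (b e2 u)
      - (qleft (a e2 u) (f u) \<bullet> (qright (f u) (bb e1 v u) + qright (D v) (b e1 u))
      + (qleft (a e2 u) (D v) + qleft (aa e2 v u) (f u)) \<bullet> qright (f u) (b e1 u)) = 0" for v
    by (rule has_derivative_constant_on_open[OF W(1) uW ph has_derivative_diff[OF
      has_derivative_inner[OF
        bounded_bilinear.FDERIV[OF bounded_bilinear_qleft has_derivative_a[OF u] D]
        bounded_bilinear.FDERIV[OF bounded_bilinear_qright D has_derivative_b[OF u]]]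
      has_derivative_inner[OF
        bounded_bilinear.FDERIV[OF bounded_bilinear_qleft has_derivative_a[OF u] D]
        bounded_bilinear.FDERIV[OF bounded_bilinear_qright D has_derivative_b[OF u]]]]])
  then have dph: "(qleft (a e1 u) q \<bullet> qright (D v) (b e2 u) + qleft (a e1 u) (D v) \<bullet> qright q (b e2 u))
      - (qleft (a e2 u) q \<bullet> qright (D v) (b e1 u) + qleft (a e2 u) (D v) \<bullet> qright q (b e1 u))
      + (qleft (aa e1 v u) q \<bullet> qright q (b e2 u) + qleft (a e1 u) q \<bullet> qright q (bb e2 v u)
     - qleft (aa e2 v u) q \<bullet> qright q (b e1 u) - qleft (a e2 u) q \<bullet> qright q (bb e1 v u)) = 0" for v
    unfolding q_def by (simp add: inner_add_left inner_add_right algebra_simps)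
  obtain w where w: "normal_frame (\<phi> u) (\<psi> u) q w" using lifts_normal_frame[OF u q] .
  have "- 2 * \<kappa> v * ?k = 0" if v: "v = e1 \<or> v = e2" for v
    using dph[of v] unfolding frame_phase_derivative[OF u w q v] mixed[OF a_tangent[OF u] b_tangent[OF u]]
    by (simp add: conjugate_phase_form_def algebra_simps)
  moreover have "?k \<noteq> 0" using phase_forms_nonzero[OF u U(3) N] lifts_phase[OF u q] by simp
  ultimately have \<kappa>0: "\<kappa> e1 = 0" "\<kappa> e2 = 0" by auto
  have lD: "linear D" by (rule has_derivative_linear[OF D])
  have "\<kappa> v = v$1 * \<kappa> e1 + v$2 * \<kappa> e2" for v
    unfolding \<kappa>_def by (subst vec2_expand[of v]) (simp only: linear_add[OF lD] linear_scale[OF lD] inner_add_left inner_scaleR_left)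
  then have "D = E" using DE \<kappa>0 by (simp add: fun_eq_iff)
  with D show ?thesis by (simp add: E_def q_def)
qed

text \<open>Bootstrapping: the derivative of \<open>f\<close> is a polynomial in the smooth data and
  \<open>f\<close> itself, so each order of differentiability yields the next.\<close>

lemma lift_smooth:
  assumes W: "open W" "W \<subseteq> V" and f: "\<And>u. u \<in> W \<Longrightarrow> f u \<in> lifts u"
    and d: "\<And>u. u \<in> W \<Longrightarrow> f differentiable (at u)"
  shows "smooth_on W f"
proof -
  have sm: "smooth_on W X" by (rule smooth_on_subset[OF smooth W(2)])
  have basic: "Ck_on k \<phi> W" "Ck_on k (a v) W" "Ck_on k (b v) W" for k v
    unfolding \<phi>_def[abs_def] a_def[abs_def] b_def[abs_def]
    using sm smooth_on_frechet_derivative[OF sm] W(1)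
    by (auto simp: smooth_on_def intro!: Ck_on_bounded_linear[OF bounded_linear_fst] Ck_on_bounded_linear[OF bounded_linear_snd])
  have "Ck_on k f W" for k
  proof (induction k)
    case 0
    then show ?case using d by (auto intro!: continuous_at_imp_continuous_on differentiable_imp_continuous_within)
  next
    case (Suc k)
    show ?case
      by (rule Ck_on_SucI[OF W(1) lift_has_derivative[OF W f d]], assumption+)
        (unfold lift_differential_def, intro Ck_on_bounded_linear[OF bounded_linear_scaleR_right] Ck_on_bilinear[OF bounded_bilinear_qleft]
          Ck_on_bilinear[OF bounded_bilinear_qright] Ck_on_add W(1) basic Suc)
  qed
  then show ?thesis by (simp add: smooth_on_def)
qed

lemma lift_differential_inj:
  assumes u: "u \<in> V" and q: "q \<in> lifts u"
  shows "linear (lift_differential u q)" and "inj (lift_differential u q)"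
proof -
  show lin: "linear (lift_differential u q)"
  proof (rule linearI)
    show "lift_differential u q (v + v') = lift_differential u q v + lift_differential u q v'" for v v'
      unfolding lift_differential_def linear_add[OF linear_a[OF u]] linear_add[OF linear_b[OF u]]
      by (simp add: qleft.add_left qright.add_right qleft.add_right scaleR_add_right)
    show "lift_differential u q (c *\<^sub>R v) = c *\<^sub>R lift_differential u q v" for c v
      unfolding lift_differential_def linear_scale[OF linear_a[OF u]] linear_scale[OF linear_b[OF u]]
      by (simp add: qleft.scaleR_left qright.scaleR_right qleft.add_right qleft.scaleR_right scaleR_add_right)
  qed
  have "v = 0" if "lift_differential u q v = 0" for v
  proof (rule ccontr)
    assume "v \<noteq> 0"
    then have "qleft (a v u) q + qright q (b v u) \<noteq> 0" by (rule sum_nonzero[OF u q])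
    then show False using rotate_lift_differential[OF u, of q v] that by (simp add: qleft.zero_right)
  qed
  then show "inj (lift_differential u q)" using linear_injective_0[OF lin] by blast
qed

end

subsection \<open>Minimality of the lift\<close>

context normal_frame
begin

text \<open>\<open>x\<close> and \<open>y\<close> are the projections of \<open>n\<close> to the
  plane and to its complement; \<zeta> sees only \<open>x\<close> and is faithful there.\<close>

lemma normal_of_\<zeta>_eq_0:
  assumes "\<zeta> n = 0"
  shows "in_plane \<phi> (- \<psi>) n"
proof -
  define x where "x = (1/2) *\<^sub>R (n + qleft \<phi> (qright n (- \<psi>)))"
  define y where "y = (1/2) *\<^sub>R (n + qleft \<phi> (qright n \<psi>))"
  have n: "n = x + y"
    by (simp add: x_def y_def scaleR_add_right[symmetric] qleft.minus_right qright.minus_right scaleR_2[symmetric])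
  have "in_plane \<phi> (- (- \<psi>)) x"
    unfolding x_def by (intro in_plane_scaleR in_plane_projection) (simp_all add: unit)
  then have x: "in_plane \<phi> \<psi> x" by simp
  have y: "in_plane \<phi> (- \<psi>) y"
    unfolding y_def by (intro in_plane_scaleR in_plane_projection) (simp_all add: unit)
  have "\<zeta> x = 0" using assms n \<zeta>_normal[OF y] by (simp add: \<zeta>_add)
  then have "x \<bullet> x = 0" using inner_eq_\<zeta>[OF x] by simp
  with n y show ?thesis by simp
qed

end

context lagrangian_chart
begin

lemma lift_frechet_derivative:
  assumes W: "open W" "W \<subseteq> V" and f: "\<And>u. u \<in> W \<Longrightarrow> f u \<in> lifts u"
    and d: "\<And>u. u \<in> W \<Longrightarrow> f differentiable (at u)" and uW: "u \<in> W"
  shows "frechet_derivative f (at u) = lift_differential u (f u)"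
  using frechet_derivative_at[OF lift_has_derivative[OF assms]] by simp

text \<open>A signed area of the lift, measured with the rotation \<phi> of its tangent plane. Its
  sign later decides whether a chart has to be reflected.\<close>

lemma lift_orientation_nonzero:
  assumes u: "u \<in> V" and q: "q \<in> lifts u"
  shows "qleft (\<phi> u) (lift_differential u q e1) \<bullet> lift_differential u q e2 \<noteq> 0"
proof -
  obtain w where w: "normal_frame (\<phi> u) (\<psi> u) q w" using lifts_normal_frame[OF u q] .
  interpret nf: normal_frame "\<phi> u" "\<psi> u" q w by (rule w)
  have \<zeta>: "nf.\<zeta> (lift_differential u q v) = 1/2 * (\<i> * (\<alpha> w q u v + \<beta> w q u v))" for v
    unfolding lift_differential_def by (simp add: nf.\<zeta>_scaleR nf.\<zeta>_rotate frame_\<zeta>_sum[OF u w])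
  have "qleft (\<phi> u) (lift_differential u q e1) \<bullet> lift_differential u q e2 =
     1/4 * Im (cnj (\<alpha> w q u e1 + \<beta> w q u e1) * (\<alpha> w q u e2 + \<beta> w q u e2))"
    unfolding nf.inner_eq_\<zeta>[OF lift_differential_tangent[OF u q]] nf.\<zeta>_rotate \<zeta> by (simp add: field_simps)
  then show ?thesis using frame_sum_independent[OF u w q] by simp
qed

text \<open>The unit normal is \<open>\<phi> f\<close>, and differentiating its orthogonality to the
  derivative of \<open>f\<close> expresses the second fundamental form as
  \<open>- (1/4) * Im (cnj e * (\<alpha> - \<beta>))\<close>. The phase condition makes
  \<open>\<alpha> - \<beta>\<close> equal to \<open>\<mu> * cnj e\<close>, and the form becomes
  trace-free.\<close>

lemma lift_minimal:
  assumes W: "open W" "W \<subseteq> V" and f: "\<And>u. u \<in> W \<Longrightarrow> f u \<in> lifts u"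
    and d: "\<And>u. u \<in> W \<Longrightarrow> f differentiable (at u)" and uW: "u \<in> W"
  shows "mean_curvature_vector tangent_S3 f u = 0"
proof -
  have u: "u \<in> V" using W uW by blast
  define q where "q = f u"
  have q: "q \<in> lifts u" using f[OF uW] by (simp add: q_def)
  obtain w where w: "normal_frame (\<phi> u) (\<psi> u) q w" using lifts_normal_frame[OF u q] .
  interpret nf: normal_frame "\<phi> u" "\<psi> u" q w by (rule w)
  have fd: "frechet_derivative f (at x) = lift_differential x (f x)" if "x \<in> W" for x
    using W f d that by (rule lift_frechet_derivative)
  have sm: "smooth_on W f" using W f d by (rule lift_smooth)
  define E where "E = lift_differential u q"
  have fdu: "frechet_derivative f (at u) = E" by (simp add: E_def q_def fd[OF uW])
  have linE: "linear E" and injE: "inj E" unfolding E_def by (rule lift_differential_inj[OF u q])+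
  have ET: "in_plane (\<phi> u) (\<psi> u) (E v)" for v unfolding E_def by (rule lift_differential_tangent[OF u q])
  define N where "N = qleft (\<phi> u) q"
  have N: "in_plane (\<phi> u) (- \<psi> u) N" "N \<bullet> q = 0" "norm N = 1"
    using in_plane_rotate[OF nf.normal] qleft_inner_self lifts_unit[OF u lifts_rotate[OF u q]] by (simp_all add: N_def)
  let ?M = "{n \<in> tangent_S3 (f u). \<forall>z. n \<bullet> frechet_derivative f (at u) z = 0}"
  have M: "subspace ?M"
    by (auto simp: subspace_def tangent_S3_def inner_add_left inner_add_right)
  have EN: "E z \<bullet> N = 0" for z using in_plane_orthogonal[OF nf.unit(1,2) ET N(1)] .
  then have NM: "N \<in> ?M" using N(2) by (simp add: tangent_S3_def fdu q_def inner_commute)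
  define e where "e v = \<alpha> w q u v + \<beta> w q u v" for v
  have ind: "Im (cnj (e e1) * e e2) \<noteq> 0" unfolding e_def by (rule frame_sum_independent[OF u w q])
  have \<zeta>E: "nf.\<zeta> (E v) = 1/2 * (\<i> * e v)" for v
    unfolding E_def lift_differential_def e_def by (simp add: nf.\<zeta>_scaleR nf.\<zeta>_rotate frame_\<zeta>_sum[OF u w])
  have M_span: "n = (n \<bullet> N) *\<^sub>R N" if n: "n \<in> ?M" for n
  proof -
    have "n \<bullet> E z = 0" for z using n by (simp add: fdu)
    then have "Re (cnj (nf.\<zeta> n) * nf.\<zeta> (E z)) = 0" for z using nf.inner_eq_\<zeta>[OF ET] by metis
    then have "Im (nf.\<zeta> n * cnj (e z)) = 0" for z
      unfolding \<zeta>E by (simp add: algebra_simps)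
    then have "nf.\<zeta> n = 0" using complex_eq_0_of_two_Im[OF ind] by blast
    from in_plane_expand[OF nf.unit(1,3) nf.normal nf.normal_of_\<zeta>_eq_0[OF this]]
    have "n = (n \<bullet> q) *\<^sub>R q + (n \<bullet> N) *\<^sub>R N" by (simp add: N_def)
    moreover have "n \<bullet> q = 0" using n by (simp add: tangent_S3_def q_def inner_commute)
    ultimately show ?thesis by simp
  qed
  have "e e1 \<noteq> 0" using ind by (metis complex_cnj_zero mult_zero_left zero_complex.simps(2))
  moreover have "Re (cnj (\<alpha> w q u e1) * \<beta> w q u e2) = Re (cnj (\<alpha> w q u e2) * \<beta> w q u e1)"
    using lifts_phase[OF u q] frame_phase_form[OF u w, of e1 e2] by simp
  ultimately obtain \<mu> where \<mu>: "\<alpha> w q u e1 - \<beta> w q u e1 = \<mu> * cnj (e e1)" "\<alpha> w q u e2 - \<beta> w q u e2 = \<mu> * cnj (e e2)"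
    using conjugate_multiple[OF frame_lagrangian[OF u w]] unfolding e_def by metis
  have XXN: "frechet_derivative (\<lambda>y. frechet_derivative f (at y) v) (at u) v' \<bullet> N =
      - (1/4) * Im (cnj (e v) * (\<alpha> w q u v' - \<beta> w q u v'))" for v v'
  proof -
    have fN: "frechet_derivative f (at y) v \<bullet> qleft (\<phi> y) (f y) = 0" if "y \<in> W" for y
    proof -
      have y: "y \<in> V" using that W by blast
      show ?thesis
        unfolding fd[OF that]
        using in_plane_orthogonal[OF unit_\<phi>[OF y] unit_\<psi>[OF y] lift_differential_tangent[OF y f[OF that]]
          in_plane_rotate[OF lifts_normal[OF y f[OF that]]]] .
    qed
    have h1: "E v \<bullet> (qleft (\<phi> u) (E v') + qleft (a v' u) q)
        + frechet_derivative (\<lambda>y. frechet_derivative f (at y) v) (at u) v' \<bullet> N = 0"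
      using has_derivative_constant_on_open[OF W(1) uW fN has_derivative_inner[OF
        smooth_on_has_derivative[OF smooth_on_frechet_derivative[OF sm] uW]
        bounded_bilinear.FDERIV[OF bounded_bilinear_qleft has_derivative_\<phi>[OF u] smooth_on_has_derivative[OF sm uW]]], of v']
      by (simp add: fdu N_def q_def)
    \<comment> \<open>The derivative of the unit normal: \<open>\<phi> E\<close> is minus half of
      \<open>a q + q b\<close>, and adding \<open>a q\<close> leaves half the difference.\<close>
    have h2: "qleft (\<phi> u) (E v') + qleft (a v' u) q = (1/2) *\<^sub>R (qleft (a v' u) q - qright q (b v' u))"
      unfolding E_def rotate_lift_differential[OF u]
      by (simp add: vec_eq_iff field_simps)
    have h3: "E v \<bullet> (1/2) *\<^sub>R (qleft (a v' u) q - qright q (b v' u)) = 1/4 * Im (cnj (e v) * (\<alpha> w q u v' - \<beta> w q u v'))"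
    proof -
      have "in_plane (\<phi> u) (\<psi> u) (qleft (a v' u) q - qright q (b v' u))"
        by (intro in_plane_diff nf.plane_qleft nf.plane_qright a_tangent b_tangent u)
      moreover have "nf.\<zeta> (qleft (a v' u) q - qright q (b v' u)) = \<alpha> w q u v' - \<beta> w q u v'"
        by (simp add: nf.\<zeta>_diff \<alpha>_def \<beta>_def)
      ultimately have "E v \<bullet> (qleft (a v' u) q - qright q (b v' u)) =
          Re (cnj (1/2 * (\<i> * e v)) * (\<alpha> w q u v' - \<beta> w q u v'))"
        using nf.inner_eq_\<zeta>[of "qleft (a v' u) q - qright q (b v' u)" "E v"] unfolding \<zeta>E by metis
      also have "Re (cnj (1/2 * (\<i> * x)) * y) = 1/2 * Im (cnj x * y)" for x y by (simp add: field_simps)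
      finally show ?thesis by simp
    qed
    show ?thesis using h1 unfolding h2 h3 by linarith
  qed
  have EE: "E v \<bullet> E v' = 1/4 * Re (cnj (e v) * e v')" for v v'
    unfolding nf.inner_eq_\<zeta>[OF ET] \<zeta>E by (simp add: field_simps)
  define K where "K = 2 * ((E e1 \<bullet> E e1) * (E e2 \<bullet> E e2) - (E e1 \<bullet> E e2)\<^sup>2) * (mean_curvature_vector tangent_S3 f u \<bullet> N)"
  note K = mean_curvature_vector_inner(2)[where X=f and u=u and TN=tangent_S3 and n=N, unfolded fdu, OF linE injE M[unfolded fdu] NM[unfolded fdu],
      folded K_def]
  have "K = - (1/16) * (Re (cnj (e e2) * e e2) * Im (\<mu> * cnj (e e1) * cnj (e e1)) - 2 * Re (cnj (e e1) * e e2) * Im (\<mu> * cnj (e e1) * cnj (e e2))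
    + Re (cnj (e e1) * e e1) * Im (\<mu> * cnj (e e2) * cnj (e e2)))"
    unfolding K XXN \<mu> EE by (simp add: algebra_simps)
  also have "\<dots> = 0" unfolding trace_free_of_conjugate_multiple by simp
  finally have H0: "mean_curvature_vector tangent_S3 f u \<bullet> N = 0"
    using gram_det_neq_0[OF linE injE] by (simp add: K_def)
  have HM: "mean_curvature_vector tangent_S3 f u \<in> ?M"
    using mean_curvature_vector_inner(1)[where X=f and u=u and TN=tangent_S3, unfolded fdu, OF linE injE M[unfolded fdu]] by (simp add: fdu)
  show ?thesis by (subst M_span[OF HM]) (simp only: H0 scaleR_zero_left)
qed

end

subsection \<open>The Gauss map of an oriented plane\<close>

lemma rotation_matrix_rows:
  "rotation_matrix (vector [v1, v2, v3, v4] :: real^4^4) \<longleftrightarrow>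
    norm v1 = 1 \<and> norm v2 = 1 \<and> norm v3 = 1 \<and> norm v4 = 1 \<and>
    v1 \<bullet> v2 = 0 \<and> v1 \<bullet> v3 = 0 \<and> v1 \<bullet> v4 = 0 \<and> v2 \<bullet> v3 = 0 \<and> v2 \<bullet> v4 = 0 \<and> v3 \<bullet> v4 = 0 \<and>
    det (vector [v1, v2, v3, v4] :: real^4^4) = 1"
proof -
  have "row i A = A $ i" for i and A :: "real^4^4" by (simp add: row_def vec_eq_iff)
  then show ?thesis
    unfolding rotation_matrix_def orthogonal_matrix_orthonormal_rows
    by (simp add: forall_4 orthogonal_def) (auto simp: inner_commute)
qed

lemma det_row_4_uminus:
  "det (vector [v1, v2, v3, - v4] :: real^4^4) = - det (vector [v1, v2, v3, v4] :: real^4^4)"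
  by (simp add: det_4 algebra_simps)

lemma in_plane_rotate_eq:
  assumes "norm \<phi> = 1" "in_plane \<phi> \<psi> v" "in_plane \<phi> \<psi> v'" "norm v = 1" "norm v' = 1" "v \<bullet> v' = 0"
  shows "v' = qleft \<phi> v \<or> v' = - qleft \<phi> v"
proof -
  have e: "v' = (v' \<bullet> qleft \<phi> v) *\<^sub>R qleft \<phi> v"
    using in_plane_expand[OF assms(1,4,2,3)] assms(6) by (simp add: inner_commute)
  have "qleft \<phi> v \<bullet> qleft \<phi> v = 1" unfolding qleft_inner_qleft using assms by (simp add: dot_square_norm)
  then have "norm (qleft \<phi> v) = 1" by (simp add: norm_eq_1)
  then have "\<bar>v' \<bullet> qleft \<phi> v\<bar> = 1" using arg_cong[OF e, of norm] assms(5) by simp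
  then have "v' \<bullet> qleft \<phi> v = 1 \<or> v' \<bullet> qleft \<phi> v = -1" by linarith
  then show ?thesis by (metis e scaleR_minus1_left scaleR_one)
qed

text \<open>Positivity forces \<open>v2 = \<phi> v1\<close> and the determinant forces
  \<open>v4 = \<phi> v3\<close>, so both self-dual halves contribute \<phi>. On the complement
  \<open>v4 = - v3 \<psi>\<close>, so the difference of the anti-self-dual halves adds up to
  \<psi>.\<close>

lemma plane_to_spheres_eq:
  assumes U: "norm \<phi> = 1" "norm \<psi> = 1" and P: "in_plane \<phi> \<psi> v1" "in_plane \<phi> \<psi> v2"
    and pos: "qleft \<phi> v1 \<bullet> v2 > 0" and R: "rotation_matrix (vector [v1, v2, v3, v4] :: real^4^4)"
  shows "plane_to_spheres v1 v2 v3 v4 = (\<phi>, \<psi>)"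
proof -
  have on: "norm v1 = 1" "norm v2 = 1" "norm v3 = 1" "norm v4 = 1" "v1 \<bullet> v2 = 0" "v1 \<bullet> v3 = 0" "v1 \<bullet> v4 = 0"
      "v2 \<bullet> v3 = 0" "v2 \<bullet> v4 = 0" "v3 \<bullet> v4 = 0" and det: "det (vector [v1, v2, v3, v4] :: real^4^4) = 1"
    using R unfolding rotation_matrix_rows by blast+
  have "v2 \<noteq> - qleft \<phi> v1"
    using pos inner_ge_zero[of "qleft \<phi> v1"] by (metis inner_minus_right neg_0_less_iff_less not_less)
  then have v2: "v2 = qleft \<phi> v1" using in_plane_rotate_eq[OF U(1) P on(1,2,5)] by blast
  obtain q where "norm q = 1" "in_plane \<phi> (- \<psi>) q" using in_plane_exists_unit[of \<phi> "- \<psi>"] U by auto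
  then interpret nf: normal_frame \<phi> \<psi> q v1 using U on(1) P(1) by unfold_locales
  have N: "in_plane \<phi> (- \<psi>) v3" "in_plane \<phi> (- \<psi>) v4"
    using on(6-9) by (auto intro!: nf.normal_of_\<zeta>_eq_0 simp: nf.\<zeta>_def complex_eq_iff v2 inner_commute)
  have sq: "v1 \<bullet> v1 = 1" "v3 \<bullet> v3 = 1" "\<phi> \<bullet> \<phi> = 1" using on U by (simp_all add: dot_square_norm)
  have d: "det (vector [v1, v2, v3, qleft \<phi> v3] :: real^4^4) = 1"
    using det_qleft[of v1 \<phi> v3] on(6,8) by (simp add: v2 sq)
  then have v4: "v4 = qleft \<phi> v3"
    using in_plane_rotate_eq[OF U(1) N on(3,4,10)] det det_row_4_uminus[of v1 v2 v3 "qleft \<phi> v3"] by auto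
  have ax: "axis k 1 \<bullet> c = c $ k" for k and c :: "real^3" by (simp add: inner_axis')
  have 1: "qleft (axis k 1) v1 \<bullet> v2 = \<phi> $ k" "qleft (axis k 1) v3 \<bullet> v4 = \<phi> $ k" for k
    unfolding v2 v4 qleft_inner_qleft by (simp_all add: sq ax)
  have "v2 = qright v1 \<psi>" "v4 = - qright v3 \<psi>"
    using P(1) N(1) by (simp_all add: v2 v4 in_plane_def qright.minus_right)
  then have 2: "qright v1 (axis k 1) \<bullet> v2 = \<psi> $ k" "qright v3 (axis k 1) \<bullet> v4 = - \<psi> $ k" for k
    by (simp_all add: qright_inner_qright sq ax)
  have lin: "dual_coords s (c *\<^sub>R (x + y)) = c *\<^sub>R (dual_coords s x + dual_coords s y)"
       "dual_coords s (c *\<^sub>R (x - y)) = c *\<^sub>R (dual_coords s x - dual_coords s y)" for s c x y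
    by (simp_all add: linear_scale[OF linear_dual_coords] linear_add[OF linear_dual_coords] linear_diff[OF linear_dual_coords])
  have half: "(1 / sqrt 2) * (c / sqrt 2 + c / sqrt 2) = c" for c :: real
    by (simp add: field_simps)
  show ?thesis
    unfolding plane_to_spheres_def lin dual_coords_wedge_1 dual_coords_wedge_m1 1 2
    using half by (simp add: vec_eq_iff)
qed

text \<open>Supplies a frame meeting the premise in \<open>gauss_map\<close>; with none, the
  description there would hold of every \<open>q\<close> and determine nothing.\<close>

lemma rotation_matrix_of_normal:
  assumes U: "norm \<phi> = 1" "norm \<psi> = 1" and v: "in_plane \<phi> \<psi> v" "norm v = 1" and q: "in_plane \<phi> (- \<psi>) q" "norm q = 1"
  shows "rotation_matrix (vector [v, qleft \<phi> v, q, qleft \<phi> q] :: real^4^4)"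
proof -
  have sq: "v \<bullet> v = 1" "q \<bullet> q = 1" "\<phi> \<bullet> \<phi> = 1" using assms by (simp_all add: dot_square_norm)
  have o: "v \<bullet> q = 0" "v \<bullet> qleft \<phi> q = 0" "qleft \<phi> v \<bullet> q = 0" "qleft \<phi> v \<bullet> qleft \<phi> q = 0"
    using in_plane_orthogonal[OF U] v(1) q(1) in_plane_rotate by blast+
  have "v \<bullet> qleft \<phi> v = 0" "q \<bullet> qleft \<phi> q = 0" using qleft_inner_self by (metis inner_commute)+
  then show ?thesis
    unfolding rotation_matrix_rows using assms o
    by (simp add: det_qleft sq norm_eq_1 qleft_inner_qleft)
qed

subsection \<open>Charts and tangent planes\<close>

lemma chart_homeomorphism:
  assumes "smooth_surface S A" "(V, x) \<in> A"
  shows "open V" "openin (top_of_set S) (x ` V)" "homeomorphism V (x ` V) x (inv_into V x)" "x ` V \<subseteq> S"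
    "continuous_on V x" "inj_on x V"
proof -
  show 1: "open V" and 2: "openin (top_of_set S) (x ` V)" and 3: "homeomorphism V (x ` V) x (inv_into V x)"
    using assms unfolding smooth_surface_def by blast+
  show "x ` V \<subseteq> S" using 2 openin_imp_subset by blast
  show "continuous_on V x" using 3 by (rule homeomorphism_cont1)
  show "inj_on x V" using 3 by (metis homeomorphism_apply1 inj_on_inverseI)
qed

lemma chart_image_open:
  assumes "smooth_surface S A" "(V, x) \<in> A" "open W" "W \<subseteq> V"
  shows "openin (top_of_set S) (x ` W)"
proof -
  note c = chart_homeomorphism[OF assms(1,2)]
  have "openin (top_of_set V) W" using assms(3,4) c(1) openin_open_eq by blast
  then have "openin (top_of_set (x ` V)) (x ` W)" using homeomorphism_imp_open_map[OF c(3)] by blast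
  then show ?thesis using c(2) openin_trans by blast
qed

lemma chart_preimage_open:
  assumes "smooth_surface S A" "(V, x) \<in> A" "openin (top_of_set S) T"
  shows "open (V \<inter> x -` T)"
proof -
  note c = chart_homeomorphism[OF assms(1,2)]
  have "openin (top_of_set V) (V \<inter> x -` T)"
    using c(4) by (intro continuous_openin_preimage[OF c(5) _ assms(3)]) blast
  then show ?thesis using c(1) openin_open_eq by blast
qed

lemma transition:
  assumes S: "smooth_surface S A" and x: "(V, x) \<in> A" and y: "(W, y) \<in> A"
    and u: "u \<in> V" "x u \<in> y ` W"
  defines "\<tau> \<equiv> inv_into W y \<circ> x"
  shows "\<tau> u \<in> W" and "y (\<tau> u) = x u"
    and "(\<tau> has_derivative frechet_derivative \<tau> (at u)) (at u)"
    and "\<And>f :: 'a::{t2_space,second_countable_topology} \<Rightarrow> 'e::euclidean_space. smooth_on W (f \<circ> y) \<Longrightarrow>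
      frechet_derivative (f \<circ> x) (at u) = frechet_derivative (f \<circ> y) (at (\<tau> u)) \<circ> frechet_derivative \<tau> (at u)"
proof -
  let ?O = "V \<inter> x -` (y ` W)"
  have O: "open ?O" using chart_preimage_open[OF S x] chart_homeomorphism(2)[OF S y] .
  have uO: "u \<in> ?O" using u by blast
  have \<tau>: "\<tau> v \<in> W" "y (\<tau> v) = x v" if "v \<in> ?O" for v
    using that by (auto simp: \<tau>_def inv_into_into f_inv_into_f)
  show "\<tau> u \<in> W" "y (\<tau> u) = x u" using \<tau>[OF uO] by auto
  have "smooth_on ?O \<tau>" using S x y unfolding smooth_surface_def \<tau>_def by blast
  from smooth_on_has_derivative[OF this uO] show d: "(\<tau> has_derivative frechet_derivative \<tau> (at u)) (at u)" .
  fix f :: "'a \<Rightarrow> 'e" assume f: "smooth_on W (f \<circ> y)"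
  have "((f \<circ> y) \<circ> \<tau> has_derivative frechet_derivative (f \<circ> y) (at (\<tau> u)) \<circ> frechet_derivative \<tau> (at u)) (at u)"
    by (rule diff_chain_at[OF d smooth_on_has_derivative[OF f \<tau>(1)[OF uO]]])
  then have "(f \<circ> x has_derivative frechet_derivative (f \<circ> y) (at (\<tau> u)) \<circ> frechet_derivative \<tau> (at u)) (at u)"
    by (rule has_derivative_transform_within_open[OF _ O uO]) (simp add: \<tau>(2))
  from frechet_derivative_at[OF this]
  show "frechet_derivative (f \<circ> x) (at u) = frechet_derivative (f \<circ> y) (at (\<tau> u)) \<circ> frechet_derivative \<tau> (at u)" by simp
qed

text \<open>A transition map carries the image of one chart derivative into that of the other; one
  inclusion is enough because \<open>(V, x)\<close> is itself among the charts of the union.\<close>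

lemma tangent_image_chart:
  fixes f :: "'a::{t2_space,second_countable_topology} \<Rightarrow> 'e::euclidean_space"
  assumes S: "smooth_surface S A" and f: "immersion A f" and x: "(V, x) \<in> A" "u \<in> V"
  shows "tangent_image A f (x u) = range (frechet_derivative (f \<circ> x) (at u))"
proof -
  have sm: "smooth_on W (f \<circ> y)" if "(W, y) \<in> A" for W y using f that unfolding immersion_def by blast
  have sub: "range (frechet_derivative (f \<circ> y) (at w)) \<subseteq> range (frechet_derivative (f \<circ> x) (at u))"
    if y: "(W, y) \<in> A" "w \<in> W" "y w = x u" for W y w
  proof -
    have "y w \<in> x ` V" using that x by auto
    note tr = transition[OF S y(1) x(1) y(2) this]
    have "inv_into V x (y w) = u" using inv_into_f_f[OF chart_homeomorphism(6)[OF S x(1)] x(2)] y(3) by simp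
    then show ?thesis using tr(4)[OF sm[OF x(1)]] by auto
  qed
  show ?thesis
    unfolding tangent_image_def using sub x by blast
qed

lemma area_form_bilinear:
  fixes L :: "real^2 \<Rightarrow> 'e::euclidean_space" and \<omega> :: "'e \<Rightarrow> 'e \<Rightarrow> real"
  assumes L: "linear L" and \<omega>: "bilinear \<omega>" "\<And>x. \<omega> x x = 0"
  shows "\<omega> (L v) (L w) = (v$1 * w$2 - v$2 * w$1) * \<omega> (L e1) (L e2)"
proof -
  have e: "L v = v$1 *\<^sub>R L e1 + v$2 *\<^sub>R L e2" for v
    by (subst vec2_expand[of v]) (simp only: linear_add[OF L] linear_scale[OF L])
  note b = bilinear_ladd[OF \<omega>(1)] bilinear_radd[OF \<omega>(1)] bilinear_lmul[OF \<omega>(1)] bilinear_rmul[OF \<omega>(1)]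
  have "\<omega> (L e1 + L e2) (L e1 + L e2) = \<omega> (L e1) (L e1) + \<omega> (L e2) (L e1) + (\<omega> (L e1) (L e2) + \<omega> (L e2) (L e2))"
    by (simp only: b)
  then have "\<omega> (L e2) (L e1) = - \<omega> (L e1) (L e2)" unfolding \<omega>(2) by simp
  then show ?thesis unfolding e[of v] e[of w] by (simp add: b \<omega>(2) algebra_simps)
qed

text \<open>The right side contains neither \<open>v\<close> nor \<open>w\<close>: the square of an
  alternating form is the same on all orthonormal pairs, which gives \<open>C_squared\<close> its
  meaning.\<close>

lemma orthonormal_area_square:
  fixes L :: "real^2 \<Rightarrow> 'e::euclidean_space"
  assumes L: "linear L" "inj L" and \<omega>: "bilinear \<omega>" "\<And>x. \<omega> x x = 0"
    and on: "norm (L v) = 1" "norm (L w) = 1" "L v \<bullet> L w = 0"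
  shows "(\<omega> (L v) (L w))\<^sup>2 = (\<omega> (L e1) (L e2))\<^sup>2 / ((L e1 \<bullet> L e1) * (L e2 \<bullet> L e2) - (L e1 \<bullet> L e2)\<^sup>2)"
proof -
  let ?g = "(L e1 \<bullet> L e1) * (L e2 \<bullet> L e2) - (L e1 \<bullet> L e2)\<^sup>2"
  have e: "L v = v$1 *\<^sub>R L e1 + v$2 *\<^sub>R L e2" for v
    by (subst vec2_expand[of v]) (simp only: linear_add[OF L(1)] linear_scale[OF L(1)])
  have "(L v \<bullet> L v) * (L w \<bullet> L w) - (L v \<bullet> L w)\<^sup>2 = (v$1 * w$2 - v$2 * w$1)\<^sup>2 * ?g"
    unfolding e[of v] e[of w]
    by (simp add: inner_add_left inner_add_right inner_commute[of "L e2" "L e1"] power2_eq_square algebra_simps)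
  then have "1 = (v$1 * w$2 - v$2 * w$1)\<^sup>2 * ?g" using on by (simp add: dot_square_norm)
  then have "(v$1 * w$2 - v$2 * w$1)\<^sup>2 = 1 / ?g" using gram_det_neq_0[OF L] by (simp add: field_simps)
  then show ?thesis
    unfolding area_form_bilinear[OF L(1) \<omega>, of v w] power_mult_distrib by simp
qed

lemma C_squared_chart:
  assumes S: "smooth_surface S A" and f: "immersion A \<Phi>" and x: "(V, x) \<in> A" "u \<in> V"
    and on: "norm (frechet_derivative (\<Phi> \<circ> x) (at u) v) = 1" "norm (frechet_derivative (\<Phi> \<circ> x) (at u) w) = 1"
      "frechet_derivative (\<Phi> \<circ> x) (at u) v \<bullet> frechet_derivative (\<Phi> \<circ> x) (at u) w = 0"
  shows "C_squared A \<Phi> (x u) = (cross3 (fst (\<Phi> (x u))) (fst (frechet_derivative (\<Phi> \<circ> x) (at u) v))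
      \<bullet> fst (frechet_derivative (\<Phi> \<circ> x) (at u) w))\<^sup>2"
proof -
  let ?L = "frechet_derivative (\<Phi> \<circ> x) (at u)"
  define \<omega> where "\<omega> E F = cross3 (fst (\<Phi> (x u))) (fst E) \<bullet> fst F" for E F :: "(real^3) \<times> (real^3)"
  have L: "linear ?L" "inj ?L"
    using f x has_derivative_linear[OF smooth_on_has_derivative, of V "\<Phi> \<circ> x" u] unfolding immersion_def by blast+
  have \<omega>: "bilinear \<omega>" "\<omega> E E = 0" for E
    unfolding \<omega>_def bilinear_def by (auto intro!: linearI simp: cross_add_right cross_mult_right inner_add_left inner_add_right dot_cross_self)
  note sq = orthonormal_area_square[where \<omega>=\<omega>, OF L \<omega>]
  have "\<forall>E1 \<in> range ?L. \<forall>E2 \<in> range ?L. norm E1 = 1 \<and> norm E2 = 1 \<and> E1 \<bullet> E2 = 0 \<longrightarrow> (\<omega> E1 E2)\<^sup>2 = (\<omega> (?L v) (?L w))\<^sup>2"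
    using sq[OF on] sq by auto
  then have "(THE c. \<forall>E1 \<in> range ?L. \<forall>E2 \<in> range ?L. norm E1 = 1 \<and> norm E2 = 1 \<and> E1 \<bullet> E2 = 0 \<longrightarrow> (\<omega> E1 E2)\<^sup>2 = c)
      = (\<omega> (?L v) (?L w))\<^sup>2"
    by (intro the_equality) (use on in blast)+
  then show ?thesis
    unfolding C_squared_def tangent_image_chart[OF S f x] \<omega>_def .
qed

definition swap2 :: "real^2 \<Rightarrow> real^2" where
  "swap2 v = vector [v$2, v$1]"

lemma swap2_swap2 [simp]: "swap2 (swap2 v) = v"
  by (simp add: swap2_def vec_eq_iff forall_2)

lemma bounded_linear_swap2: "bounded_linear swap2"
  by (auto intro!: linearI simp: linear_conv_bounded_linear[symmetric] swap2_def vec_eq_iff forall_2)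

text \<open>Material for an oriented atlas: a chart is restricted to an open set on which the lift
  has one sign of orientation and, if that sign is negative, composed with a reflection.
  \<open>id\<close> and \<open>swap2\<close> are both linear involutions, which allows a common
  treatment.\<close>

definition reflected_charts :: "'a::{t2_space,second_countable_topology} atlas \<Rightarrow> 'a atlas" where
  "reflected_charts A = {(\<rho> -` W, x \<circ> \<rho>) | V x W \<rho>. (V, x) \<in> A \<and> open W \<and> W \<subseteq> V \<and> (\<rho> = id \<or> \<rho> = swap2)}"

lemma reflected_chartsI:
  "(V, x) \<in> A \<Longrightarrow> open W \<Longrightarrow> W \<subseteq> V \<Longrightarrow> \<rho> = id \<or> \<rho> = swap2 \<Longrightarrow> (\<rho> -` W, x \<circ> \<rho>) \<in> reflected_charts A"
  unfolding reflected_charts_def by blast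

lemma reflected_chart_inv:
  assumes x: "inj_on x V" and W: "W \<subseteq> V" and \<rho>: "\<And>v. \<rho> (\<rho> v) = v" and z: "z \<in> x ` W"
  shows "inv_into (\<rho> -` W) (x \<circ> \<rho>) z = \<rho> (inv_into V x z)"
proof -
  obtain w where w: "w \<in> W" "z = x w" using z by blast
  have "inj_on (x \<circ> \<rho>) (\<rho> -` W)"
    using x W \<rho> by (intro inj_onI) (metis comp_apply inj_onD subsetD vimage_eq)
  moreover have "\<rho> w \<in> \<rho> -` W" "(x \<circ> \<rho>) (\<rho> w) = z" using w \<rho> by simp_all
  ultimately have "inv_into (\<rho> -` W) (x \<circ> \<rho>) z = \<rho> w" by (metis inv_into_f_f)
  moreover have "inv_into V x z = w" using inv_into_f_f[OF x, of w] w W by blast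
  ultimately show ?thesis by simp
qed

lemma reflected_charts_cases:
  assumes "(V', x') \<in> reflected_charts A"
  obtains V x W \<rho> where "(V, x) \<in> A" "open W" "W \<subseteq> V" "V' = \<rho> -` W" "x' = x \<circ> \<rho>" "\<rho> = id \<or> \<rho> = swap2"
    "bounded_linear \<rho>" "\<And>v. \<rho> (\<rho> v) = v" "x' ` V' = x ` W"
proof -
  obtain V x W \<rho> where *: "(V, x) \<in> A" "open W" "W \<subseteq> V" "V' = \<rho> -` W" "x' = x \<circ> \<rho>" "\<rho> = id \<or> \<rho> = swap2"
    using assms unfolding reflected_charts_def by blast
  have \<rho>: "\<rho> (\<rho> v) = v" for v using *(6) by auto
  have "bounded_linear \<rho>" using *(6) bounded_linear_swap2 bounded_linear_ident by (auto simp: id_def)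
  moreover have im: "\<rho> ` (\<rho> -` W) = W" using \<rho> by (metis surj_def surj_image_vimage_eq)
  have "x' ` V' = x ` (\<rho> ` (\<rho> -` W))" unfolding *(4,5) by (rule image_comp[symmetric])
  then have "x' ` V' = x ` W" unfolding im .
  ultimately show ?thesis using that * \<rho> by blast
qed

lemma subset_reflected_charts: "smooth_surface S A \<Longrightarrow> A \<subseteq> reflected_charts A"
proof clarify
  fix V x assume "smooth_surface S A" "(V, x) \<in> A"
  then show "(V, x) \<in> reflected_charts A"
    using reflected_chartsI[of V x A V id] chart_homeomorphism(1)[of S A V x] by simp
qed

text \<open>Stated for any covering subfamily, so that it serves for the oriented atlas and for its
  union with \<open>A\<close>, that is, for compatibility of the two.\<close>

lemma smooth_surface_reflected_charts:
  assumes S: "smooth_surface S A" and C: "C \<subseteq> reflected_charts A" and cov: "(\<Union>(V, x)\<in>C. x ` V) = S"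
  shows "smooth_surface S C"
  unfolding smooth_surface_def
proof (intro conjI cov)
  show "\<forall>(V, x)\<in>C. open V \<and> openin (top_of_set S) (x ` V) \<and> homeomorphism V (x ` V) x (inv_into V x)"
  proof clarify
    fix V' x' assume "(V', x') \<in> C"
    then have "(V', x') \<in> reflected_charts A" using C by blast
    then obtain V x W \<rho> where *: "(V, x) \<in> A" "open W" "W \<subseteq> V" "V' = \<rho> -` W" "x' = x \<circ> \<rho>"
      "bounded_linear \<rho>" "\<And>v. \<rho> (\<rho> v) = v" "x' ` V' = x ` W" by (rule reflected_charts_cases) blast
    note c = chart_homeomorphism[OF S *(1)]
    have \<rho>: "continuous_on X \<rho>" for X using *(6) by (rule linear_continuous_on)
    have op: "open V'" unfolding *(4) by (rule open_vimage[OF *(2) \<rho>])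
    have im: "openin (top_of_set S) (x' ` V')" unfolding *(8) by (rule chart_image_open[OF S *(1-3)])
    have inv: "inv_into V' x' z = \<rho> (inv_into V x z)" if "z \<in> x ` W" for z
      unfolding *(4,5) by (rule reflected_chart_inv[OF c(6) *(3,7) that])
    have "inj_on x' V'"
      unfolding *(4,5) using c(6) *(3,7) by (intro inj_onI) (metis comp_apply inj_onD subsetD vimage_eq)
    moreover have "continuous_on V' x'"
      unfolding *(4,5) using c(5) *(3) by (intro continuous_on_compose \<rho>) (auto intro: continuous_on_subset)
    moreover have "continuous_on (x ` W) (inv_into V x)"
      using homeomorphism_cont2[OF c(3)] *(3) by (auto intro: continuous_on_subset)
    then have "continuous_on (x ` W) (\<rho> \<circ> inv_into V x)"
      by (intro continuous_on_compose \<rho>)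
    then have "continuous_on (x' ` V') (inv_into V' x')"
      unfolding *(8) by (rule continuous_on_eq) (simp add: inv)
    ultimately have "homeomorphism V' (x' ` V') x' (inv_into V' x')"
      unfolding homeomorphism_def by (auto simp: inv_into_into f_inv_into_f image_iff)
    with op im show "open V' \<and> openin (top_of_set S) (x' ` V') \<and> homeomorphism V' (x' ` V') x' (inv_into V' x')" by blast
  qed
  show "\<forall>(V, x)\<in>C. \<forall>(W, y)\<in>C. smooth_on (V \<inter> x -` (y ` W)) (inv_into W y \<circ> x)"
  proof clarify
    fix V1' x1' V2' x2' assume "(V1', x1') \<in> C" "(V2', x2') \<in> C"
    then have 12: "(V1', x1') \<in> reflected_charts A" "(V2', x2') \<in> reflected_charts A" using C by blast+
    obtain V x W \<rho> where *: "(V, x) \<in> A" "open W" "W \<subseteq> V" "V1' = \<rho> -` W" "x1' = x \<circ> \<rho>"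
      "bounded_linear \<rho>" "\<And>v. \<rho> (\<rho> v) = v" "x1' ` V1' = x ` W" using 12(1) by (rule reflected_charts_cases) blast
    obtain V2 y Y \<rho>2 where **: "(V2, y) \<in> A" "open Y" "Y \<subseteq> V2" "V2' = \<rho>2 -` Y" "x2' = y \<circ> \<rho>2"
      "bounded_linear \<rho>2" "\<And>v. \<rho>2 (\<rho>2 v) = v" "x2' ` V2' = y ` Y" using 12(2) by (rule reflected_charts_cases) blast
    have "open (V \<inter> x -` (y ` Y))" by (rule chart_preimage_open[OF S *(1) chart_image_open[OF S **(1-3)]])
    then have O: "open (W \<inter> x -` (y ` Y))" using *(2,3) by (metis (no_types, lifting) inf.absorb_iff2 inf_assoc inf_commute open_Int)
    have "smooth_on (V \<inter> x -` (y ` V2)) (inv_into V2 y \<circ> x)"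
      using S *(1) **(1) unfolding smooth_surface_def by blast
    then have "smooth_on (W \<inter> x -` (y ` Y)) (inv_into V2 y \<circ> x)"
      by (rule smooth_on_subset) (use *(3) **(3) in blast)
    then have "smooth_on (W \<inter> x -` (y ` Y)) (\<lambda>u. \<rho>2 ((inv_into V2 y \<circ> x) u))"
      by (rule smooth_on_bounded_linear[OF **(6) O])
    then have sm: "smooth_on (\<rho> -` (W \<inter> x -` (y ` Y))) (\<lambda>u. \<rho>2 ((inv_into V2 y \<circ> x) (\<rho> u)))"
      by (rule smooth_on_compose_linear[OF *(6) O])
    have dom: "V1' \<inter> x1' -` (x2' ` V2') = \<rho> -` (W \<inter> x -` (y ` Y))" unfolding **(8) *(4,5) by auto
    show "smooth_on (V1' \<inter> x1' -` (x2' ` V2')) (inv_into V2' x2' \<circ> x1')"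
      unfolding dom
    proof (rule smooth_on_cong[OF _ _ sm])
      show "open (\<rho> -` (W \<inter> x -` (y ` Y)))"
        by (rule open_vimage[OF O linear_continuous_on[OF *(6)]])
      fix u assume "u \<in> \<rho> -` (W \<inter> x -` (y ` Y))"
      then have "x (\<rho> u) \<in> y ` Y" by blast
      from reflected_chart_inv[OF chart_homeomorphism(6)[OF S **(1)] **(3,7) this]
      show "\<rho>2 ((inv_into V2 y \<circ> x) (\<rho> u)) = (inv_into V2' x2' \<circ> x1') u" by (simp add: *(5) **(4,5))
    qed
  qed
qed

subsection \<open>The global lift\<close>

locale minimal_lagrangian_surface =
  fixes S :: "'a::{t2_space,second_countable_topology} set" and A :: "'a atlas"
    and \<Phi> :: "'a \<Rightarrow> (real^3) \<times> (real^3)"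
  assumes surface: "smooth_surface S A"
    and minimal: "minimal_immersion S A S2xS2 tangent_S2xS2 \<Phi>"
    and lagrangian: "lagrangian A \<Phi>"
    and C_squared: "\<forall>p\<in>S. C_squared A \<Phi> p < 1/4"
begin

lemma immersion: "immersion A \<Phi>"
  using minimal by (simp add: minimal_immersion_def)

lemma chart_point: "(V, x) \<in> A \<Longrightarrow> u \<in> V \<Longrightarrow> x u \<in> S"
  using chart_homeomorphism(4)[OF surface] by blast

lemma chart_exists:
  assumes "p \<in> S"
  obtains V x u where "(V, x) \<in> A" "u \<in> V" "x u = p"
  using surface assms unfolding smooth_surface_def by blast

lemma chart:
  assumes x: "(V, x) \<in> A"
  shows "lagrangian_chart V (\<Phi> \<circ> x)"
proof
  show "open V" by (rule chart_homeomorphism(1)[OF surface x])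
  have im: "smooth_on V (\<Phi> \<circ> x) \<and> (\<forall>u\<in>V. inj (frechet_derivative (\<Phi> \<circ> x) (at u)))"
    using bspec[OF immersion[unfolded immersion_def] x] by simp
  then show "smooth_on V (\<Phi> \<circ> x)" by blast
  fix u assume u: "u \<in> V"
  show "inj (frechet_derivative (\<Phi> \<circ> x) (at u))" using im u by blast
  have "\<Phi> ` S \<subseteq> S2xS2" and H: "\<forall>(V, x)\<in>A. \<forall>u\<in>V. mean_curvature_vector tangent_S2xS2 (\<Phi> \<circ> x) u = 0"
    using minimal by (simp_all add: minimal_immersion_def)
  then show "(\<Phi> \<circ> x) u \<in> S2xS2" using chart_point[OF x u] by (simp add: image_subset_iff)
  show "omega_S2xS2 ((\<Phi> \<circ> x) u) (frechet_derivative (\<Phi> \<circ> x) (at u) v) (frechet_derivative (\<Phi> \<circ> x) (at u) w) = 0" for v w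
    using bspec[OF lagrangian[unfolded lagrangian_def] x] u by simp
  show "mean_curvature_vector tangent_S2xS2 (\<Phi> \<circ> x) u = 0"
    using bspec[OF H x] u by simp
  fix v w
  assume on: "norm (frechet_derivative (\<Phi> \<circ> x) (at u) v) = 1" "norm (frechet_derivative (\<Phi> \<circ> x) (at u) w) = 1"
     "frechet_derivative (\<Phi> \<circ> x) (at u) v \<bullet> frechet_derivative (\<Phi> \<circ> x) (at u) w = 0"
  show "(cross3 (fst ((\<Phi> \<circ> x) u)) (fst (frechet_derivative (\<Phi> \<circ> x) (at u) v)) \<bullet> fst (frechet_derivative (\<Phi> \<circ> x) (at u) w))\<^sup>2 < 1 / 4"
    using bspec[OF C_squared chart_point[OF x u]] unfolding C_squared_chart[OF surface immersion x u on] o_apply .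
qed

text \<open>Fibres of the discrete bundle, formed with the tangent plane so that they depend on the
  point and not on a chart.\<close>

definition lift_values :: "'a \<Rightarrow> (real^4) set" where
  "lift_values p = gauss_lifts (\<Phi> p) (tangent_image A \<Phi> p)"

lemma lift_values_chart:
  assumes x: "(V, x) \<in> A" "u \<in> V"
  shows "lift_values (x u) = lagrangian_chart.lifts (\<Phi> \<circ> x) u"
proof -
  interpret lagrangian_chart V "\<Phi> \<circ> x" by (rule chart[OF x(1)])
  show ?thesis unfolding lift_values_def lifts_def tangent_image_chart[OF surface immersion x] by simp
qed

text \<open>One local lift \<open>f\<close> yields four sections \<open>f\<close>,
  \<open>- f\<close>, \<open>\<phi> f\<close>, \<open>- \<phi> f\<close>, and these exhaust every
  fibre over the image of a ball.\<close>

lemma lift_values_local_sections: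
  assumes "p \<in> S"
  shows "\<exists>U. p \<in> U \<and> openin (top_of_set S) U \<and> path_connected U \<and>
      (\<forall>y\<in>U. \<forall>k\<in>lift_values y. \<exists>f. continuous_on U f \<and> f y = k \<and> (\<forall>z\<in>U. f z \<in> lift_values z))"
proof -
  obtain V x u0 where x: "(V, x) \<in> A" "u0 \<in> V" "x u0 = p" using chart_exists[OF assms] .
  interpret lagrangian_chart V "\<Phi> \<circ> x" by (rule chart[OF x(1)])
  note c = chart_homeomorphism[OF surface x(1)]
  obtain q0 where "q0 \<in> lifts u0" using lifts_nonempty[OF x(2)] by blast
  then obtain W f where f: "open W" "u0 \<in> W" "W \<subseteq> V" "f u0 = q0" and fd: "\<And>u. u \<in> W \<Longrightarrow> f differentiable (at u)"
    and fl: "\<And>u. u \<in> W \<Longrightarrow> f u \<in> lifts u" using local_lift[OF x(2)] by metis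
  obtain d where d: "d > 0" "ball u0 d \<subseteq> W" using f(1,2) open_contains_ball by blast
  let ?B = "ball u0 d"
  have BV: "?B \<subseteq> V" using d f by blast
  have fB: "continuous_on ?B f"
    using d(2) fd by (intro continuous_at_imp_continuous_on ballI differentiable_imp_continuous_within) blast
  have \<phi>B: "continuous_on ?B \<phi>"
    using smooth BV unfolding \<phi>_def[abs_def]
    by (intro continuous_on_fst) (meson continuous_on_subset smooth_on_imp_continuous_on)
  have B\<phi>f: "continuous_on ?B (\<lambda>u. qleft (\<phi> u) (f u))"
    by (rule bounded_bilinear.continuous_on[OF bounded_bilinear_qleft \<phi>B fB])
  have inv: "continuous_on (x ` ?B) (inv_into V x)" "inv_into V x ` x ` ?B \<subseteq> ?B"
    "\<And>u. u \<in> ?B \<Longrightarrow> inv_into V x (x u) = u"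
    using homeomorphism_cont2[OF c(3)] BV homeomorphism_apply1[OF c(3)]
    by (auto intro: continuous_on_subset)
  have sec: "\<exists>h. continuous_on (x ` ?B) h \<and> h (x u) = g u \<and> (\<forall>z\<in>x ` ?B. h z \<in> lift_values z)"
    if g: "continuous_on ?B g" "\<And>u. u \<in> ?B \<Longrightarrow> g u \<in> lifts u" and u: "u \<in> ?B" for g u
  proof (intro exI conjI ballI)
    show "continuous_on (x ` ?B) (\<lambda>z. g (inv_into V x z))"
      by (rule continuous_on_compose2[OF g(1) inv(1,2)])
    show "g (inv_into V x (x u)) = g u" using inv(3)[OF u] by simp
    fix z assume "z \<in> x ` ?B"
    then obtain v where v: "v \<in> ?B" "z = x v" by blast
    then have "lift_values z = lifts v" using lift_values_chart[OF x(1), of v] BV by blast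
    then show "g (inv_into V x z) \<in> lift_values z" using g(2)[OF v(1)] inv(3)[OF v(1)] v(2) by simp
  qed
  have "\<exists>h. continuous_on (x ` ?B) h \<and> h y = k \<and> (\<forall>z\<in>x ` ?B. h z \<in> lift_values z)"
    if y: "y \<in> x ` ?B" and k: "k \<in> lift_values y" for y k
  proof -
    obtain u where u: "u \<in> ?B" "y = x u" using y by blast
    have uV: "u \<in> V" using u BV by blast
    have "k \<in> lifts u" using k lift_values_chart[OF x(1) uV] u by simp
    then consider "k = f u" | "k = - f u" | "k = qleft (\<phi> u) (f u)" | "k = - qleft (\<phi> u) (f u)"
      using lifts_cases[OF uV fl] u d(2) by blast
    then show ?thesis
    proof cases
      case 1
      then show ?thesis using sec[OF fB _ u(1)] fl d(2) u(2) by blast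
    next
      case 2
      then show ?thesis using sec[OF continuous_on_minus[OF fB] _ u(1)] fl d(2) BV u(2) lifts_uminus by blast
    next
      case 3
      then show ?thesis using sec[OF B\<phi>f _ u(1)] fl d(2) BV u(2) lifts_rotate by blast
    next
      case 4
      then show ?thesis using sec[OF continuous_on_minus[OF B\<phi>f] _ u(1)] fl d(2) BV u(2) lifts_rotate lifts_uminus by blast
    qed
  qed
  moreover have "p \<in> x ` ?B" using x(3) d(1) by auto
  moreover have "openin (top_of_set S) (x ` ?B)" by (rule chart_image_open[OF surface x(1) open_ball BV])
  moreover have "path_connected (x ` ?B)"
    using c(5) BV by (intro path_connected_continuous_image convex_imp_path_connected convex_ball) (auto intro: continuous_on_subset)
  ultimately show ?thesis by blast
qed

lemma lift_exists:
  assumes "simply_connected S"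
  obtains \<sigma> where "continuous_on S \<sigma>" "\<And>p. p \<in> S \<Longrightarrow> \<sigma> p \<in> lift_values p"
proof -
  have ne: "lift_values p \<noteq> {}" if p: "p \<in> S" for p
  proof -
    obtain V x u where x: "(V, x) \<in> A" "u \<in> V" "x u = p" using chart_exists[OF p] .
    interpret lagrangian_chart V "\<Phi> \<circ> x" by (rule chart[OF x(1)])
    show ?thesis using lifts_nonempty[OF x(2)] lift_values_chart[OF x(1,2)] x(3) by simp
  qed
  have sep: "1 \<le> dist k k'" if p: "p \<in> S" and k: "k \<in> lift_values p" "k' \<in> lift_values p" "k \<noteq> k'" for p k k'
  proof -
    obtain V x u where x: "(V, x) \<in> A" "u \<in> V" "x u = p" using chart_exists[OF p] .
    interpret lagrangian_chart V "\<Phi> \<circ> x" by (rule chart[OF x(1)])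
    show ?thesis using lifts_separated[OF x(2)] lift_values_chart[OF x(1,2)] x(3) k by blast
  qed
  show thesis
    using simply_connected_discrete_section[of S lift_values 1, OF lift_values_local_sections ne zero_less_one sep assms that] .
qed

end

section \<open>Minimality, orientation and Gauss map of the global lift\<close>

locale minimal_lagrangian_lift = minimal_lagrangian_surface S A \<Phi>
  for S :: "'a::{t2_space,second_countable_topology} set" and A :: "'a atlas" and \<Phi> :: "'a \<Rightarrow> (real^3) \<times> (real^3)" +
  fixes \<sigma> :: "'a \<Rightarrow> real^4"
  assumes \<sigma>: "continuous_on S \<sigma>" "\<And>p. p \<in> S \<Longrightarrow> \<sigma> p \<in> lift_values p"
begin

text \<open>Near \<open>u\<close> the continuous section stays within distance 1 of the
  differentiable local lift through its value at \<open>u\<close>, so by the gap between candidates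
  the two coincide there.\<close>

lemma lift_chart:
  assumes x: "(V, x) \<in> A" and u: "u \<in> V"
  shows "(\<sigma> \<circ> x) u \<in> lagrangian_chart.lifts (\<Phi> \<circ> x) u" and "(\<sigma> \<circ> x) differentiable (at u)"
proof -
  interpret lagrangian_chart V "\<Phi> \<circ> x" by (rule chart[OF x])
  note c = chart_homeomorphism[OF surface x]
  have mem: "(\<sigma> \<circ> x) v \<in> lifts v" if "v \<in> V" for v
    using \<sigma>(2)[OF chart_point[OF x that]] lift_values_chart[OF x that] by simp
  then show "(\<sigma> \<circ> x) u \<in> lifts u" using u .
  obtain W f where f: "open W" "u \<in> W" "W \<subseteq> V" "f u = (\<sigma> \<circ> x) u" and fd: "\<And>v. v \<in> W \<Longrightarrow> f differentiable (at v)"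
    and fl: "\<And>v. v \<in> W \<Longrightarrow> f v \<in> lifts v" using local_lift[OF u mem[OF u]] by metis
  have "continuous_on V (\<sigma> \<circ> x)"
    using c(4,5) \<sigma>(1) by (intro continuous_on_compose) (auto intro: continuous_on_subset)
  then have "continuous_on W (\<sigma> \<circ> x)" using f(3) continuous_on_subset by blast
  moreover have "continuous_on W f"
    using fd by (intro continuous_at_imp_continuous_on ballI differentiable_imp_continuous_within) blast
  ultimately have "continuous_on W (\<lambda>v. dist (f v) ((\<sigma> \<circ> x) v))" by (intro continuous_on_dist)
  then have O: "open (W \<inter> (\<lambda>v. dist (f v) ((\<sigma> \<circ> x) v)) -` {..<1})"
    by (rule continuous_open_preimage[OF _ f(1)]) simp
  have uO: "u \<in> W \<inter> (\<lambda>v. dist (f v) ((\<sigma> \<circ> x) v)) -` {..<1}" using f(2,4) by simp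
  have eq: "f v = (\<sigma> \<circ> x) v" if v: "v \<in> W \<inter> (\<lambda>v. dist (f v) ((\<sigma> \<circ> x) v)) -` {..<1}" for v
  proof (rule ccontr)
    assume "f v \<noteq> (\<sigma> \<circ> x) v"
    moreover have "v \<in> V" "v \<in> W" using v f(3) by blast+
    ultimately have "1 \<le> dist (f v) ((\<sigma> \<circ> x) v)" using lifts_separated[OF _ fl mem] by blast
    then show False using v by simp
  qed
  obtain f' where "(f has_derivative f') (at u)" using fd[OF f(2)] unfolding differentiable_def by blast
  then have "(\<sigma> \<circ> x has_derivative f') (at u)"
    by (rule has_derivative_transform_within_open[OF _ O uO]) (rule eq)
  then show "(\<sigma> \<circ> x) differentiable (at u)" unfolding differentiable_def by blast
qed

lemma lift_chart_derivative:
  assumes x: "(V, x) \<in> A" and u: "u \<in> V"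
  shows "smooth_on V (\<sigma> \<circ> x)"
    and "frechet_derivative (\<sigma> \<circ> x) (at u) = lagrangian_chart.lift_differential (\<Phi> \<circ> x) u ((\<sigma> \<circ> x) u)"
    and "mean_curvature_vector tangent_S3 (\<sigma> \<circ> x) u = 0"
proof -
  interpret lagrangian_chart V "\<Phi> \<circ> x" by (rule chart[OF x])
  note l = lift_chart[OF x]
  show "smooth_on V (\<sigma> \<circ> x)" using open_V subset_refl l by (rule lift_smooth)
  show "frechet_derivative (\<sigma> \<circ> x) (at u) = lift_differential u ((\<sigma> \<circ> x) u)"
    using open_V subset_refl l u by (rule lift_frechet_derivative)
  show "mean_curvature_vector tangent_S3 (\<sigma> \<circ> x) u = 0"
    using open_V subset_refl l u by (rule lift_minimal)
qed

lemma lift_minimal_immersion: "minimal_immersion S A S3 tangent_S3 \<sigma>"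
proof -
  have "\<sigma> ` S \<subseteq> S3"
  proof (rule image_subsetI)
    fix p assume "p \<in> S"
    from \<sigma>(2)[OF this] show "\<sigma> p \<in> S3" by (simp add: S3_def lift_values_def gauss_lifts_def)
  qed
  moreover have "smooth_on V (\<sigma> \<circ> x)" if x: "(V, x) \<in> A" for V x
  proof (cases "V = {}")
    \<comment> \<open>An atlas may contain a chart with empty domain, while the chart lemmas are
      stated at a point of the domain.\<close>
    case True
    have "Ck_on k f {}" for k and f :: "real^2 \<Rightarrow> real^4" by (induction k arbitrary: f) simp_all
    then show ?thesis by (simp add: True smooth_on_def)
  next
    case False
    then obtain u where "u \<in> V" by blast
    then show ?thesis by (rule lift_chart_derivative(1)[OF x])
  qed
  moreover have "inj (frechet_derivative (\<sigma> \<circ> x) (at u))" if x: "(V, x) \<in> A" and u: "u \<in> V" for V x u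
  proof -
    interpret lagrangian_chart V "\<Phi> \<circ> x" by (rule chart[OF x])
    show ?thesis unfolding lift_chart_derivative(2)[OF x u] by (rule lift_differential_inj(2)[OF u lift_chart(1)[OF x u]])
  qed
  ultimately show ?thesis
    unfolding minimal_immersion_def immersion_def using lift_chart_derivative(3) by (auto split: prod.splits)
qed

abbreviation d\<sigma> :: "(real^2 \<Rightarrow> 'a) \<Rightarrow> real^2 \<Rightarrow> real^2 \<Rightarrow> real^4" where
  "d\<sigma> x u \<equiv> frechet_derivative (\<sigma> \<circ> x) (at u)"

text \<open>Signed area density of the lift, positive when the coordinate frame orients the tangent
  plane by the rotation \<phi>, the orientation for which the plane has Gauss image \<Phi>.\<close>

definition orientation_density :: "(real^2 \<Rightarrow> 'a) \<Rightarrow> real^2 \<Rightarrow> real" where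
  "orientation_density x u =
     qleft (fst (\<Phi> (x u))) (d\<sigma> x u e1) \<bullet> d\<sigma> x u e2"

definition oriented_charts :: "'a atlas" where
  "oriented_charts = {(V, x) \<in> reflected_charts A. \<forall>u\<in>V. orientation_density x u > 0}"

lemma reflected_chart_derivative:
  assumes x': "(V', x') \<in> reflected_charts A" and u: "u \<in> V'"
  defines "L \<equiv> d\<sigma> x' u"
  shows "smooth_on V' (\<sigma> \<circ> x')" and "linear L" and "inj L"
    and "in_plane (fst (\<Phi> (x' u))) (snd (\<Phi> (x' u))) (L v)"
proof -
  obtain V x W \<rho> where *: "(V, x) \<in> A" "open W" "W \<subseteq> V" "V' = \<rho> -` W" "x' = x \<circ> \<rho>"
      "bounded_linear \<rho>" "\<And>v. \<rho> (\<rho> v) = v" using x' by (rule reflected_charts_cases) blast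
  interpret lagrangian_chart V "\<Phi> \<circ> x" by (rule chart[OF *(1)])
  have \<rho>u: "\<rho> u \<in> W" "\<rho> u \<in> V" using u *(3,4) by auto
  note l = lift_chart(1)[OF *(1) \<rho>u(2)]
  have "smooth_on W (\<sigma> \<circ> x)" by (rule smooth_on_subset[OF lift_chart_derivative(1)[OF *(1) \<rho>u(2)] *(3)])
  from smooth_on_compose_linear[OF *(6,2) this]
  show "smooth_on V' (\<sigma> \<circ> x')" unfolding *(4,5) by (simp add: o_def)
  have "((\<sigma> \<circ> x) \<circ> \<rho> has_derivative d\<sigma> x (\<rho> u) \<circ> \<rho>) (at u)"
    by (rule diff_chain_at[OF bounded_linear_imp_has_derivative[OF *(6)]
      smooth_on_has_derivative[OF lift_chart_derivative(1)[OF *(1) \<rho>u(2)] \<rho>u(2)]])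
  from frechet_derivative_at[OF this]
  have L: "L = lift_differential (\<rho> u) ((\<sigma> \<circ> x) (\<rho> u)) \<circ> \<rho>"
    unfolding L_def *(5) lift_chart_derivative(2)[OF *(1) \<rho>u(2)] by (simp add: o_assoc)
  have \<rho>: "linear \<rho>" "inj \<rho>" using *(6,7) by (auto simp: bounded_linear.linear intro: inj_on_inverseI)
  show "linear L" "inj L"
    unfolding L using \<rho> lift_differential_inj[OF \<rho>u(2) l] by (auto intro: linear_compose inj_compose)
  show "in_plane (fst (\<Phi> (x' u))) (snd (\<Phi> (x' u))) (L v)"
    using lift_differential_tangent[OF \<rho>u(2) l, of "\<rho> v"] unfolding L by (simp add: \<phi>_def \<psi>_def *(5))
qed

lemma orientation_density_nonzero:
  assumes x: "(V, x) \<in> A" and u: "u \<in> V"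
  shows "orientation_density x u \<noteq> 0"
proof -
  interpret lagrangian_chart V "\<Phi> \<circ> x" by (rule chart[OF x])
  show ?thesis
    using lift_orientation_nonzero[OF u lift_chart(1)[OF x u]]
    unfolding orientation_density_def lift_chart_derivative(2)[OF x u] by (simp add: \<phi>_def)
qed

lemma orientation_density_swap:
  assumes x: "(V, x) \<in> A" and u: "swap2 u \<in> V"
  shows "orientation_density (x \<circ> swap2) u = - orientation_density x (swap2 u)"
proof -
  have "((\<sigma> \<circ> x) \<circ> swap2 has_derivative d\<sigma> x (swap2 u) \<circ> swap2) (at u)"
    by (rule diff_chain_at[OF bounded_linear_imp_has_derivative[OF bounded_linear_swap2]
      smooth_on_has_derivative[OF lift_chart_derivative(1)[OF x u] u]])
  from frechet_derivative_at[OF this]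
  have D: "d\<sigma> (x \<circ> swap2) u = d\<sigma> x (swap2 u) \<circ> swap2"
    by (simp add: o_assoc)
  have s: "swap2 e1 = e2" "swap2 e2 = e1" by (simp_all add: swap2_def vec_eq_iff forall_2 axis_def)
  show ?thesis
    unfolding orientation_density_def D o_apply s by (subst qleft_inner) (simp add: inner_commute)
qed

lemma continuous_orientation_density:
  assumes x: "(V, x) \<in> A"
  shows "continuous_on V (orientation_density x)"
proof (cases "V = {}")
  case False
  then obtain u where u: "u \<in> V" by blast
  interpret lagrangian_chart V "\<Phi> \<circ> x" by (rule chart[OF x])
  have "continuous_on V (\<lambda>u. fst (\<Phi> (x u)))"
    using continuous_on_fst[OF smooth_on_imp_continuous_on[OF smooth]] by simp
  moreover have "continuous_on V (\<lambda>u. d\<sigma> x u v)" for v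
    by (rule smooth_on_imp_continuous_on[OF smooth_on_frechet_derivative[OF lift_chart_derivative(1)[OF x u]]])
  ultimately show ?thesis
    unfolding orientation_density_def[abs_def]
    by (intro continuous_on_inner bounded_bilinear.continuous_on[OF bounded_bilinear_qleft])
qed simp

lemma oriented_charts_cover: "(\<Union>(V, x)\<in>oriented_charts. x ` V) = S"
proof (intro equalityI subsetI)
  fix p assume "p \<in> (\<Union>(V, x)\<in>oriented_charts. x ` V)"
  then obtain V' x' where x': "(V', x') \<in> reflected_charts A" and p: "p \<in> x' ` V'"
    unfolding oriented_charts_def by blast
  obtain V x W where "(V, x) \<in> A" "W \<subseteq> V" "x' ` V' = x ` W" using x' by (rule reflected_charts_cases)
  moreover from this p obtain w where "w \<in> W" "p = x w" by blast
  ultimately show "p \<in> S" using chart_point[of V x w] by blast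
next
  fix p assume "p \<in> S"
  from chart_exists[OF this] obtain V x u where x: "(V, x) \<in> A" "u \<in> V" "x u = p" .
  have op: "open (V \<inter> orientation_density x -` T)" if "open T" for T
    by (rule continuous_open_preimage[OF continuous_orientation_density[OF x(1)] chart_homeomorphism(1)[OF surface x(1)] that])
  show "p \<in> (\<Union>(V, x)\<in>oriented_charts. x ` V)"
  proof (cases "orientation_density x u > 0")
    case True
    let ?W = "V \<inter> orientation_density x -` {0<..}"
    have "(id -` ?W, x \<circ> id) \<in> reflected_charts A"
      by (rule reflected_chartsI[OF x(1) op]) auto
    then have W: "(?W, x) \<in> oriented_charts" unfolding oriented_charts_def by simp
    have "p \<in> x ` ?W" using x True by auto
    then show ?thesis by (intro UN_I[OF W]) simp
  next
    case False
    let ?W = "V \<inter> orientation_density x -` {..<0}"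
    have "(swap2 -` ?W, x \<circ> swap2) \<in> reflected_charts A"
      by (rule reflected_chartsI[OF x(1) op]) auto
    then have W: "(swap2 -` ?W, x \<circ> swap2) \<in> oriented_charts"
      unfolding oriented_charts_def using orientation_density_swap[OF x(1)] by simp
    have "orientation_density x u < 0" using False orientation_density_nonzero[OF x(1,2)] by simp
    then have "p \<in> (x \<circ> swap2) ` (swap2 -` ?W)"
      using x by (intro image_eqI[of _ _ "swap2 u"]) simp_all
    then show ?thesis by (intro UN_I[OF W]) simp
  qed
qed

lemma oriented_charts_subset: "oriented_charts \<subseteq> reflected_charts A"
  unfolding oriented_charts_def by blast

lemma oriented_charts_surface: "smooth_surface S oriented_charts"
  by (rule smooth_surface_reflected_charts[OF surface oriented_charts_subset oriented_charts_cover])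

lemma area_form: "bilinear (\<lambda>E F. qleft a E \<bullet> F)"
  unfolding bilinear_def by (auto intro!: linearI simp: qleft.add_right qleft.scaleR_right inner_add_left inner_add_right)

text \<open>Under a change of chart the orientation density is multiplied by the Jacobian
  determinant, which is therefore a quotient of two positive numbers.\<close>

lemma oriented_atlas: "oriented_atlas S A oriented_charts"
  unfolding oriented_atlas_def
proof (intro conjI)
  show "smooth_surface S oriented_charts" by (rule oriented_charts_surface)
  show "smooth_surface S (A \<union> oriented_charts)"
  proof (rule smooth_surface_reflected_charts[OF surface])
    show "A \<union> oriented_charts \<subseteq> reflected_charts A"
      using subset_reflected_charts[OF surface] oriented_charts_subset by blast
    have "(\<Union>(V, x)\<in>A. x ` V) = S" using surface unfolding smooth_surface_def by blast
    then show "(\<Union>(V, x)\<in>A \<union> oriented_charts. x ` V) = S"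
      unfolding UN_Un oriented_charts_cover by simp
  qed
  have "0 < det (jacobian (inv_into W y \<circ> x) (at u))"
    if x: "(V, x) \<in> oriented_charts" and y: "(W, y) \<in> oriented_charts" and u: "u \<in> V" "x u \<in> y ` W" for V x W y u
  proof -
    let ?\<tau> = "inv_into W y \<circ> x"
    let ?T = "frechet_derivative ?\<tau> (at u)"
    let ?L = "d\<sigma> y (?\<tau> u)"
    note tr = transition[OF oriented_charts_surface x y u]
    have y': "(W, y) \<in> reflected_charts A" using y oriented_charts_subset by blast
    note yd = reflected_chart_derivative[OF y' tr(1)]
    have "orientation_density x u = qleft (fst (\<Phi> (y (?\<tau> u)))) (?L (?T e1)) \<bullet> ?L (?T e2)"
      unfolding orientation_density_def tr(2) tr(4)[OF yd(1)] by simp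
    also have "\<dots> = (?T e1 $ 1 * ?T e2 $ 2 - ?T e1 $ 2 * ?T e2 $ 1) * orientation_density y (?\<tau> u)"
      unfolding orientation_density_def
      by (rule area_form_bilinear[OF yd(2) area_form]) (rule qleft_inner_self)
    also have "?T e1 $ 1 * ?T e2 $ 2 - ?T e1 $ 2 * ?T e2 $ 1 = det (jacobian ?\<tau> (at u))"
      by (simp add: jacobian_def matrix_def det_2)
    finally have "orientation_density x u = det (jacobian ?\<tau> (at u)) * orientation_density y (?\<tau> u)" .
    moreover have "orientation_density x u > 0" using x u(1) unfolding oriented_charts_def by blast
    moreover have "orientation_density y (?\<tau> u) > 0" using y tr(1) unfolding oriented_charts_def by blast
    ultimately show ?thesis by (simp add: zero_less_mult_iff)
  qed
  then show "\<forall>(V, x)\<in>oriented_charts. \<forall>(W, y)\<in>oriented_charts. \<forall>u\<in>V \<inter> x -` (y ` W).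
      0 < det (jacobian (inv_into W y \<circ> x) (at u))" by blast
qed

text \<open>Every admissible frame gives \<Phi> by \<open>plane_to_spheres_eq\<close>; what is left
  is to produce one, from a unit tangent vector, its rotation by \<phi>, \<open>\<sigma> p\<close>
  and the unit normal \<open>\<phi> \<sigma>\<close>.\<close>

lemma gauss_map_lift:
  assumes p: "p \<in> S"
  shows "gauss_map oriented_charts \<sigma> p = \<Phi> p"
proof -
  let ?\<phi> = "fst (\<Phi> p)" and ?\<psi> = "snd (\<Phi> p)"
  have "\<Phi> ` S \<subseteq> S2xS2" using minimal by (simp add: minimal_immersion_def)
  then have "\<Phi> p \<in> S2xS2" using p by blast
  then have U: "norm ?\<phi> = 1" "norm ?\<psi> = 1" by (simp_all add: S2xS2_def mem_Times_iff)
  have N: "norm (\<sigma> p) = 1" "in_plane ?\<phi> (- ?\<psi>) (\<sigma> p)"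
    using \<sigma>(2)[OF p] by (simp_all add: lift_values_def gauss_lifts_def)
  have det: "det (vector [a, b] :: real^2^2) = a$1 * b$2 - a$2 * b$1" for a b :: "real^2"
    by (simp add: det_2)
  have area: "qleft ?\<phi> (d\<sigma> x u a) \<bullet> d\<sigma> x u b =
      det (vector [a, b] :: real^2^2) * orientation_density x u" "orientation_density x u > 0"
      if x: "(V, x) \<in> oriented_charts" "u \<in> V" "x u = p" for V x u a b
  proof -
    have "(V, x) \<in> reflected_charts A" using x oriented_charts_subset by blast
    note xd = reflected_chart_derivative[OF this x(2)]
    show "qleft ?\<phi> (d\<sigma> x u a) \<bullet> d\<sigma> x u b =
      det (vector [a, b] :: real^2^2) * orientation_density x u"
      unfolding det orientation_density_def x(3)
      by (rule area_form_bilinear[OF xd(2) area_form]) (rule qleft_inner_self)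
    show "orientation_density x u > 0" using x unfolding oriented_charts_def by blast
  qed
  have plane: "in_plane ?\<phi> ?\<psi> (d\<sigma> x u a)"
    if x: "(V, x) \<in> oriented_charts" "u \<in> V" "x u = p" for V x u a
  proof -
    have "(V, x) \<in> reflected_charts A" using x oriented_charts_subset by blast
    from reflected_chart_derivative(4)[OF this x(2)] show ?thesis unfolding x(3) .
  qed
  have all: "plane_to_spheres v1 v2 v3 v4 = \<Phi> p"
    if "positive_frame oriented_charts \<sigma> p v1 v2" and R: "rotation_matrix (vector [v1, v2, v3, v4] :: real^4^4)"
    for v1 v2 v3 v4
  proof -
    obtain V x u a b where x: "(V, x) \<in> oriented_charts" "u \<in> V" "x u = p" and ab: "det (vector [a, b] :: real^2^2) > 0"
      and v: "v1 = d\<sigma> x u a" "v2 = d\<sigma> x u b"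
      using \<open>positive_frame oriented_charts \<sigma> p v1 v2\<close> unfolding positive_frame_def by blast
    have "qleft ?\<phi> v1 \<bullet> v2 > 0" unfolding v using area[OF x] ab by simp
    moreover have "in_plane ?\<phi> ?\<psi> v1" "in_plane ?\<phi> ?\<psi> v2" unfolding v by (rule plane[OF x])+
    ultimately show ?thesis using plane_to_spheres_eq[OF U _ _ _ R] by simp
  qed
  obtain V x u where x: "(V, x) \<in> oriented_charts" "u \<in> V" "x u = p"
    using p unfolding oriented_charts_cover[symmetric] by blast
  let ?L = "d\<sigma> x u"
  have "(V, x) \<in> reflected_charts A" using x oriented_charts_subset by blast
  note xd = reflected_chart_derivative[OF this x(2)]
  have "e1 \<noteq> 0" by (simp add: axis_eq_0_iff)
  then obtain a b where ab: "norm (?L a) = 1" "norm (?L b) = 1" "?L a \<bullet> ?L b = 0"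
    using orthonormal_pair_exists[OF xd(2,3)] by blast
  \<comment> \<open>The second vector of an orthonormal pair is the rotated first one up to sign;
    \<open>b\<close> or \<open>- b\<close> realizes the rotation itself, and the area 1 then shows
    that the frame is positive.\<close>
  obtain b' where b': "?L b' = qleft ?\<phi> (?L a)"
  proof (cases "?L b = qleft ?\<phi> (?L a)")
    case False
    then have "?L b = - qleft ?\<phi> (?L a)" using in_plane_rotate_eq[OF U(1) plane[OF x] plane[OF x] ab] by blast
    then show ?thesis using that[of "- b"] by (simp add: linear_neg[OF xd(2)])
  qed (use that in blast)
  have "qleft ?\<phi> (?L a) \<bullet> ?L b' = 1"
    unfolding b' qleft_inner_qleft using U ab(1) by (simp add: dot_square_norm)
  then have "det (vector [a, b'] :: real^2^2) * orientation_density x u > 0" using area(1)[OF x, of a b'] by simp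
  then have "det (vector [a, b'] :: real^2^2) > 0" using area(2)[OF x] by (simp add: zero_less_mult_iff)
  then have "positive_frame oriented_charts \<sigma> p (?L a) (?L b')"
    unfolding positive_frame_def using x by blast
  moreover have "rotation_matrix (vector [?L a, ?L b', \<sigma> p, qleft ?\<phi> (\<sigma> p)] :: real^4^4)"
    unfolding b' by (rule rotation_matrix_of_normal[OF U plane[OF x] ab(1) N(2,1)])
  ultimately show ?thesis
    unfolding gauss_map_def using all by (intro the_equality) blast+
qed

end

lemma isometry_S2xS2_id: "isometry_S2xS2 id"
  unfolding isometry_S2xS2_def
  by (intro conjI bij_betw_id exI[of _ UNIV] exI[of _ "\<lambda>q. q"])
    (simp_all add: smooth_on_def Ck_on_ident)

theorem theorem3:
  fixes S :: "'a::{t2_space,second_countable_topology} set"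
    and A :: "'a atlas"
    and \<Phi> :: "'a \<Rightarrow> (real^3) \<times> (real^3)"
  assumes "smooth_surface S A"
    and "simply_connected S"
    and "minimal_immersion S A S2xS2 tangent_S2xS2 \<Phi>"
    and "lagrangian A \<Phi>"
    and "\<forall>p\<in>S. C_squared A \<Phi> p < 1/4"
  shows "\<exists>B \<Psi> F. oriented_atlas S A B \<and>
           minimal_immersion S A S3 tangent_S3 \<Psi> \<and>
           isometry_S2xS2 F \<and>
           (\<forall>p\<in>S. F (\<Phi> p) = gauss_map B \<Psi> p)"
proof -
  interpret minimal_lagrangian_surface S A \<Phi> using assms by unfold_locales
  obtain \<sigma> where \<sigma>: "continuous_on S \<sigma>" "\<And>p. p \<in> S \<Longrightarrow> \<sigma> p \<in> lift_values p"
    using lift_exists[OF assms(2)] by blast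
  interpret minimal_lagrangian_lift S A \<Phi> \<sigma> using \<sigma> by unfold_locales
  have "\<forall>p\<in>S. id (\<Phi> p) = gauss_map oriented_charts \<sigma> p" using gauss_map_lift by simp
  then show ?thesis using oriented_atlas lift_minimal_immersion isometry_S2xS2_id by blast
qed

end
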